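(* Let $1\le p<\infty$ and $\alpha>-1$. Then $$J_{\mathrm{mb}}[N_\alpha^p]=\mathcal{B}\qquad\text{and}\qquad I_{\mathrm{mb}}[N_\alpha^p]=H^\infty.$$ That is, for an analytic function $g$ on $\mathbb{D}$: the operator $J_g$ is metrically bounded on $N_\alpha^p$ if and only if $g\in\mathcal{B}$, and the operator $I_g$ is metrically bounded on $N_\alpha^p$ if and only if $g\in H^\infty$.
   Context: $\mathbb{D}=\{z\in\mathbb{C}:|z|<1\}$, and $H(\mathbb{D})$ is the space of analytic functions on $\mathbb{D}$. $dA(z)=dx\,dy/\pi$ is normalized area measure and $dA_\alpha(z)=(1+\alpha)(1-|z|^2)^\alpha\,dA(z)$. For $h\in H(\mathbb{D})$, $\|h\|_{N_\alpha^p}=\left\{\int_{\mathbb{D}}[\log(1+|h(z)|)]^p\,dA_\alpha(z)\right\}^{1/p}\in[0,\infty]$ (not a norm in the usual sense). The area Nevanlinna space $N_\alpha^p$ is the set of $h\in H(\mathbb{D})$ with $\|h\|_{N_\alpha^p}<\infty$. A linear operator $T$ is called metrically bounded on $N_\alpha^p$ if there exists $C>0$ such that $\|Tf\|_{N_\alpha^p}\le C\|f\|_{N_\alpha^p}$ for all $f\in N_\alpha^p$ (in particular $Tf\in N_\alpha^p$). For $g\in H(\mathbb{D})$, the Volterra-type operators $J_g,I_g$ are defined for $f\in H(\mathbb{D})$, $z\in\mathbb{D}$ by $$J_gf(z)=\int_0^z f(\zeta)g'(\zeta)\,d\zeta,\qquad I_gf(z)=\int_0^z f'(\zeta)g(\zeta)\,d\zeta.$$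 $J_{\mathrm{mb}}[N_\alpha^p]$ is the set of $g\in H(\mathbb{D})$ such that $J_g$ is metrically bounded on $N_\alpha^p$; $I_{\mathrm{mb}}[N_\alpha^p]$ is the set of $g\in H(\mathbb{D})$ such that $I_g$ is metrically bounded on $N_\alpha^p$. $H^\infty$ is the space of bounded analytic functions on $\mathbb{D}$, and $\mathcal{B}=\{g\in H(\mathbb{D}):\sup_{z\in\mathbb{D}}(1-|z|^2)|g'(z)|<\infty\}$ is the Bloch space. *)

theory Defs
  imports "HOL-Complex_Analysis.Complex_Analysis"
begin

text \<open>
  An analytic function on the unit disc is rendered as a total function
  \<open>complex \<Rightarrow> complex\<close> that is holomorphic on \<open>unit_disk\<close>. Every notion below depends
  only on the values taken on the disc.
\<close>

abbreviation unit_disk :: "complex set" where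
  "unit_disk \<equiv> ball 0 1"

definition analytic_disk :: "(complex \<Rightarrow> complex) set" where
  "analytic_disk = {h. h holomorphic_on unit_disk}"

definition area_measure :: "complex measure" where
  "area_measure = density (restrict_space lborel unit_disk) (\<lambda>z. ennreal (1 / pi))"

definition weighted_area_measure :: "real \<Rightarrow> complex measure" where
  "weighted_area_measure \<alpha> =
     density area_measure (\<lambda>z. ennreal ((1 + \<alpha>) * (1 - (norm z)\<^sup>2) powr \<alpha>))"

text \<open>Real powers on \<open>[0, \<infinity>]\<close>; meant for exponents \<open>r > 0\<close>, where \<open>\<infinity>\<close> is sent to \<open>\<infinity>\<close>.\<close>

definition ennreal_powr :: "ennreal \<Rightarrow> real \<Rightarrow> ennreal" where
  "ennreal_powr x r = (if x = \<infinity> then \<infinity> else ennreal (enn2real x powr r))"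

definition nevanlinna_norm :: "real \<Rightarrow> real \<Rightarrow> (complex \<Rightarrow> complex) \<Rightarrow> ennreal" where
  "nevanlinna_norm p \<alpha> h =
     ennreal_powr
       (\<integral>\<^sup>+ z. ennreal (ln (1 + norm (h z)) powr p) \<partial>weighted_area_measure \<alpha>) (1 / p)"

definition nevanlinna_space :: "real \<Rightarrow> real \<Rightarrow> (complex \<Rightarrow> complex) set" where
  "nevanlinna_space p \<alpha> = {h \<in> analytic_disk. nevanlinna_norm p \<alpha> h < \<infinity>}"

definition metrically_bounded ::
    "real \<Rightarrow> real \<Rightarrow> ((complex \<Rightarrow> complex) \<Rightarrow> (complex \<Rightarrow> complex)) \<Rightarrow> bool" where
  "metrically_bounded p \<alpha> T \<longleftrightarrow>
     (\<exists>C::real. C > 0 \<and>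
        (\<forall>f \<in> nevanlinna_space p \<alpha>.
           T f \<in> nevanlinna_space p \<alpha> \<and>
           nevanlinna_norm p \<alpha> (T f) \<le> ennreal C * nevanlinna_norm p \<alpha> f))"

text \<open>
  For \<open>z\<close> in the disc the integrals from \<open>0\<close> to \<open>z\<close> are path independent, so they are taken
  along the segment.
\<close>

definition volterra_J ::
    "(complex \<Rightarrow> complex) \<Rightarrow> (complex \<Rightarrow> complex) \<Rightarrow> complex \<Rightarrow> complex" where
  "volterra_J g f z = contour_integral (linepath 0 z) (\<lambda>\<zeta>. f \<zeta> * deriv g \<zeta>)"

definition volterra_I ::
    "(complex \<Rightarrow> complex) \<Rightarrow> (complex \<Rightarrow> complex) \<Rightarrow> complex \<Rightarrow> complex" where
  "volterra_I g f z = contour_integral (linepath 0 z) (\<lambda>\<zeta>. deriv f \<zeta> * g \<zeta>)"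

definition J_mb :: "real \<Rightarrow> real \<Rightarrow> (complex \<Rightarrow> complex) set" where
  "J_mb p \<alpha> = {g \<in> analytic_disk. metrically_bounded p \<alpha> (volterra_J g)}"

definition I_mb :: "real \<Rightarrow> real \<Rightarrow> (complex \<Rightarrow> complex) set" where
  "I_mb p \<alpha> = {g \<in> analytic_disk. metrically_bounded p \<alpha> (volterra_I g)}"

definition H_infinity :: "(complex \<Rightarrow> complex) set" where
  "H_infinity = {g \<in> analytic_disk. bounded (g ` unit_disk)}"

definition bloch_space :: "(complex \<Rightarrow> complex) set" where
  "bloch_space =
     {g \<in> analytic_disk. bdd_above ((\<lambda>z. (1 - (norm z)\<^sup>2) * norm (deriv g z)) ` unit_disk)}"

end

theory Submission
  imports Defs
begin

text \<open>
  Sufficiency. If \<open>g\<close> is a Bloch function and \<open>F = J\<^sub>g f\<close>, then over one dyadic step towards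
  the boundary \<open>ln (1 + |F|)\<close> grows by at most a constant times the local supremum of
  \<open>ln (1 + |f|)\<close>, whose \<open>p\<close>-th power is controlled by an area mean because \<open>ln (1 + |f|)\<close> is
  subharmonic. Summing the steps with a slightly geometric loss \<open>\<epsilon>\<close> bounds \<open>(ln (1 + |F|))\<^sup>p\<close> by an
  integral operator with kernel \<open>(1 - |z|\<^sup>2) powr (- \<epsilon>) (1 - |\<xi>|\<^sup>2) powr (\<epsilon> - 2)\<close> on
  \<open>|\<xi> - z| < 5 (1 - |\<xi>|\<^sup>2)\<close>; by Tonelli and the size of Carleson boxes it is bounded for the weight
  \<open>(1 - |z|\<^sup>2) powr \<alpha>\<close> as soon as \<open>\<alpha> - \<epsilon> > -1\<close>. The case of \<open>I\<^sub>g\<close> follows from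
  \<open>I\<^sub>g f = f g - f(0) g(0) - J\<^sub>g f\<close>.

  Necessity. Since \<open>ln (1 + t |f|)\<close> is comparable to \<open>t |f|\<close> for small values, metric boundedness
  applied to \<open>t f\<close> yields the growth estimates of an operator bounded on the weighted Bergman space.
  Testing it on \<open>f(z) = (1 - cnj w z) powi (- n)\<close> at \<open>z = w\<close> gives the conditions on \<open>g\<close>.
\<close>

section \<open>Lebesgue measure on the complex plane\<close>


text \<open>The logarithm is the obstacle: \<open>ln (1 + |F|)\<close> is only subadditive, so the
  increments of \<open>F\<close> cannot be summed first and the logarithm taken at the end. A single
  increment bounded by \<open>M * m\<close>, with \<open>|f| \<le> m\<close> along the step, costs
  just a factor \<open>M\<close> on the logarithm, by Bernoulli's inequality
  \<open>1 + M * m \<le> (1 + m) powr M\<close>. About \<open>log 2 (1 / (1 - |z|))\<close> steps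
  lead from 0 to \<open>z\<close>. Combining them through
  \<open>(x + y) powr p \<le> E * x powr p + C * y powr p\<close> multiplies the early ones by up to
  \<open>E ^ n\<close>. For \<open>E = 2 powr \<epsilon>\<close> this is a loss of order
  \<open>(1 - |z|) powr (- \<epsilon>)\<close>, and the strict inequality \<alpha> > -1 leaves room
  for it; the usual factor \<open>2 powr (p - 1)\<close> could compound to more than the weight
  absorbs.

  Planar integration rests on Tonelli in the real and imaginary parts, on invariance under
  rotations, and on the distribution of \<open>1 - |z|^2\<close> over the disc. Together they take
  the place of polar coordinates.\<close>

lemma lborel_complex_eq:
  "(lborel :: complex measure) = distr (lborel \<Otimes>\<^sub>M lborel) borel (\<lambda>(x, y). Complex x y)"
proof (rule lborel_eqI)
  have meas [measurable]: "(\<lambda>(x, y). Complex x y) \<in> borel_measurable (lborel \<Otimes>\<^sub>M lborel)"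
    unfolding lborel_prod by (auto intro!: borel_measurable_continuous_onI continuous_intros
      simp: case_prod_beta Complex_eq)
  fix l u :: complex
  assume le: "\<And>b. b \<in> Basis \<Longrightarrow> l \<bullet> b \<le> u \<bullet> b"
  have le': "Re l \<le> Re u" "Im l \<le> Im u"
    using le[of 1] le[of \<i>] by (auto simp: Basis_complex_def)
  have pre: "(\<lambda>(x, y). Complex x y) -` box l u = {Re l<..<Re u} \<times> {Im l<..<Im u}"
    by (auto simp: in_box_complex_iff)
  have "emeasure (distr (lborel \<Otimes>\<^sub>M lborel) borel (\<lambda>(x, y). Complex x y)) (box l u)
      = emeasure (lborel \<Otimes>\<^sub>M lborel) ({Re l<..<Re u} \<times> {Im l<..<Im u})"
    by (subst emeasure_distr) (auto simp: pre space_pair_measure)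
  also have "\<dots> = ennreal (Re u - Re l) * ennreal (Im u - Im l)"
    using le' by (subst lborel.emeasure_pair_measure_Times) auto
  also have "\<dots> = ennreal (\<Prod>b\<in>Basis. (u - l) \<bullet> b)"
    using le' by (simp add: Basis_complex_def ennreal_mult)
  finally show "emeasure (distr (lborel \<Otimes>\<^sub>M lborel) borel (\<lambda>(x, y). Complex x y)) (box l u)
      = ennreal (\<Prod>b\<in>Basis. (u - l) \<bullet> b)"
    by simp
qed simp

lemma measurable_Complex [measurable]:
  "f \<in> borel_measurable M \<Longrightarrow> g \<in> borel_measurable M \<Longrightarrow> (\<lambda>x. Complex (f x) (g x)) \<in> borel_measurable M"
  unfolding Complex_eq by (intro borel_measurable_add borel_measurable_times) auto

lemma nn_integral_lborel_complex:
  assumes [measurable]: "F \<in> borel_measurable borel"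
  shows "(\<integral>\<^sup>+z. F z \<partial>lborel) = (\<integral>\<^sup>+x. \<integral>\<^sup>+y. F (Complex x y) \<partial>lborel \<partial>lborel)"
    and "(\<integral>\<^sup>+z. F z \<partial>lborel) = (\<integral>\<^sup>+y. \<integral>\<^sup>+x. F (Complex x y) \<partial>lborel \<partial>lborel)"
proof -
  have "(\<integral>\<^sup>+z. F z \<partial>lborel) = (\<integral>\<^sup>+p. F (case p of (x, y) \<Rightarrow> Complex x y) \<partial>(lborel \<Otimes>\<^sub>M lborel))"
    by (subst lborel_complex_eq, subst nn_integral_distr) (auto simp: case_prod_beta)
  also have "\<dots> = (\<integral>\<^sup>+x. \<integral>\<^sup>+y. F (Complex x y) \<partial>lborel \<partial>lborel)"
    by (subst lborel.nn_integral_fst[symmetric]) (auto simp: case_prod_beta)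
  finally show *: "(\<integral>\<^sup>+z. F z \<partial>lborel) = (\<integral>\<^sup>+x. \<integral>\<^sup>+y. F (Complex x y) \<partial>lborel \<partial>lborel)" .
  show "(\<integral>\<^sup>+z. F z \<partial>lborel) = (\<integral>\<^sup>+y. \<integral>\<^sup>+x. F (Complex x y) \<partial>lborel \<partial>lborel)"
    unfolding * by (rule lborel_pair.Fubini') (auto simp: case_prod_beta)
qed

text \<open>On each horizontal line the shear is a translation, so Tonelli reduces the claim to
  translation invariance on the real line.\<close>

lemma nn_integral_shear_Re:
  assumes [measurable]: "F \<in> borel_measurable borel"
  shows "(\<integral>\<^sup>+z. F (z + of_real (a * Im z)) \<partial>lborel) = (\<integral>\<^sup>+z. F z \<partial>lborel)"
proof -
  have "(\<integral>\<^sup>+z. F (z + of_real (a * Im z)) \<partial>lborel)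
      = (\<integral>\<^sup>+y. \<integral>\<^sup>+x. F (Complex (a * y + 1 * x) y) \<partial>lborel \<partial>lborel)"
    by (subst nn_integral_lborel_complex(2))
       (auto intro!: nn_integral_cong arg_cong[where f=F] simp: complex_eq_iff)
  also have "\<dots> = (\<integral>\<^sup>+y. \<integral>\<^sup>+x. F (Complex x y) \<partial>lborel \<partial>lborel)"
    by (subst nn_integral_real_affine[where c=1 and f="\<lambda>x. F (Complex x y)" and t="a * y" for x y]) simp_all
  also have "\<dots> = (\<integral>\<^sup>+z. F z \<partial>lborel)"
    by (subst nn_integral_lborel_complex(2)) auto
  finally show ?thesis .
qed

lemma nn_integral_shear_Im:
  assumes [measurable]: "F \<in> borel_measurable borel"
  shows "(\<integral>\<^sup>+z. F (z + \<i> * of_real (a * Re z)) \<partial>lborel) = (\<integral>\<^sup>+z. F z \<partial>lborel)"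
proof -
  have "(\<integral>\<^sup>+z. F (z + \<i> * of_real (a * Re z)) \<partial>lborel)
      = (\<integral>\<^sup>+x. \<integral>\<^sup>+y. F (Complex x (a * x + 1 * y)) \<partial>lborel \<partial>lborel)"
    by (subst nn_integral_lborel_complex(1))
       (auto intro!: nn_integral_cong arg_cong[where f=F] simp: complex_eq_iff)
  also have "\<dots> = (\<integral>\<^sup>+x. \<integral>\<^sup>+y. F (Complex x y) \<partial>lborel \<partial>lborel)"
    by (subst nn_integral_real_affine[where c=1 and f="\<lambda>y. F (Complex x y)" and t="a * x" for x y]) simp_all
  also have "\<dots> = (\<integral>\<^sup>+z. F z \<partial>lborel)"
    by (subst nn_integral_lborel_complex(1)) auto
  finally show ?thesis .
qed

text \<open>A rotation by an angle other than \<open>\<pi>\<close> is a product of three shears.\<close>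

lemma nn_integral_lborel_rotate_aux:
  assumes [measurable]: "F \<in> borel_measurable borel" and c: "norm c = 1" "c \<noteq> -1"
  shows "(\<integral>\<^sup>+z. F (c * z) \<partial>lborel) = (\<integral>\<^sup>+z. F (z :: complex) \<partial>lborel)"
proof -
  \<comment> \<open>For \<open>c = cis \<theta>\<close> this is \<open>- tan (\<theta> / 2)\<close>
    and \<open>s\<close> is \<open>sin \<theta>\<close>, the parameters of the classical
    factorisation; the excluded angle \<pi> is the pole of the tangent.\<close>
  define a where "a = - Im c / (1 + Re c)"
  define s where "s = Im c"
  have sq: "(Re c)\<^sup>2 + s\<^sup>2 = 1"
    using c by (simp add: s_def cmod_def)
  have "Re c \<noteq> -1"
    using c sq by (auto simp: complex_eq_iff s_def)
  then have r: "1 + Re c \<noteq> 0" by auto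
  have as: "a * s = Re c - 1"
    using sq r unfolding a_def s_def by (simp add: field_simps power2_eq_square)
  have aa: "a * (1 + Re c) = - s"
    using r by (simp add: a_def s_def)
  define S where "S = (\<lambda>z. z + of_real (a * Im z))"
  define T where "T = (\<lambda>z. z + \<i> * of_real (s * Re z))"
  have [measurable]: "S \<in> borel_measurable borel" "T \<in> borel_measurable borel"
    unfolding S_def T_def by measurable
  have "S (T (S z)) = c * z" for z
  proof -
    have 1: "Im (S (T (S z))) = Im (c * z)"
    proof -
      have "Im (S (T (S z))) = Im z * (1 + a * s) + s * Re z"
        by (simp add: S_def T_def algebra_simps)
      then show ?thesis unfolding as by (simp add: s_def algebra_simps)
    qed
    have "Re (S (T (S z))) = Re z * (1 + a * s) + Im z * (a * (1 + (1 + a * s)))"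
      by (simp add: S_def T_def algebra_simps)
    also have "\<dots> = Re (c * z)"
      using aa unfolding as by (simp add: s_def algebra_simps)
    finally show ?thesis using 1 by (simp add: complex_eq_iff)
  qed
  then have "(\<integral>\<^sup>+z. F (c * z) \<partial>lborel) = (\<integral>\<^sup>+z. F (S (T (S z))) \<partial>lborel)"
    by simp
  also have "\<dots> = (\<integral>\<^sup>+z. F (S (T z)) \<partial>lborel)"
    using nn_integral_shear_Re[of "\<lambda>z. F (S (T z))" a] by (simp add: S_def)
  also have "\<dots> = (\<integral>\<^sup>+z. F (S z) \<partial>lborel)"
    using nn_integral_shear_Im[of "\<lambda>z. F (S z)" s] by (simp add: T_def)
  also have "\<dots> = (\<integral>\<^sup>+z. F z \<partial>lborel)"
    using nn_integral_shear_Re[of F a] by (simp add: S_def)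
  finally show ?thesis .
qed

text \<open>The angle \<pi> is reached by rotating twice by a square root: the principal root has
  nonnegative real part and so differs from -1.\<close>

lemma nn_integral_lborel_rotate:
  assumes [measurable]: "F \<in> borel_measurable borel" and c: "norm c = 1"
  shows "(\<integral>\<^sup>+z. F (c * z) \<partial>lborel) = (\<integral>\<^sup>+z. F (z :: complex) \<partial>lborel)"
proof -
  define d where "d = csqrt c"
  have dd: "d * d = c" by (metis d_def power2_csqrt power2_eq_square)
  have d: "norm d = 1" using c by (simp add: d_def)
  have "Re d \<ge> 0" unfolding d_def using csqrt_principal[of c] by auto
  then have "d \<noteq> -1" by (auto simp: complex_eq_iff)
  note rot = nn_integral_lborel_rotate_aux[OF _ d this]
  have "(\<integral>\<^sup>+z. F (c * z) \<partial>lborel) = (\<integral>\<^sup>+z. F (d * (d * z)) \<partial>lborel)"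
    by (simp add: dd[symmetric] mult.assoc)
  also have "\<dots> = (\<integral>\<^sup>+z. F z \<partial>lborel)"
    using rot[of "\<lambda>z. F (d * z)"] rot[of F] by simp
  finally show ?thesis .
qed


section \<open>Carleson boxes\<close>

text \<open>The unnormalised density of \<open>weighted_area_measure\<close>, extended by zero so
  that every integral is taken over the plane with respect to \<open>lborel\<close>. The exponent
  will be \<alpha>, \<alpha> - \<epsilon> or, inside a kernel, \<epsilon> - 2.\<close>

definition disk_weight :: "real \<Rightarrow> complex \<Rightarrow> ennreal" where
  "disk_weight \<beta> z = indicator unit_disk z * ennreal ((1 - (norm z)\<^sup>2) powr \<beta>)"

lemma ball_in_borel [measurable]: "ball (a :: 'a::euclidean_space) r \<in> sets borel"
  by simp

lemma measurable_disk_weight [measurable]: "disk_weight \<beta> \<in> borel_measurable borel"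
  unfolding disk_weight_def[abs_def] by measurable

lemma emeasure_ball_complex: "r \<ge> 0 \<Longrightarrow> emeasure lborel (ball (c::complex) r) = ennreal (pi * r\<^sup>2)"
  by (simp add: emeasure_ball unit_ball_vol_2)

text \<open>This stands in for polar coordinates. Half-lines suffice to identify the measure, and
  for \<open>a\<close> between 0 and 1 the preimage of \<open>{a<..}\<close> is a centred ball of
  radius \<open>sqrt (1 - a)\<close>, whose area is linear in \<open>a\<close>; hence the uniform
  density.\<close>

lemma distr_norm_square_disk:
  "distr (density lborel (indicator unit_disk)) borel (\<lambda>z::complex. 1 - (norm z)\<^sup>2)
     = density lborel (\<lambda>s. ennreal pi * indicator {0<..1} s)" (is "?M = ?N")
proof (rule measure_eqI_lessThan)
  have eq: "emeasure ?M {a<..} = ennreal (pi * (if a \<ge> 1 then 0 else if a \<ge> 0 then 1 - a else 1))" for a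
  proof -
    have [measurable]: "(\<lambda>z::complex. 1 - (norm z)\<^sup>2) \<in> borel_measurable borel" by measurable
    have "emeasure ?M {a<..} = emeasure (density lborel (indicator unit_disk)) {z::complex. a < 1 - (norm z)\<^sup>2}"
      by (subst emeasure_distr) (auto simp: vimage_def)
    also have "\<dots> = (\<integral>\<^sup>+z. indicator (unit_disk \<inter> {z. a < 1 - (norm z)\<^sup>2}) z \<partial>lborel)"
      by (subst emeasure_density, measurable) (intro nn_integral_cong, auto split: split_indicator)
    also have "\<dots> = emeasure lborel (unit_disk \<inter> {z::complex. a < 1 - (norm z)\<^sup>2})"
      by (subst nn_integral_indicator) auto
    also have "unit_disk \<inter> {z::complex. a < 1 - (norm z)\<^sup>2} =
        ball 0 (if a \<ge> 1 then 0 else if a \<ge> 0 then sqrt (1 - a) else 1)"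
    proof -
      have q: "(norm z)\<^sup>2 < 1 - a \<longleftrightarrow> norm z < sqrt (1 - a)" for z :: complex
        by (metis norm_ge_zero real_sqrt_less_iff real_sqrt_unique)
      have t: "norm z < 1 \<Longrightarrow> (norm z)\<^sup>2 < 1" for z :: complex
        by (simp add: power_less_one_iff)
      consider "a \<ge> 1" | "0 \<le> a" "a < 1" | "a < 0" by linarith
      then show ?thesis
      proof cases
        case 1
        have "\<not> a < 1 - (norm z)\<^sup>2" for z :: complex
          using 1 zero_le_power2[of "norm z"] by linarith
        then show ?thesis using 1 by auto
      next
        case 2
        have "sqrt (1 - a) \<le> 1" using 2 by simp
        then have "norm z < 1 \<and> a < 1 - (norm z)\<^sup>2 \<longleftrightarrow> norm z < sqrt (1 - a)" for z :: complex
          using q[of z] by linarith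
        then show ?thesis
          unfolding set_eq_iff Int_iff mem_Collect_eq mem_ball dist_0_norm using 2 by simp
      next
        case 3
        have "norm z < 1 \<and> a < 1 - (norm z)\<^sup>2 \<longleftrightarrow> norm z < 1" for z :: complex
          using t[of z] 3 by linarith
        then show ?thesis
          unfolding set_eq_iff Int_iff mem_Collect_eq mem_ball dist_0_norm using 3 by simp
      qed
    qed
    also have "emeasure lborel \<dots> = ennreal (pi * (if a \<ge> 1 then 0 else if a \<ge> 0 then 1 - a else 1))"
      by (subst emeasure_ball_complex) auto
    finally show ?thesis .
  qed
  show "emeasure ?M {a<..} < \<infinity>" for a
    unfolding eq by simp
  show "emeasure ?M {a<..} = emeasure ?N {a<..}" for a
  proof -
    have "emeasure ?N {a<..} = (\<integral>\<^sup>+s. ennreal pi * indicator ({0<..1} \<inter> {a<..}) s \<partial>lborel)"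
      by (subst emeasure_density) (auto simp: intro!: nn_integral_cong split: split_indicator)
    also have "\<dots> = ennreal pi * emeasure lborel ({0<..1} \<inter> {a<..})"
      by (subst nn_integral_cmult_indicator) auto
    also have "{0<..1} \<inter> {a<..} = {max 0 a<..1}" by auto
    finally show ?thesis unfolding eq
      by (cases "a \<ge> 1") (auto simp: ennreal_mult' max_def)
  qed
qed auto

lemma nn_integral_disk_weight_annulus:
  assumes \<beta>: "\<beta> > -1" and h: "h \<ge> 0"
  shows "(\<integral>\<^sup>+z. disk_weight \<beta> z * indicator {z. 1 - (norm z)\<^sup>2 < h} z \<partial>lborel)
           \<le> ennreal (pi * (h powr (\<beta> + 1) / (\<beta> + 1)))"
proof -
  have "(\<integral>\<^sup>+z. disk_weight \<beta> z * indicator {z. 1 - (norm z)\<^sup>2 < h} z \<partial>lborel)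
     = (\<integral>\<^sup>+s. ennreal (s powr \<beta>) * indicator {..<h} s
          \<partial>distr (density lborel (indicator unit_disk)) borel (\<lambda>z::complex. 1 - (norm z)\<^sup>2))"
  proof -
    have [measurable]: "(\<lambda>z::complex. 1 - (norm z)\<^sup>2) \<in> borel_measurable borel" by measurable
    show ?thesis
      by (subst nn_integral_distr, measurable, subst nn_integral_density, measurable)
         (auto simp: disk_weight_def mult_ac intro!: nn_integral_cong split: split_indicator)
  qed
  also have "\<dots> = (\<integral>\<^sup>+s. ennreal pi * indicator {0<..1} s * (ennreal (s powr \<beta>) * indicator {..<h} s) \<partial>lborel)"
    unfolding distr_norm_square_disk by (subst nn_integral_density) auto
  \<comment> \<open>Forgetting \<open>s \<le> 1\<close> gives an upper bound of one form for all
    \<open>h\<close>, including \<open>h > 1\<close>.\<close>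
  also have "\<dots> \<le> (\<integral>\<^sup>+s. ennreal pi * (ennreal (s powr \<beta>) * indicator {0..h} s) \<partial>lborel)"
    by (intro nn_integral_mono) (auto split: split_indicator)
  also have "\<dots> = ennreal pi * ennreal (h powr (\<beta> + 1) / (\<beta> + 1))"
    by (subst nn_integral_cmult, simp)
       (subst nn_integral_has_integral_lebesgue'[OF _ has_integral_powr_from_0], use \<beta> h in auto)
  also have "\<dots> = ennreal (pi * (h powr (\<beta> + 1) / (\<beta> + 1)))"
    using \<beta> by (subst ennreal_mult[symmetric]) auto
  finally show ?thesis .
qed

lemma nn_integral_disk_weight:
  assumes \<beta>: "\<beta> > -1"
  shows "(\<integral>\<^sup>+z. disk_weight \<beta> z \<partial>lborel) \<le> ennreal (pi * (2 powr (\<beta> + 1) / (\<beta> + 1)))"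
proof -
  \<comment> \<open>The annulus is cut out by a strict inequality, so the threshold has to exceed
    the value 1 attained at the centre.\<close>
  have "1 - (cmod z)\<^sup>2 < 2" for z by (smt (verit) zero_le_power2)
  then have "(\<integral>\<^sup>+z. disk_weight \<beta> z \<partial>lborel)
      = (\<integral>\<^sup>+z. disk_weight \<beta> z * indicator {z. 1 - (norm z)\<^sup>2 < 2} z \<partial>lborel)"
    by (intro nn_integral_cong) (auto split: split_indicator)
  also have "\<dots> \<le> ennreal (pi * (2 powr (\<beta> + 1) / (\<beta> + 1)))"
    by (rule nn_integral_disk_weight_annulus) (use \<beta> in auto)
  finally show ?thesis .
qed

section \<open>Packing rotated balls along the unit circle\<close>

lemma half_le_sin:
  assumes "0 \<le> x" "x \<le> (1::real)"
  shows "x / 2 \<le> sin x"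
proof -
  have "sin 0 - 0 / 2 \<le> sin x - x / 2"
  proof (rule DERIV_nonneg_imp_nondecreasing[OF assms(1)])
    fix t :: real assume t: "0 \<le> t" "t \<le> x"
    have "cos (pi / 3) \<le> cos t"
      using t assms pi_gt3 by (intro cos_monotone_0_pi_le) auto
    then show "\<exists>y. ((\<lambda>a. sin a - a / 2) has_real_derivative y) (at t) \<and> 0 \<le> y"
      by (intro exI[of _ "cos t - 1/2"]) (auto intro!: derivative_eq_intros simp: cos_60)
  qed
  then show ?thesis by simp
qed

text \<open>Separates the centres of the rotated balls. Rotating \<open>cis x\<close> to 1 leaves
  \<open>cis (y - x) - 1\<close>, whose imaginary part is a sine.\<close>

lemma norm_cis_diff_ge:
  assumes "x \<le> y" "y - x \<le> 1"
  shows "(y - x) / 2 \<le> norm (cis y - cis x)"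
proof -
  have "cis y - cis x = cis x * (cis (y - x) - 1)"
    by (simp add: algebra_simps cis_mult)
  then have "norm (cis y - cis x) = norm (cis (y - x) - 1)"
    by (simp add: norm_mult)
  also have "\<dots> \<ge> \<bar>Im (cis (y - x) - 1)\<bar>" by (rule abs_Im_le_cmod)
  finally show ?thesis using half_le_sin[of "y - x"] assms by auto
qed

text \<open>Geometric arguments produce the distance \<open>1 - norm z\<close>, the measure carries
  \<open>1 - (norm z)^2\<close>; these bounds convert between the two.\<close>

lemma one_minus_norm_square_le:
  assumes "norm (z :: complex) \<le> 1"
  shows "1 - norm z \<le> 1 - (norm z)\<^sup>2" "1 - (norm z)\<^sup>2 \<le> 2 * (1 - norm z)"
proof -
  have "(norm z)\<^sup>2 \<le> norm z"
    using mult_right_mono[OF assms, of "norm z"] by (simp add: power2_eq_square)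
  then show "1 - norm z \<le> 1 - (norm z)\<^sup>2" by simp
  have "0 \<le> (1 - norm z)\<^sup>2" by simp
  then show "1 - (norm z)\<^sup>2 \<le> 2 * (1 - norm z)" by (simp add: power2_eq_square algebra_simps)
qed

lemma disk_weight_rotate: "norm c = 1 \<Longrightarrow> disk_weight \<beta> (c * z) = disk_weight \<beta> z"
  by (auto simp: disk_weight_def norm_mult split: split_indicator)

text \<open>
  About \<open>1 / (4 h)\<close> rotated copies of the ball are disjoint, and all meet the disc inside the
  annulus \<open>1 - |z|\<^sup>2 < 2 h\<close>.
\<close>

lemma disk_weight_Carleson_small:
  assumes \<beta>: "\<beta> > -1" and a: "norm a = 1" and h: "0 < h" "h < 1 / 8"
  shows "(\<integral>\<^sup>+z. disk_weight \<beta> z * indicator (ball a h) z \<partial>lborel)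
           \<le> ennreal (8 * h * (pi * ((2 * h) powr (\<beta> + 1) / (\<beta> + 1))))" (is "?I \<le> _")
proof -
  \<comment> \<open>The copies are spaced by the angle \<open>4 * h\<close>, so this many fit into
    an arc of length 1, the range of \<open>norm_cis_diff_ge\<close>.\<close>
  define N where "N = nat \<lfloor>1 / (4 * h)\<rfloor>"
  have N: "real N \<le> 1 / (4 * h)" "1 / (8 * h) \<le> real N"
  proof -
    \<comment> \<open>Here \<open>h < 1 / 8\<close> enters: a number that is at least 2 loses at
      most half of itself when rounded down.\<close>
    have "2 \<le> 1 / (4 * h)" using h by (simp add: field_simps)
    moreover have "1 / (8 * h) = 1 / (4 * h) / 2" by simp
    moreover have "real N = of_int \<lfloor>1 / (4 * h)\<rfloor>" using h by (simp add: N_def)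
    ultimately show "real N \<le> 1 / (4 * h)" "1 / (8 * h) \<le> real N" by linarith+
  qed
  define c where "c = (\<lambda>k::nat. cis (4 * h * real k))"
  have nc: "norm (c k) = 1" for k by (simp add: c_def)
  \<comment> \<open>An arc of length \<open>4 * h\<close> has a chord of at least
    \<open>2 * h\<close>, which makes open balls of radius \<open>h\<close> disjoint.\<close>
  have far: "2 * h \<le> norm (c l - c k)" if "k < l" "l < N" for k l
  proof -
    have "4 * h * real l \<le> 4 * h * real N" using that h by simp
    also have "\<dots> \<le> 4 * h * (1 / (4 * h))" using N(1) h by (intro mult_left_mono) auto
    also have "\<dots> = 1" using h by simp
    finally have le: "4 * h * real l \<le> 1" .
    have kl: "real k + 1 \<le> real l" using that by linarith
    have "2 * h * (real l - real k) \<ge> 2 * h * 1" using kl h by (intro mult_left_mono) auto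
    moreover have "(4 * h * real l - 4 * h * real k) / 2 \<le> norm (c l - c k)"
      unfolding c_def
    proof (rule norm_cis_diff_ge)
      show "4 * h * real k \<le> 4 * h * real l" using kl h by simp
      have "0 \<le> 4 * h * real k" using h by simp
      then show "4 * h * real l - 4 * h * real k \<le> 1" using le by linarith
    qed
    ultimately show ?thesis by (simp add: algebra_simps)
  qed
  have disj: "disjoint_family_on (\<lambda>k. ball (c k * a) h) {..<N}"
  proof -
    have *: "ball (c k * a) h \<inter> ball (c l * a) h = {}" if "k < l" "l < N" for k l
    proof -
      have "dist (c k * a) (c l * a) = norm (c l - c k)"
        using a by (simp add: dist_norm norm_minus_commute left_diff_distrib[symmetric] norm_mult)
      then have "2 * h \<le> dist (c k * a) (c l * a)" using far[OF that] by simp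
      then show ?thesis by (intro disjoint_ballI) simp
    qed
    show ?thesis unfolding disjoint_family_on_def
      using * by (metis Int_commute lessThan_iff linorder_neqE_nat)
  qed
  have rot: "(\<integral>\<^sup>+z. disk_weight \<beta> z * indicator (ball (c k * a) h) z \<partial>lborel) = ?I" for k
  proof -
    have "?I = (\<integral>\<^sup>+z. disk_weight \<beta> (cnj (c k) * z) * indicator (ball a h) (cnj (c k) * z) \<partial>lborel)"
      by (rule nn_integral_lborel_rotate[symmetric]) (auto simp: nc)
    also have "\<dots> = (\<integral>\<^sup>+z. disk_weight \<beta> z * indicator (ball (c k * a) h) z \<partial>lborel)"
    proof (intro nn_integral_cong)
      fix z
      have "cnj (c k) * (c k * a - z) = a - cnj (c k) * z"
        using nc[of k] complex_norm_square[of "c k"] by (simp add: algebra_simps)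
      then have "dist a (cnj (c k) * z) = norm (cnj (c k) * (c k * a - z))"
        by (simp add: dist_norm)
      also have "\<dots> = dist (c k * a) z" by (simp add: norm_mult nc dist_norm)
      finally show "disk_weight \<beta> (cnj (c k) * z) * indicator (ball a h) (cnj (c k) * z)
          = disk_weight \<beta> z * indicator (ball (c k * a) h) z"
        by (simp add: disk_weight_rotate nc split: split_indicator)
    qed
    finally show ?thesis by simp
  qed
  have "of_nat N * ?I = (\<Sum>k<N. \<integral>\<^sup>+z. disk_weight \<beta> z * indicator (ball (c k * a) h) z \<partial>lborel)"
    by (simp add: rot)
  also have "\<dots> = (\<integral>\<^sup>+z. (\<Sum>k<N. disk_weight \<beta> z * indicator (ball (c k * a) h) z) \<partial>lborel)"
    by (subst nn_integral_sum) auto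
  also have "\<dots> = (\<integral>\<^sup>+z. disk_weight \<beta> z * indicator (\<Union>k<N. ball (c k * a) h) z \<partial>lborel)"
    using disj by (simp add: indicator_UN_disjoint sum_distrib_left)
  also have "\<dots> \<le> (\<integral>\<^sup>+z. disk_weight \<beta> z * indicator {z. 1 - (norm z)\<^sup>2 < 2 * h} z \<partial>lborel)"
  proof (intro nn_integral_mono)
    fix z
    have "1 - (norm z)\<^sup>2 < 2 * h" if "norm z < 1" "z \<in> ball (c k * a) h" for k
    proof -
      have "norm (c k * a) \<le> norm (c k * a - z) + norm z" by (metis norm_triangle_sub add.commute)
      then have "1 - norm z < h" using that nc a by (simp add: dist_norm norm_mult)
      then show ?thesis using one_minus_norm_square_le(2)[of z] that by simp
    qed
    then show "disk_weight \<beta> z * indicator (\<Union>k<N. ball (c k * a) h) z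
        \<le> disk_weight \<beta> z * indicator {z. 1 - (norm z)\<^sup>2 < 2 * h} z"
      by (auto simp: disk_weight_def split: split_indicator)
  qed
  also have "\<dots> \<le> ennreal (pi * ((2 * h) powr (\<beta> + 1) / (\<beta> + 1)))"
    by (rule nn_integral_disk_weight_annulus) (use \<beta> h in auto)
  finally have *: "of_nat N * ?I \<le> ennreal (pi * ((2 * h) powr (\<beta> + 1) / (\<beta> + 1)))" .
  \<comment> \<open>All copies have the same mass, so the lower bound on their number turns the mass
    of the annulus into a bound for one ball.\<close>
  have "1 \<le> 8 * h * real N" using N(2) h by (simp add: field_simps)
  then have "ennreal 1 * ?I \<le> ennreal (8 * h * real N) * ?I"
    by (intro mult_right_mono) auto
  then have "?I \<le> ennreal (8 * h) * (of_nat N * ?I)"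
    using h by (simp add: ennreal_mult mult.assoc ennreal_of_nat_eq_real_of_nat)
  also have "\<dots> \<le> ennreal (8 * h) * ennreal (pi * ((2 * h) powr (\<beta> + 1) / (\<beta> + 1)))"
    by (intro mult_left_mono *) auto
  also have "\<dots> = ennreal (8 * h * (pi * ((2 * h) powr (\<beta> + 1) / (\<beta> + 1))))"
    using h \<beta> by (subst ennreal_mult) auto
  finally show ?thesis .
qed

text \<open>Small balls are covered by the packing bound, of order
  \<open>h * h powr (\<beta> + 1)\<close>. For \<open>h \<ge> 1 / 8\<close> the finite mass of the
  whole disc is enough, since \<open>(8 * h) powr (\<beta> + 2) \<ge> 1\<close>. The constant
  \<open>8 powr (\<beta> + 2)\<close> also covers the factor 8 of the packing, because \<beta> + 2
  \<ge> 1.\<close>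

lemma disk_weight_Carleson:
  assumes \<beta>: "\<beta> > -1"
  obtains C where "C > 0"
    "\<And>a h. norm a = 1 \<Longrightarrow> h > 0 \<Longrightarrow>
       (\<integral>\<^sup>+z. disk_weight \<beta> z * indicator (ball a h) z \<partial>lborel) \<le> ennreal (C * h powr (\<beta> + 2))"
proof
  define K where "K = pi * (2 powr (\<beta> + 1) / (\<beta> + 1))"
  have K: "K > 0" using \<beta> by (simp add: K_def)
  show "8 powr (\<beta> + 2) * K > 0" using K by simp
  fix a :: complex and h :: real
  assume a: "norm a = 1" and h: "h > 0"
  show "(\<integral>\<^sup>+z. disk_weight \<beta> z * indicator (ball a h) z \<partial>lborel) \<le> ennreal (8 powr (\<beta> + 2) * K * h powr (\<beta> + 2))"
  proof (cases "h < 1 / 8")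
    case True
    have "(8::real) powr 1 \<le> 8 powr (\<beta> + 2)" using \<beta> by (intro powr_mono) auto
    then have "8 * (K * h powr (\<beta> + 2)) \<le> 8 powr (\<beta> + 2) * (K * h powr (\<beta> + 2))"
      using K by (intro mult_right_mono) auto
    moreover have "8 * h * (pi * ((2 * h) powr (\<beta> + 1) / (\<beta> + 1))) = 8 * (K * h powr (\<beta> + 2))"
    proof -
      have "h powr (\<beta> + 2) = h * h powr (\<beta> + 1)"
        using h powr_add[of h 1 "\<beta> + 1"] by (simp add: add_ac)
      then show ?thesis using h by (simp add: K_def powr_mult)
    qed
    ultimately show ?thesis
      using disk_weight_Carleson_small[OF \<beta> a h True] by (smt (verit) ennreal_leI mult.assoc order_trans)
  next
    case False
    have "(\<integral>\<^sup>+z. disk_weight \<beta> z * indicator (ball a h) z \<partial>lborel) \<le> (\<integral>\<^sup>+z. disk_weight \<beta> z \<partial>lborel)"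
      by (intro nn_integral_mono) (auto split: split_indicator)
    also have "\<dots> \<le> ennreal K" unfolding K_def by (rule nn_integral_disk_weight[OF \<beta>])
    also have "K \<le> 8 powr (\<beta> + 2) * K * h powr (\<beta> + 2)"
    proof -
      have "1 \<le> (8 * h) powr (\<beta> + 2)" using False \<beta> by (intro ge_one_powr_ge_zero) auto
      then show ?thesis using K h by (simp add: powr_mult)
    qed
    finally show ?thesis by (simp add: ennreal_leI)
  qed
qed


section \<open>Subharmonicity\<close>

abbreviation circ :: "real \<Rightarrow> complex" where
  "circ t \<equiv> cis (2 * pi * t)"

text \<open>Cauchy's integral formula, with the circle parametrised over an interval of length 1 so
  that the integral is already the mean.\<close>

lemma has_integral_circle_mean:
  assumes "q holomorphic_on UNIV"
  shows "((\<lambda>t. q (circ t)) has_integral q 0) {0..1}"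
proof -
  have "((\<lambda>u. q u / (u - 0)) has_contour_integral (2 * of_real pi * \<i> * q 0)) (circlepath 0 1)"
    using assms by (intro Cauchy_integral_circlepath_simple) (auto intro: holomorphic_on_subset)
  then have "((\<lambda>t. q (circ t) * (2 * of_real pi * \<i>)) has_integral (q 0 * (2 * of_real pi * \<i>))) {0..1}"
    unfolding has_contour_integral vector_derivative_circlepath
    by (simp add: circlepath cis_conv_exp mult_ac)
  from has_integral_mult_left[OF this, of "inverse (2 * of_real pi * \<i>)"] show ?thesis
    by (simp add: field_simps)
qed

text \<open>The traces on the circle of harmonic polynomials. One analytic polynomial encodes both
  the trace and its harmonic extension; negative frequencies are absorbed because conjugation does
  not change a real part.\<close>

definition Re_poly_on_circle :: "(complex \<Rightarrow> real) \<Rightarrow> bool" where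
  "Re_poly_on_circle \<phi> \<longleftrightarrow> (\<exists>p. \<forall>z. norm z = 1 \<longrightarrow> \<phi> z = Re (poly p z))"

lemma Re_poly_on_circle_add:
  "Re_poly_on_circle \<phi> \<Longrightarrow> Re_poly_on_circle \<psi> \<Longrightarrow> Re_poly_on_circle (\<lambda>z. \<phi> z + \<psi> z)"
  unfolding Re_poly_on_circle_def by (metis poly_add plus_complex.sel(1))

lemma Re_poly_on_circle_sum:
  "finite I \<Longrightarrow> (\<And>i. i \<in> I \<Longrightarrow> Re_poly_on_circle (\<phi> i)) \<Longrightarrow> Re_poly_on_circle (\<lambda>z. \<Sum>i\<in>I. \<phi> i z)"
proof (induction I rule: finite_induct)
  case empty
  then show ?case by (auto simp: Re_poly_on_circle_def intro!: exI[of _ 0])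
next
  case (insert i I)
  then show ?case by (simp add: Re_poly_on_circle_add)
qed

lemma Re_poly_on_circle_monom: "Re_poly_on_circle (\<lambda>z. Re (a * z ^ n))"
  unfolding Re_poly_on_circle_def by (auto simp: poly_monom intro!: exI[of _ "monom a n"])

text \<open>On the circle \<open>cnj z\<close> is the inverse of \<open>z\<close>, so in
  \<open>2 * (Re A * Re B) = Re (A * B) + Re (A * cnj B)\<close> the second product is again a
  multiple of a power of \<open>z\<close>; \<open>n \<le> m\<close> keeps its exponent
  natural.\<close>

lemma Re_poly_on_circle_mult_monom:
  assumes "n \<le> m"
  shows "Re_poly_on_circle (\<lambda>z. Re (a * z ^ m) * Re (b * z ^ n))"
proof -
  have "Re_poly_on_circle (\<lambda>z. Re (a * b / 2 * z ^ (m + n)) + Re (a * cnj b / 2 * z ^ (m - n)))"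
    by (intro Re_poly_on_circle_add Re_poly_on_circle_monom)
  moreover have "Re (a * z ^ m) * Re (b * z ^ n)
      = Re (a * b / 2 * z ^ (m + n)) + Re (a * cnj b / 2 * z ^ (m - n))" if "norm z = 1" for z
  proof -
    have Re_mult: "2 * (Re A * Re B) = Re (A * B) + Re (A * cnj B)" for A B by simp
    have half: "Re (x / 2 * y) = Re (x * y) / 2" for x y by simp
    have zz: "z * cnj z = 1" using complex_norm_square[of z] that by simp
    have "z ^ m * cnj z ^ n = z ^ (m - n) * (z * cnj z) ^ n"
      using assms by (simp add: power_mult_distrib mult.assoc[symmetric] power_add[symmetric])
    then have "a * z ^ m * cnj (b * z ^ n) = a * cnj b * z ^ (m - n)"
      by (simp add: zz mult_ac)
    then have e: "Re (a * cnj b * z ^ (m - n)) = Re (a * z ^ m * cnj (b * z ^ n))" by (simp only:)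
    have "a * b * z ^ (m + n) = (a * z ^ m) * (b * z ^ n)" by (simp add: power_add mult_ac)
    then have e': "Re (a * b * z ^ (m + n)) = Re ((a * z ^ m) * (b * z ^ n))" by (simp only:)
    have "2 * (Re (a * z ^ m) * Re (b * z ^ n)) = Re (a * b * z ^ (m + n)) + Re (a * cnj b * z ^ (m - n))"
      unfolding e e' by (rule Re_mult)
    then show ?thesis unfolding half by linarith
  qed
  ultimately show ?thesis unfolding Re_poly_on_circle_def by metis
qed

lemma Re_poly_on_circle_mult:
  assumes "Re_poly_on_circle \<phi>" "Re_poly_on_circle \<psi>"
  shows "Re_poly_on_circle (\<lambda>z. \<phi> z * \<psi> z)"
proof -
  obtain p q where p: "\<And>z. norm z = 1 \<Longrightarrow> \<phi> z = Re (poly p z)"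
      and q: "\<And>z. norm z = 1 \<Longrightarrow> \<psi> z = Re (poly q z)"
    using assms unfolding Re_poly_on_circle_def by metis
  have mono: "Re_poly_on_circle (\<lambda>z. Re (a * z ^ m) * Re (b * z ^ n))" for a b m n
    using Re_poly_on_circle_mult_monom[of n m a b] Re_poly_on_circle_mult_monom[of m n b a]
    by (cases "n \<le> m") (auto simp: mult.commute)
  have "Re_poly_on_circle (\<lambda>z. \<Sum>i\<le>degree p. \<Sum>j\<le>degree q. Re (coeff p i * z ^ i) * Re (coeff q j * z ^ j))"
    by (intro Re_poly_on_circle_sum mono) auto
  moreover have "(\<Sum>i\<le>degree p. \<Sum>j\<le>degree q. Re (coeff p i * z ^ i) * Re (coeff q j * z ^ j))
      = Re (poly p z) * Re (poly q z)" for z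
    by (simp only: poly_altdef Re_sum sum_product)
  ultimately show ?thesis
    using p q unfolding Re_poly_on_circle_def by metis
qed

lemma real_polynomial_function_Re_poly_on_circle:
  "real_polynomial_function \<phi> \<Longrightarrow> Re_poly_on_circle \<phi>"
proof (induction rule: real_polynomial_function.induct)
  case (linear f)
  interpret bounded_linear f by fact
  \<comment> \<open>A real-linear functional on the plane is the real part of multiplication by a
    complex number, determined by the values at 1 and \<open>\<i>\<close>.\<close>
  have "f z = Re (Complex (f 1) (- f \<i>) * z ^ 1)" for z
  proof -
    have "f z = f (Re z *\<^sub>R 1 + Im z *\<^sub>R \<i>)"
      by (rule arg_cong[where f=f]) (simp add: complex_eq_iff)
    then show ?thesis by (simp add: add scaleR)
  qed
  then have "f = (\<lambda>z. Re (Complex (f 1) (- f \<i>) * z ^ 1))" by (rule ext)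
  then show ?case using Re_poly_on_circle_monom[of "Complex (f 1) (- f \<i>)" 1] by (simp only:)
next
  case (const c)
  show ?case using Re_poly_on_circle_monom[of "of_real c" 0] by simp
next
  case (add f g)
  then show ?case by (intro Re_poly_on_circle_add)
next
  case (mult f g)
  then show ?case by (intro Re_poly_on_circle_mult)
qed

lemma continuous_on_circ_compose:
  assumes "continuous_on (sphere 0 1) u"
  shows "continuous_on A (\<lambda>t. u (circ t))"
  by (rule continuous_on_compose2[OF assms]) (auto simp: cis_conv_exp intro!: continuous_intros)

text \<open>
  Approximating \<open>ln (1 + |f|)\<close> on the circle by \<open>Re p\<close> with a polynomial \<open>p\<close> reduces its
  sub-mean value property to the maximum principle for \<open>(1 + c f) exp (- p)\<close>; the zeros of
  \<open>1 + c f\<close> are irrelevant.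
\<close>

lemma circle_submean_unit:
  assumes cont: "continuous_on (cball 0 1) f" and hol: "f holomorphic_on ball 0 1"
  shows "ln (1 + norm (f 0)) \<le> integral {0..1} (\<lambda>t. ln (1 + norm (f (circ t))))"
proof (rule field_le_epsilon)
  fix e :: real assume e: "e > 0"
  define u where "u = (\<lambda>z. ln (1 + norm (f z)))"
  have contu: "continuous_on (sphere 0 1) u"
    unfolding u_def using continuous_on_subset[OF cont sphere_cball]
    by (intro continuous_intros) (auto simp: add_nonneg_eq_0_iff)
  obtain g where g: "real_polynomial_function g" "\<And>x. x \<in> sphere 0 1 \<Longrightarrow> \<bar>u x - g x\<bar> < e / 2"
    using Stone_Weierstrass_real_polynomial_function[OF compact_sphere contu, of "e / 2"] e by auto
  obtain p where p: "\<And>z. norm z = 1 \<Longrightarrow> g z = Re (poly p z)"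
    using real_polynomial_function_Re_poly_on_circle[OF g(1)] unfolding Re_poly_on_circle_def by metis
  have up: "\<bar>u z - Re (poly p z)\<bar> < e / 2" if "norm z = 1" for z
    using g(2)[of z] p[OF that] that by simp
  \<comment> \<open>Turns \<open>f 0\<close> onto the positive axis:
    \<open>norm (1 + c * f 0)\<close> equals \<open>1 + norm (f 0)\<close>, while
    \<open>norm (1 + c * f z) \<le> 1 + norm (f z)\<close> holds everywhere. If
    \<open>f 0 = 0\<close>, then \<open>c = 0\<close> and both remain true.\<close>
  define c where "c = cnj (sgn (f 0))"
  have c: "norm c \<le> 1" "c * f 0 = of_real (norm (f 0))"
  proof -
    show "norm c \<le> 1" by (simp add: c_def norm_sgn)
    have "c * f 0 = f 0 * cnj (f 0) / of_real (norm (f 0))"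
      by (simp add: c_def sgn_eq)
    also have "\<dots> = of_real (norm (f 0))"
      unfolding complex_norm_square[symmetric] by (simp add: power2_eq_square)
    finally show "c * f 0 = of_real (norm (f 0))" .
  qed
  have expu: "exp (u z) = 1 + norm (f z)" for z
    unfolding u_def by (rule exp_ln) (simp add: add_pos_nonneg)
  define h where "h = (\<lambda>z. (1 + c * f z) * exp (- poly p z))"
  have "norm (h 0) \<le> exp (e / 2)"
  proof (rule maximum_modulus_frontier[of h "ball 0 1"])
    show "h holomorphic_on interior (ball 0 1)"
      using hol unfolding h_def by (auto intro!: holomorphic_intros)
    show "continuous_on (closure (ball 0 1)) h"
      using cont unfolding h_def by (auto intro!: continuous_intros)
    fix z :: complex assume "z \<in> frontier (ball 0 1)"
    then have z: "norm z = 1" by simp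
    have "norm (1 + c * f z) \<le> 1 + norm c * norm (f z)"
      by (metis norm_mult norm_one norm_triangle_ineq)
    also have "\<dots> \<le> 1 + norm (f z)" using c(1) by (simp add: mult_left_le_one_le)
    also have "\<dots> = exp (u z)" by (simp only: expu)
    finally have "norm (h z) \<le> exp (u z) * exp (- Re (poly p z))"
      unfolding h_def norm_mult by (simp add: norm_exp_eq_Re mult_right_mono)
    also have "\<dots> = exp (u z - Re (poly p z))" by (simp add: mult_exp_exp)
    also have "\<dots> \<le> exp (e / 2)" using up[OF z] unfolding exp_le_cancel_iff by linarith
    finally show "norm (h z) \<le> exp (e / 2)" .
  qed auto
  moreover have "norm (h 0) = exp (u 0 - Re (poly p 0))"
  proof -
    have "norm (1 + c * f 0) = 1 + norm (f 0)"
      unfolding c(2) by (metis abs_of_nonneg add_nonneg_nonneg norm_ge_zero norm_of_real of_real_1 of_real_add zero_le_one)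
    then have "norm (h 0) = exp (u 0) * exp (- Re (poly p 0))"
      unfolding h_def norm_mult expu by (simp add: norm_exp_eq_Re)
    then show ?thesis by (simp add: mult_exp_exp)
  qed
  ultimately have "u 0 \<le> Re (poly p 0) + e / 2" by simp
  moreover have int: "((\<lambda>t. Re (poly p (circ t))) has_integral Re (poly p 0)) {0..1}"
    by (rule has_integral_Re[OF has_integral_circle_mean]) (auto intro!: holomorphic_intros)
  \<comment> \<open>The approximation is used twice, on the boundary for the maximum principle and
    here under the integral, at a cost of \<open>e / 2\<close> each time.\<close>
  have "Re (poly p 0) - e / 2 \<le> integral {0..1} (\<lambda>t. u (circ t))"
  proof (rule has_integral_le)
    show "((\<lambda>t. Re (poly p (circ t)) - e / 2) has_integral Re (poly p 0) - e / 2) {0..1}"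
      using has_integral_diff[OF int has_integral_const_real[of "e / 2" 0 1]] by simp
    show "((\<lambda>t. u (circ t)) has_integral integral {0..1} (\<lambda>t. u (circ t))) {0..1}"
      by (intro integrable_integral integrable_continuous_interval continuous_on_circ_compose contu)
    fix t :: real
    show "Re (poly p (circ t)) - e / 2 \<le> u (circ t)"
      using up[OF norm_cis[of "2 * pi * t"]] by linarith
  qed
  ultimately show "ln (1 + norm (f 0)) \<le> integral {0..1} (\<lambda>t. ln (1 + norm (f (circ t)))) + e"
    by (simp add: u_def)
qed

text \<open>A convex power lies above its tangent at \<open>a\<close>; integrated over the circle
  this becomes Jensen's inequality. Young's inequality with weights \<open>1 / p\<close> and
  \<open>1 - 1 / p\<close> takes the place of differentiation.\<close>

lemma powr_tangent:
  assumes "p \<ge> 1" "x \<ge> 0" "a \<ge> (0::real)"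
  shows "p * a powr (p - 1) * x - (p - 1) * a powr p \<le> x powr p"
proof (cases "x > 0 \<and> a > 0")
  case True
  have "(x powr p) powr (1 / p) * (a powr p) powr (1 - 1 / p) \<le> 1 / p * x powr p + (1 - 1 / p) * a powr p"
    using True assms by (intro Youngs_inequality_0) auto
  also have "(x powr p) powr (1 / p) * (a powr p) powr (1 - 1 / p) = x * a powr (p - 1)"
    using assms True by (simp add: powr_powr right_diff_distrib)
  finally have "p * (x * a powr (p - 1)) \<le> p * (1 / p * x powr p + (1 - 1 / p) * a powr p)"
    using assms by (intro mult_left_mono) auto
  then show ?thesis using assms by (simp add: algebra_simps)
next
  \<comment> \<open>If \<open>a = 0\<close>, the slope vanishes even for \<open>p = 1\<close>,
    because \<open>0 powr 0 = 0\<close>.\<close>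
  case False
  then show ?thesis using assms by (auto simp: not_less)
qed

lemma circle_submean_powr:
  assumes p: "p \<ge> 1" and cont: "continuous_on (cball 0 1) f" and hol: "f holomorphic_on ball 0 1"
  shows "ennreal (ln (1 + norm (f 0)) powr p)
     \<le> (\<integral>\<^sup>+t. ennreal (ln (1 + norm (f (circ t))) powr p) * indicator {0..1} t \<partial>lborel)"
proof -
  define u where "u = (\<lambda>z. ln (1 + norm (f z)))"
  \<comment> \<open>With the tangent taken at the centre value,
    \<open>p * a powr (p - 1) * a - (p - 1) * a powr p\<close> collapses to
    \<open>a powr p\<close>.\<close>
  define a where "a = u 0"
  have u0: "u z \<ge> 0" for z by (simp add: u_def)
  have contu: "continuous_on (sphere 0 1) u"
    unfolding u_def using continuous_on_subset[OF cont sphere_cball]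
    by (intro continuous_intros) (auto simp: add_nonneg_eq_0_iff)
  have "continuous_on (sphere 0 1) (\<lambda>z. u z powr p)"
    using contu p u0 by (intro continuous_on_powr' continuous_intros) auto
  then have int1: "((\<lambda>t. u (circ t) powr p) has_integral integral {0..1} (\<lambda>t. u (circ t) powr p)) {0..1}"
    by (intro integrable_integral integrable_continuous_interval continuous_on_circ_compose)
  have int2: "((\<lambda>t. u (circ t)) has_integral integral {0..1} (\<lambda>t. u (circ t))) {0..1}"
    by (intro integrable_integral integrable_continuous_interval continuous_on_circ_compose contu)
  have int3: "((\<lambda>t. p * a powr (p - 1) * u (circ t) - (p - 1) * a powr p) has_integral
       p * a powr (p - 1) * integral {0..1} (\<lambda>t. u (circ t)) - (p - 1) * a powr p) {0..1}"
    using has_integral_diff[OF has_integral_mult_right[OF int2, of "p * a powr (p - 1)"]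
        has_integral_const_real[of "(p - 1) * a powr p" 0 1]] by simp
  have "a \<le> integral {0..1} (\<lambda>t. u (circ t))"
    unfolding a_def u_def by (rule circle_submean_unit[OF cont hol])
  then have "p * a powr (p - 1) * a - (p - 1) * a powr p
      \<le> p * a powr (p - 1) * integral {0..1} (\<lambda>t. u (circ t)) - (p - 1) * a powr p"
    using p by (intro diff_right_mono mult_left_mono) auto
  also have "\<dots> \<le> integral {0..1} (\<lambda>t. u (circ t) powr p)"
    by (rule has_integral_le[OF int3 int1]) (intro powr_tangent p u0, simp add: a_def u0)
  also have "p * a powr (p - 1) * a - (p - 1) * a powr p = a powr p"
    using u0[of 0] powr_mult_base[of a "p - 1"] by (simp add: a_def algebra_simps)
  finally have "ennreal (a powr p) \<le> ennreal (integral {0..1} (\<lambda>t. u (circ t) powr p))"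
    by (rule ennreal_leI)
  also have "\<dots> = (\<integral>\<^sup>+t. ennreal (u (circ t) powr p) * indicator {0..1} t \<partial>lborel)"
    by (rule nn_integral_has_integral_lebesgue'[symmetric, OF _ int1]) auto
  finally show ?thesis by (simp add: a_def u_def)
qed

section \<open>Area means over balls\<close>

lemma nn_integral_lborel_translate:
  fixes F :: "'a::euclidean_space \<Rightarrow> ennreal"
  assumes [measurable]: "F \<in> borel_measurable borel"
  shows "(\<integral>\<^sup>+z. F (c + z) \<partial>lborel) = (\<integral>\<^sup>+z. F z \<partial>lborel)"
  by (subst (2) lborel_distr_plus[of c, symmetric]) (simp add: nn_integral_distr)

text \<open>A function holomorphic on a ball is arbitrary outside it, so measurability is available
  only after multiplication by an indicator.\<close>

lemma borel_measurable_indicator_ennreal: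
  fixes f :: "'a::euclidean_space \<Rightarrow> real"
  assumes "A \<in> sets borel" "continuous_on A f"
  shows "(\<lambda>x. indicator A x * ennreal (f x)) \<in> borel_measurable borel"
proof -
  have [measurable]: "(\<lambda>x. indicator A x *\<^sub>R f x) \<in> borel_measurable borel"
    by (rule borel_measurable_continuous_on_indicator[OF assms])
  have "(\<lambda>x. ennreal (indicator A x *\<^sub>R f x)) \<in> borel_measurable borel" by measurable
  also have "(\<lambda>x. ennreal (indicator A x *\<^sub>R f x)) = (\<lambda>x. indicator A x * ennreal (f x))"
    by (auto split: split_indicator)
  finally show ?thesis .
qed

lemma continuous_on_ln_norm_powr:
  assumes "continuous_on A f" "p > 0"
  shows "continuous_on A (\<lambda>z. ln (1 + norm (f z)) powr p)"
  using assms by (intro continuous_on_powr' continuous_intros) (auto simp: add_nonneg_eq_0_iff)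

text \<open>Instead of integrating over radii, each \<zeta> in the ball about 0 carries the mean
  over the circle about \<open>w\<close> through \<open>w + \<zeta>\<close>. After integration over
  \<zeta> and an interchange, rotation invariance makes the inner area integral independent of the
  angle.\<close>

lemma area_submean_powr:
  assumes p: "p \<ge> 1" and r: "r > 0" and hol: "f holomorphic_on ball w r"
  shows "ennreal (pi * r\<^sup>2 * ln (1 + norm (f w)) powr p)
     \<le> (\<integral>\<^sup>+z. indicator (ball w r) z * ennreal (ln (1 + norm (f z)) powr p) \<partial>lborel)"
proof -
  define v where "v = (\<lambda>z. indicator (ball w r) z * ennreal (ln (1 + norm (f z)) powr p))"
  have [measurable]: "v \<in> borel_measurable borel"
    unfolding v_def using p
    by (intro borel_measurable_indicator_ennreal continuous_on_ln_norm_powr holomorphic_on_imp_continuous_on hol) auto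
  have rot: "(\<integral>\<^sup>+z. v (w + z * circ t) \<partial>lborel) = (\<integral>\<^sup>+z. v z \<partial>lborel)" for t
    using nn_integral_lborel_rotate[of "\<lambda>z. v (w + z)" "circ t"] nn_integral_lborel_translate[of v w]
    by (simp add: mult.commute)
  have [measurable]: "(\<lambda>x. v (w + snd x * circ (fst x))) \<in> borel_measurable (lborel \<Otimes>\<^sub>M lborel)"
  proof -
    have [measurable]: "circ \<in> borel_measurable borel"
      by (intro borel_measurable_continuous_onI) (auto simp: cis_conv_exp intro!: continuous_intros)
    show ?thesis by measurable
  qed
  have pt: "indicator (ball 0 r) \<zeta> * v w \<le> (\<integral>\<^sup>+t. v (w + \<zeta> * circ t) * indicator {0..1} t \<partial>lborel)" for \<zeta>
  proof (cases "norm \<zeta> < r")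
    case True
    \<comment> \<open>Since \<open>norm \<zeta> < r\<close> strictly, the closed disc of radius
      \<open>norm \<zeta>\<close> stays inside the open ball, which supplies the continuity up to
      the boundary required by the circle inequality.\<close>
    have sub: "(\<lambda>z. w + \<zeta> * z) ` cball 0 1 \<subseteq> ball w r"
    proof clarify
      fix z :: complex assume "z \<in> cball 0 1"
      then have "norm (\<zeta> * z) \<le> norm \<zeta>" by (simp add: norm_mult mult_left_le)
      then show "w + \<zeta> * z \<in> ball w r" using True by (simp add: dist_norm)
    qed
    have hol': "(\<lambda>z. f (w + \<zeta> * z)) holomorphic_on cball 0 1"
      using holomorphic_on_compose_gen[OF _ hol sub] by (simp add: o_def holomorphic_intros)
    have "ennreal (ln (1 + norm (f (w + \<zeta> * 0))) powr p)
      \<le> (\<integral>\<^sup>+t. ennreal (ln (1 + norm (f (w + \<zeta> * circ t))) powr p) * indicator {0..1} t \<partial>lborel)"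
      using hol' holomorphic_on_subset[OF hol' ball_subset_cball]
      by (intro circle_submean_powr[OF p, of "\<lambda>z. f (w + \<zeta> * z)"] holomorphic_on_imp_continuous_on) auto
    moreover have "w + \<zeta> * circ t \<in> ball w r" for t
      using sub by (rule subsetD) (rule imageI, simp)
    ultimately show ?thesis using True r by (simp add: v_def)
  qed (auto)
  have "ennreal (pi * r\<^sup>2 * ln (1 + norm (f w)) powr p) = (\<integral>\<^sup>+\<zeta>. indicator (ball (0::complex) r) \<zeta> * v w \<partial>lborel)"
    using r by (subst nn_integral_multc) (auto simp: emeasure_ball_complex ennreal_mult v_def)
  also have "\<dots> \<le> (\<integral>\<^sup>+\<zeta>. (\<integral>\<^sup>+t. v (w + \<zeta> * circ t) * indicator {0..1} t \<partial>lborel) \<partial>lborel)"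
    by (intro nn_integral_mono pt)
  also have "\<dots> = (\<integral>\<^sup>+t. (\<integral>\<^sup>+\<zeta>. v (w + \<zeta> * circ t) * indicator {0..1} t \<partial>lborel) \<partial>lborel)"
    by (rule lborel_pair.Fubini') (simp add: case_prod_beta)
  also have "\<dots> = (\<integral>\<^sup>+t. (\<integral>\<^sup>+z. v z \<partial>lborel) * indicator {0..1::real} t \<partial>lborel)"
    by (simp add: nn_integral_multc rot)
  also have "\<dots> = (\<integral>\<^sup>+z. v z \<partial>lborel)"
    by (subst nn_integral_cmult) auto
  finally show ?thesis by (simp add: v_def)
qed


section \<open>The Nevanlinna integral\<close>

text \<open>The \<open>p\<close>-th power of the norm without the factor
  \<open>(1 + \<alpha>) / pi\<close>. Free of the root, it lets estimates be added by linearity of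
  the integral.\<close>

definition nev_int :: "real \<Rightarrow> real \<Rightarrow> (complex \<Rightarrow> complex) \<Rightarrow> ennreal" where
  "nev_int p \<alpha> f = (\<integral>\<^sup>+z. disk_weight \<alpha> z * ennreal (ln (1 + norm (f z)) powr p) \<partial>lborel)"

lemma measurable_indicator_ln_norm_powr:
  assumes "f holomorphic_on unit_disk" "p > 0"
  shows "(\<lambda>z. indicator unit_disk z * ennreal (ln (1 + norm (f z)) powr p)) \<in> borel_measurable borel"
  using assms by (intro borel_measurable_indicator_ennreal continuous_on_ln_norm_powr
      holomorphic_on_imp_continuous_on) auto

lemma nn_integral_weighted_area_measure:
  assumes f: "f \<in> analytic_disk" and p: "p > 0" and \<alpha>: "\<alpha> > -1"
  shows "(\<integral>\<^sup>+ z. ennreal (ln (1 + norm (f z)) powr p) \<partial>weighted_area_measure \<alpha>)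
           = ennreal ((1 + \<alpha>) / pi) * nev_int p \<alpha> f"
proof -
  define R where "R = restrict_space (lborel :: complex measure) unit_disk"
  define v where "v = (\<lambda>z. ennreal (ln (1 + norm (f z)) powr p))"
  define w where "w = (\<lambda>z::complex. ennreal ((1 + \<alpha>) * (1 - (norm z)\<^sup>2) powr \<alpha>))"
  have [measurable]: "(\<lambda>z::complex. ennreal ((1 - (norm z)\<^sup>2) powr \<alpha>)) \<in> borel_measurable borel"
    by measurable
  have V [measurable]: "(\<lambda>z. indicator unit_disk z * v z) \<in> borel_measurable borel"
    unfolding v_def using f p by (intro measurable_indicator_ln_norm_powr) (auto simp: analytic_disk_def)
  have vR [measurable]: "v \<in> borel_measurable R"
    unfolding R_def using V
    by (subst borel_measurable_restrict_space_iff_ennreal) (auto simp: mult.commute)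
  have [measurable]: "w \<in> borel_measurable R"
    unfolding R_def w_def by (intro measurable_restrict_space1) simp
  have "(\<integral>\<^sup>+ z. v z \<partial>weighted_area_measure \<alpha>) = (\<integral>\<^sup>+ z. ennreal (1 / pi) * (w z * v z) \<partial>R)"
    unfolding weighted_area_measure_def area_measure_def R_def[symmetric] w_def[symmetric]
    by (subst nn_integral_density, simp, simp) (subst nn_integral_density, auto)
  also have "\<dots> = ennreal (1 / pi) * (\<integral>\<^sup>+ z. w z * v z \<partial>R)"
    by (subst nn_integral_cmult) auto
  also have "(\<integral>\<^sup>+ z. w z * v z \<partial>R) = (\<integral>\<^sup>+ z. w z * v z * indicator unit_disk z \<partial>lborel)"
    unfolding R_def by (subst nn_integral_restrict_space) auto
  also have "\<dots> = (\<integral>\<^sup>+ z. ennreal (1 + \<alpha>) * (disk_weight \<alpha> z * (indicator unit_disk z * v z)) \<partial>lborel)"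
    using \<alpha> by (intro nn_integral_cong)
       (auto simp: w_def disk_weight_def ennreal_mult mult_ac split: split_indicator)
  also have "\<dots> = ennreal (1 + \<alpha>) * (\<integral>\<^sup>+ z. disk_weight \<alpha> z * (indicator unit_disk z * v z) \<partial>lborel)"
    by (subst nn_integral_cmult) auto
  also have "(\<integral>\<^sup>+ z. disk_weight \<alpha> z * (indicator unit_disk z * v z) \<partial>lborel) = nev_int p \<alpha> f"
    unfolding nev_int_def v_def
    by (intro nn_integral_cong) (auto simp: disk_weight_def split: split_indicator)
  also have "ennreal (1 / pi) * (ennreal (1 + \<alpha>) * nev_int p \<alpha> f) = ennreal ((1 + \<alpha>) / pi) * nev_int p \<alpha> f"
    using \<alpha> by (simp add: mult.assoc[symmetric] ennreal_mult[symmetric])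
  finally show ?thesis by (simp add: v_def)
qed

section \<open>Metric boundedness as an inequality between integrals\<close>

lemma ennreal_powr_less_top_iff: "ennreal_powr x r < \<infinity> \<longleftrightarrow> x < \<infinity>"
  by (auto simp: ennreal_powr_def top.not_eq_extremum)

lemma ennreal_powr_le_cmult_iff:
  assumes p: "p > 0" and C: "C > 0" and y: "y < \<infinity>"
  shows "ennreal_powr x (1 / p) \<le> ennreal C * ennreal_powr y (1 / p) \<longleftrightarrow> x \<le> ennreal (C powr p) * y"
proof -
  obtain b where b: "y = ennreal b" "b \<ge> 0" using y by (cases y) auto
  show ?thesis
  proof (cases x)
    case (real a)
    have "ennreal_powr x (1 / p) \<le> ennreal C * ennreal_powr y (1 / p) \<longleftrightarrow> a powr (1 / p) \<le> C * b powr (1 / p)"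
      using b real C by (simp add: ennreal_powr_def ennreal_mult[symmetric])
    also have "C * b powr (1 / p) = (C powr p * b) powr (1 / p)"
      using C b p by (simp add: powr_mult powr_powr)
    also have "a powr (1 / p) \<le> (C powr p * b) powr (1 / p) \<longleftrightarrow> a \<le> C powr p * b"
      using real b C powr_mono2[of "1 / p" a "C powr p * b"] powr_less_mono2[of "1 / p" "C powr p * b" a] p
      by (auto simp: not_le[symmetric])
    also have "\<dots> \<longleftrightarrow> x \<le> ennreal (C powr p) * y"
      using real b C by (simp add: ennreal_mult[symmetric])
    finally show ?thesis .
  next
    case top
    \<comment> \<open>Both right-hand sides are finite, so for infinite \<open>x\<close> both
      inequalities fail.\<close>
    have "ennreal C * ennreal_powr y (1 / p) < \<infinity>" "ennreal (C powr p) * y < \<infinity>"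
      using b by (auto simp: ennreal_powr_def ennreal_mult_less_top)
    then show ?thesis using top by (auto simp: ennreal_powr_def top_unique)
  qed
qed

lemma nevanlinna_norm_less_top_iff:
  assumes f: "f \<in> analytic_disk" and p: "p > 0" and \<alpha>: "\<alpha> > -1"
  shows "nevanlinna_norm p \<alpha> f < \<infinity> \<longleftrightarrow> nev_int p \<alpha> f < \<infinity>"
  unfolding nevanlinna_norm_def ennreal_powr_less_top_iff nn_integral_weighted_area_measure[OF assms]
  using \<alpha> by (auto simp: ennreal_mult_less_top)

lemma nevanlinna_norm_le_cmult_iff:
  assumes f: "f \<in> analytic_disk" and h: "h \<in> analytic_disk" and p: "p > 0" and \<alpha>: "\<alpha> > -1"
    and C: "C > 0" and fin: "nev_int p \<alpha> f < \<infinity>"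
  shows "nevanlinna_norm p \<alpha> h \<le> ennreal C * nevanlinna_norm p \<alpha> f
           \<longleftrightarrow> nev_int p \<alpha> h \<le> ennreal (C powr p) * nev_int p \<alpha> f"
proof -
  define c where "c = (1 + \<alpha>) / pi"
  have c: "c > 0" using \<alpha> by (simp add: c_def)
  have "nevanlinna_norm p \<alpha> h \<le> ennreal C * nevanlinna_norm p \<alpha> f
      \<longleftrightarrow> ennreal c * nev_int p \<alpha> h \<le> ennreal (C powr p) * (ennreal c * nev_int p \<alpha> f)"
    unfolding nevanlinna_norm_def nn_integral_weighted_area_measure[OF f p \<alpha>]
      nn_integral_weighted_area_measure[OF h p \<alpha>] c_def[symmetric]
    by (rule ennreal_powr_le_cmult_iff[OF p C]) (use fin in \<open>simp add: ennreal_mult_less_top\<close>)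
  also have "ennreal (C powr p) * (ennreal c * nev_int p \<alpha> f) = ennreal c * (ennreal (C powr p) * nev_int p \<alpha> f)"
    by (rule mult.left_commute)
  finally show ?thesis
    using c by (simp add: ennreal_mult_le_mult_iff)
qed

text \<open>The constants correspond by \<open>K = C powr p\<close>. From right to left, membership
  of \<open>T f\<close> in the space is read off from the estimate, whose right-hand side is
  finite.\<close>

lemma metrically_bounded_iff:
  assumes p: "p > 0" and \<alpha>: "\<alpha> > -1"
    and T: "\<And>f. f \<in> analytic_disk \<Longrightarrow> T f \<in> analytic_disk"
  shows "metrically_bounded p \<alpha> T \<longleftrightarrow>
     (\<exists>K>0. \<forall>f\<in>analytic_disk. nev_int p \<alpha> f < \<infinity> \<longrightarrow> nev_int p \<alpha> (T f) \<le> ennreal K * nev_int p \<alpha> f)"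
    (is "_ \<longleftrightarrow> ?R")
proof
  assume "metrically_bounded p \<alpha> T"
  then obtain C where C: "C > 0" and
    le: "\<And>f. f \<in> nevanlinna_space p \<alpha> \<Longrightarrow> nevanlinna_norm p \<alpha> (T f) \<le> ennreal C * nevanlinna_norm p \<alpha> f"
    unfolding metrically_bounded_def by blast
  show ?R
  proof (intro exI[of _ "C powr p"] conjI ballI impI)
    show "C powr p > 0" using C by simp
    fix f assume f: "f \<in> analytic_disk" and fin: "nev_int p \<alpha> f < \<infinity>"
    then show "nev_int p \<alpha> (T f) \<le> ennreal (C powr p) * nev_int p \<alpha> f"
      using nevanlinna_norm_le_cmult_iff[OF f T[OF f] p \<alpha> C fin] nevanlinna_norm_less_top_iff[OF f p \<alpha>]
        le[of f] by (simp add: nevanlinna_space_def)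
  qed
next
  assume ?R
  then obtain K where K: "K > 0" and
    le: "\<And>f. f \<in> analytic_disk \<Longrightarrow> nev_int p \<alpha> f < \<infinity> \<Longrightarrow> nev_int p \<alpha> (T f) \<le> ennreal K * nev_int p \<alpha> f"
    by blast
  define C where "C = K powr (1 / p)"
  have C: "C > 0" "C powr p = K" using K p by (auto simp: C_def powr_powr)
  show "metrically_bounded p \<alpha> T"
    unfolding metrically_bounded_def
  proof (intro exI[of _ C] conjI ballI)
    fix f assume "f \<in> nevanlinna_space p \<alpha>"
    then have f: "f \<in> analytic_disk" and fin: "nev_int p \<alpha> f < \<infinity>"
      using nevanlinna_norm_less_top_iff[of f p \<alpha>] p \<alpha> by (auto simp: nevanlinna_space_def)
    have le': "nev_int p \<alpha> (T f) \<le> ennreal K * nev_int p \<alpha> f" by (rule le[OF f fin])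
    also have "\<dots> < \<infinity>" using fin by (simp add: ennreal_mult_less_top)
    finally show "T f \<in> nevanlinna_space p \<alpha>"
      using nevanlinna_norm_less_top_iff[OF T[OF f] p \<alpha>] T[OF f] by (simp add: nevanlinna_space_def)
    show "nevanlinna_norm p \<alpha> (T f) \<le> ennreal C * nevanlinna_norm p \<alpha> f"
      using nevanlinna_norm_le_cmult_iff[OF f T[OF f] p \<alpha> C(1) fin] le' C(2) by simp
  qed (rule C(1))
qed

text \<open>Meant for weight exponents, which may be negative: either end of the range of
  \<open>x / d\<close> can then give the smaller power, hence the \<open>min\<close>.\<close>

lemma powr_ge_between:
  assumes "0 < l" "0 < d" "l * d \<le> x" "x \<le> u * d"
  shows "min (l powr a) (u powr a) * d powr a \<le> (x :: real) powr a"
proof -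
  have "0 < l * d" using assms by simp
  then have u: "0 < u" using assms by (smt (verit) mult_pos_pos zero_less_mult_pos2)
  show ?thesis
  proof (cases "a \<ge> 0")
    case True
    have "l powr a * d powr a = (l * d) powr a" using assms by (simp add: powr_mult)
    also have "\<dots> \<le> x powr a" using assms True by (intro powr_mono2) auto
    finally show ?thesis by (smt (verit) mult_right_mono powr_ge_zero)
  next
    case False
    have "u powr a * d powr a = (u * d) powr a" using assms u by (simp add: powr_mult)
    also have "\<dots> \<le> x powr a" using assms False less_le_trans[OF \<open>0 < l * d\<close> assms(3)] by (intro powr_mono2') auto
    finally show ?thesis by (smt (verit) mult_right_mono powr_ge_zero)
  qed
qed

text \<open>On the ball of radius \<open>(1 - norm z) / 2\<close> the weight is comparable to
  \<open>(1 - norm z) powr \<alpha>\<close>, so the area mean there is dominated by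
  \<open>nev_int\<close>. Of the exponent 2 + \<alpha>, the 2 comes from the area and \<alpha> from
  the weight.\<close>

lemma nevanlinna_pointwise_bound:
  assumes p: "p \<ge> 1"
  obtains C where "C > 0" "\<And>f z. f \<in> analytic_disk \<Longrightarrow> norm z < 1 \<Longrightarrow>
     ennreal (ln (1 + norm (f z)) powr p * (1 - norm z) powr (2 + \<alpha>)) \<le> ennreal C * nev_int p \<alpha> f"
proof
  \<comment> \<open>The bases 1/2 and 3 bound the quotient of \<open>1 - (norm \<xi>)^2\<close> by
    \<open>1 - norm z\<close> for \<xi> in that ball.\<close>
  define c where "c = min ((1/2) powr \<alpha>) (3 powr \<alpha>)"
  have c: "c > 0" by (simp add: c_def)
  show "4 / (pi * c) > 0" using c by simp
  fix f z assume f: "f \<in> analytic_disk" and z: "norm (z::complex) < 1"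
  define d where "d = 1 - norm z"
  have d: "d > 0" using z by (simp add: d_def)
  define v where "v = (\<lambda>z. ln (1 + norm (f z)) powr p)"
  have nev: "nev_int p \<alpha> f = (\<integral>\<^sup>+\<xi>. disk_weight \<alpha> \<xi> * ennreal (v \<xi>) \<partial>lborel)"
    by (simp add: nev_int_def v_def)
  have sub: "ball z (d / 2) \<subseteq> unit_disk" and
    wt: "c * d powr \<alpha> \<le> (1 - (norm \<xi>)\<^sup>2) powr \<alpha>" if "\<xi> \<in> ball z (d / 2)" for \<xi>
  proof -
    have *: "norm \<xi> < 1" "1 / 2 * d \<le> 1 - (norm \<xi>)\<^sup>2" "1 - (norm \<xi>)\<^sup>2 \<le> 3 * d"
      if "\<xi> \<in> ball z (d / 2)" for \<xi>
    proof -
      have "norm (\<xi> - z) < d / 2" using that by (simp add: dist_norm norm_minus_commute)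
      then have b: "norm \<xi> < norm z + d / 2" "norm z < norm \<xi> + d / 2"
        using norm_triangle_sub[of \<xi> z] norm_triangle_sub[of z \<xi>] by (auto simp: norm_minus_commute)
      then show lt: "norm \<xi> < 1" using z b(1) unfolding d_def by (simp add: field_simps)
      show "1 / 2 * d \<le> 1 - (norm \<xi>)\<^sup>2" "1 - (norm \<xi>)\<^sup>2 \<le> 3 * d"
        using one_minus_norm_square_le[of \<xi>] lt b d_def by (auto simp: field_simps)
    qed
    show "ball z (d / 2) \<subseteq> unit_disk" using *(1) by auto
    show "c * d powr \<alpha> \<le> (1 - (norm \<xi>)\<^sup>2) powr \<alpha>"
      unfolding c_def using *(2,3)[OF that] d by (intro powr_ge_between) auto
  qed
  have sub: "ball z (d / 2) \<subseteq> unit_disk"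
    using sub[of z] d by simp
  have "ennreal (c * d powr \<alpha>) * ennreal (pi * (d / 2)\<^sup>2 * v z)
      \<le> ennreal (c * d powr \<alpha>) * (\<integral>\<^sup>+\<xi>. indicator (ball z (d / 2)) \<xi> * ennreal (v \<xi>) \<partial>lborel)"
    unfolding v_def using f sub d
    by (intro mult_left_mono area_submean_powr[OF p])
       (auto simp: analytic_disk_def intro: holomorphic_on_subset)
  also have "\<dots> = (\<integral>\<^sup>+\<xi>. ennreal (c * d powr \<alpha>) * (indicator (ball z (d / 2)) \<xi> * ennreal (v \<xi>)) \<partial>lborel)"
    unfolding v_def using f sub p
    by (intro nn_integral_cmult[symmetric])
       (auto simp: analytic_disk_def intro!: borel_measurable_indicator_ennreal continuous_on_ln_norm_powr
          holomorphic_on_imp_continuous_on intro: holomorphic_on_subset)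
  also have "\<dots> \<le> nev_int p \<alpha> f"
    unfolding nev
  proof (intro nn_integral_mono)
    fix \<xi>
    show "ennreal (c * d powr \<alpha>) * (indicator (ball z (d / 2)) \<xi> * ennreal (v \<xi>)) \<le> disk_weight \<alpha> \<xi> * ennreal (v \<xi>)"
    proof (cases "\<xi> \<in> ball z (d / 2)")
      case True
      then have "\<xi> \<in> unit_disk" using sub by auto
      then show ?thesis
        using True wt[OF True] by (simp add: disk_weight_def ennreal_leI mult_right_mono)
    qed simp
  qed
  finally have "ennreal (4 / (pi * c)) * (ennreal (c * d powr \<alpha>) * ennreal (pi * (d / 2)\<^sup>2 * v z))
      \<le> ennreal (4 / (pi * c)) * nev_int p \<alpha> f"
    by (intro mult_left_mono) auto
  also have "ennreal (4 / (pi * c)) * (ennreal (c * d powr \<alpha>) * ennreal (pi * (d / 2)\<^sup>2 * v z))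
     = ennreal (v z * d powr (2 + \<alpha>))"
  proof -
    have "d powr (2 + \<alpha>) = d\<^sup>2 * d powr \<alpha>" using d by (simp add: powr_add)
    then have "4 / (pi * c) * (c * d powr \<alpha> * (pi * (d / 2)\<^sup>2 * v z)) = v z * d powr (2 + \<alpha>)"
      using c by (simp add: field_simps power2_eq_square)
    then show ?thesis using c d by (simp add: ennreal_mult[symmetric] v_def)
  qed
  finally show "ennreal (ln (1 + norm (f z)) powr p * (1 - norm z) powr (2 + \<alpha>)) \<le> ennreal (4 / (pi * c)) * nev_int p \<alpha> f"
    by (simp add: v_def d_def)
qed


section \<open>Growth of primitives\<close>

lemma primitive_on_disk:
  assumes "k holomorphic_on unit_disk"
  defines "F \<equiv> \<lambda>z. contour_integral (linepath 0 z) k"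
  shows "F 0 = 0" "\<And>z. z \<in> unit_disk \<Longrightarrow> (F has_field_derivative k z) (at z)" "F holomorphic_on unit_disk"
proof -
  obtain P where P: "\<And>z. z \<in> unit_disk \<Longrightarrow> (P has_field_derivative k z) (at z)"
    by (metis holomorphic_convex_primitive'[OF convex_ball open_ball assms(1)] at_within_open open_ball)
  have F: "F z = P z - P 0" if "z \<in> unit_disk" for z
  proof -
    have sub: "path_image (linepath 0 z) \<subseteq> unit_disk"
      unfolding path_image_linepath by (intro closed_segment_subset) (use that in auto)
    have "(k has_contour_integral (P (pathfinish (linepath 0 z)) - P (pathstart (linepath 0 z)))) (linepath 0 z)"
      by (rule contour_integral_primitive[OF has_field_derivative_at_within[OF P] valid_path_linepath sub])
    then show ?thesis unfolding F_def by (simp add: contour_integral_unique)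
  qed
  show "F 0 = 0" using F[of 0] by simp
  show D: "(F has_field_derivative k z) (at z)" if z: "z \<in> unit_disk" for z
  proof (rule has_field_derivative_transform_within_open[of "\<lambda>z. P z - P 0" _ _ unit_disk])
    show "((\<lambda>z. P z - P 0) has_field_derivative k z) (at z)"
      using P[OF z] by (auto intro!: derivative_eq_intros)
  qed (use z F in auto)
  show "F holomorphic_on unit_disk"
    by (rule holomorphic_onI) (use D field_differentiable_at_within field_differentiable_def in blast)
qed

lemma volterra_J_analytic:
  assumes "f \<in> analytic_disk" "g \<in> analytic_disk"
  shows "volterra_J g f \<in> analytic_disk" "volterra_J g f 0 = 0"
    "\<And>z. z \<in> unit_disk \<Longrightarrow> (volterra_J g f has_field_derivative f z * deriv g z) (at z)"
proof -
  have h: "(\<lambda>\<zeta>. f \<zeta> * deriv g \<zeta>) holomorphic_on unit_disk"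
    using assms by (auto simp: analytic_disk_def intro!: holomorphic_intros holomorphic_deriv)
  have "volterra_J g f = (\<lambda>z. contour_integral (linepath 0 z) (\<lambda>\<zeta>. f \<zeta> * deriv g \<zeta>))"
    by (rule ext) (rule volterra_J_def)
  note * = primitive_on_disk[OF h, folded this]
  show "volterra_J g f \<in> analytic_disk" "volterra_J g f 0 = 0"
    "\<And>z. z \<in> unit_disk \<Longrightarrow> (volterra_J g f has_field_derivative f z * deriv g z) (at z)"
    using *(2,3) by (simp_all add: analytic_disk_def volterra_J_def[of g f 0])
qed

lemma volterra_I_analytic:
  assumes "f \<in> analytic_disk" "g \<in> analytic_disk"
  shows "volterra_I g f \<in> analytic_disk" "volterra_I g f 0 = 0"
    "\<And>z. z \<in> unit_disk \<Longrightarrow> (volterra_I g f has_field_derivative deriv f z * g z) (at z)"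
proof -
  have h: "(\<lambda>\<zeta>. deriv f \<zeta> * g \<zeta>) holomorphic_on unit_disk"
    using assms by (auto simp: analytic_disk_def intro!: holomorphic_intros holomorphic_deriv)
  have "volterra_I g f = (\<lambda>z. contour_integral (linepath 0 z) (\<lambda>\<zeta>. deriv f \<zeta> * g \<zeta>))"
    by (rule ext) (rule volterra_I_def)
  note * = primitive_on_disk[OF h, folded this]
  show "volterra_I g f \<in> analytic_disk" "volterra_I g f 0 = 0"
    "\<And>z. z \<in> unit_disk \<Longrightarrow> (volterra_I g f has_field_derivative deriv f z * g z) (at z)"
    using *(2,3) by (simp_all add: analytic_disk_def volterra_I_def[of g f 0])
qed

text \<open>The inequality will be iterated once per dyadic level, so the factor on \<open>x\<close>
  must be arbitrarily close to 1; the price is a large constant on \<open>y\<close>, which enters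
  only once per level. Either \<open>y \<le> \<tau> * x\<close>, or \<open>x\<close> is at most a
  multiple of \<open>y\<close>.\<close>

lemma powr_add_le_eps:
  assumes p: "p \<ge> 1" and \<eta>: "\<eta> > 1"
  obtains C where "C > 0" "\<And>x y. x \<ge> 0 \<Longrightarrow> y \<ge> 0 \<Longrightarrow> (x + y) powr p \<le> \<eta> * x powr p + C * (y::real) powr p"
proof
  define \<tau> where "\<tau> = \<eta> powr (1 / p) - 1"
  have \<tau>: "\<tau> > 0" "(1 + \<tau>) powr p = \<eta>"
    using p \<eta> by (auto simp: \<tau>_def powr_powr intro: gr_one_powr)
  have \<tau>': "1 / \<tau> + 1 > 0" using \<tau> by (simp add: add_pos_pos)
  then show "(1 / \<tau> + 1) powr p > 0" by simp
  fix x y :: real assume xy: "x \<ge> 0" "y \<ge> 0"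
  show "(x + y) powr p \<le> \<eta> * x powr p + (1 / \<tau> + 1) powr p * y powr p"
  proof (cases "y \<le> \<tau> * x")
    case True
    then have "x + y \<le> (1 + \<tau>) * x" by (simp add: distrib_right)
    then have "(x + y) powr p \<le> ((1 + \<tau>) * x) powr p"
      using xy p by (intro powr_mono2) auto
    also have "\<dots> = \<eta> * x powr p" using xy \<tau> by (simp add: powr_mult)
    finally show ?thesis by (simp add: add_increasing2)
  next
    case False
    then have "x \<le> 1 / \<tau> * y" using \<tau> by (simp add: field_simps)
    then have "x + y \<le> (1 / \<tau> + 1) * y" by (simp only: distrib_right mult_1)
    then have "(x + y) powr p \<le> ((1 / \<tau> + 1) * y) powr p"
      using xy p by (intro powr_mono2) auto
    also have "\<dots> = (1 / \<tau> + 1) powr p * y powr p" using xy \<tau>' by (simp add: powr_mult)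
    finally show ?thesis using \<eta> by (simp add: add_increasing)
  qed
qed

text \<open>Bernoulli's inequality under the logarithm, obtained from Young's inequality for the
  numbers 1 and \<open>(1 + m) powr M\<close>. It turns the Bloch constant into a mere
  factor.\<close>

lemma ln_one_plus_mult_le:
  assumes "M \<ge> 1" "m \<ge> (0::real)"
  shows "ln (1 + M * m) \<le> M * ln (1 + m)"
proof -
  have "1 powr (1 - 1 / M) * ((1 + m) powr M) powr (1 / M) \<le> (1 - 1 / M) * 1 + 1 / M * (1 + m) powr M"
    using assms by (intro Youngs_inequality_0) auto
  then have "1 + m \<le> 1 - 1 / M + 1 / M * (1 + m) powr M"
    using assms by (simp add: powr_powr)
  then have "M * (1 + m) \<le> M * (1 - 1 / M + 1 / M * (1 + m) powr M)"
    using assms by (intro mult_left_mono) auto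
  then have "1 + M * m \<le> (1 + m) powr M"
    using assms by (simp add: algebra_simps)
  then have "ln (1 + M * m) \<le> ln ((1 + m) powr M)"
    using assms by (subst ln_le_cancel_iff) (auto simp: add_pos_nonneg)
  then show ?thesis using assms by (simp add: ln_powr)
qed

lemma ln_one_plus_add_le:
  assumes "x \<ge> 0" "y \<ge> (0::real)"
  shows "ln (1 + (x + y)) \<le> ln (1 + x) + ln (1 + y)"
proof -
  have "ln (1 + (x + y)) \<le> ln ((1 + x) * (1 + y))"
    using assms by (subst ln_le_cancel_iff) (auto simp: algebra_simps add_pos_nonneg)
  also have "\<dots> = ln (1 + x) + ln (1 + y)" using assms by (intro ln_mult_pos) auto
  finally show ?thesis .
qed

text \<open>Every point of the segment is at distance at least \<open>1 - s\<close> from the circle,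
  so the derivative of \<open>F\<close> is at most \<open>M * m / (1 - s)\<close> there. The segment
  is no longer than \<open>1 - s\<close>, so the increment is at most \<open>M * m\<close>, whatever
  the distance to the boundary.\<close>

lemma ln_norm_radial_step:
  assumes F: "\<And>z. z \<in> unit_disk \<Longrightarrow> (F has_field_derivative f z * g' z) (at z)"
    and g': "\<And>z. z \<in> unit_disk \<Longrightarrow> (1 - norm z) * norm (g' z) \<le> M"
    and M: "M \<ge> 1" and a: "norm a = 1" and s: "0 \<le> s0" "s0 \<le> s" "s < 1" "s - s0 \<le> 1 - s"
    and Y: "\<And>\<sigma>. s0 \<le> \<sigma> \<Longrightarrow> \<sigma> \<le> s \<Longrightarrow> ln (1 + norm (f (of_real \<sigma> * a))) \<le> Y"
  shows "ln (1 + norm (F (of_real s * a))) \<le> ln (1 + norm (F (of_real s0 * a))) + M * Y"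
proof -
  \<comment> \<open>The bound on \<open>norm f\<close> that corresponds to \<open>Y\<close>, since
    \<open>ln (1 + m) = Y\<close>.\<close>
  define m where "m = exp Y - 1"
  have Y0: "0 \<le> Y" using Y[of s0] s by (smt (verit) ln_ge_zero norm_ge_zero)
  then have m: "m \<ge> 0" by (simp add: m_def)
  have fm: "norm (f (of_real \<sigma> * a)) \<le> m" if "s0 \<le> \<sigma>" "\<sigma> \<le> s" for \<sigma>
  proof -
    have "exp (ln (1 + norm (f (of_real \<sigma> * a)))) \<le> exp Y" using Y[OF that] by simp
    then show ?thesis by (simp add: m_def add_pos_nonneg)
  qed
  define S where "S = closed_segment (of_real s0 * a) (of_real s * a)"
  have S: "\<exists>\<sigma>. s0 \<le> \<sigma> \<and> \<sigma> \<le> s \<and> z = of_real \<sigma> * a" if "z \<in> S" for z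
  proof -
    obtain t where t: "0 \<le> t" "t \<le> 1" "z = (1 - t) *\<^sub>R (of_real s0 * a) + t *\<^sub>R (of_real s * a)"
      using \<open>z \<in> S\<close> unfolding S_def in_segment by blast
    have "z = of_real ((1 - t) * s0 + t * s) * a"
      unfolding t(3) by (simp add: scaleR_conv_of_real algebra_simps)
    moreover have "s0 \<le> (1 - t) * s0 + t * s"
      using mult_left_mono[OF s(2) t(1)] by (simp add: algebra_simps)
    moreover have "(1 - t) * s0 + t * s \<le> s"
      using mult_left_mono[OF s(2), of "1 - t"] t(2) by (simp add: algebra_simps)
    ultimately show ?thesis by blast
  qed
  have "norm (F (of_real s * a) - F (of_real s0 * a)) \<le> (M * m / (1 - s)) * norm (of_real s * a - of_real s0 * a)"
  proof (rule field_differentiable_bound[of S F "\<lambda>z. f z * g' z"])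
    show "convex S" unfolding S_def by (rule convex_closed_segment)
    fix z assume "z \<in> S"
    then obtain \<sigma> where \<sigma>: "s0 \<le> \<sigma>" "\<sigma> \<le> s" "z = of_real \<sigma> * a" using S by blast
    have nz: "norm z = \<sigma>" using \<sigma> s a by (simp add: norm_mult)
    then have z: "z \<in> unit_disk" using \<sigma> s by simp
    show "(F has_field_derivative f z * g' z) (at z within S)"
      using F[OF z] by (rule has_field_derivative_at_within)
    have "(1 - s) * norm (g' z) \<le> (1 - \<sigma>) * norm (g' z)"
      using \<sigma> by (intro mult_right_mono) auto
    also have "\<dots> \<le> M" using g'[OF z] nz by simp
    finally have "norm (g' z) \<le> M / (1 - s)" using s by (simp add: field_simps)
    then have "norm (f z) * norm (g' z) \<le> m * (M / (1 - s))"
      using fm[OF \<sigma>(1,2)] \<sigma>(3) m by (intro mult_mono) auto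
    then show "norm (f z * g' z) \<le> M * m / (1 - s)" by (simp add: norm_mult mult.commute)
  qed (auto simp: S_def)
  also have "norm (of_real s * a - of_real s0 * a) = s - s0"
  proof -
    have "of_real s * a - of_real s0 * a = of_real (s - s0) * a" by (simp add: algebra_simps)
    then show ?thesis using a s by (simp add: norm_mult del: of_real_diff)
  qed
  also have "(M * m / (1 - s)) * (s - s0) \<le> (M * m / (1 - s)) * (1 - s)"
    using s m M by (intro mult_left_mono) auto
  also have "\<dots> = M * m" using s by simp
  finally have "norm (F (of_real s * a)) \<le> norm (F (of_real s0 * a)) + M * m"
    using norm_triangle_sub[of "F (of_real s * a)" "F (of_real s0 * a)"] by linarith
  then have "ln (1 + norm (F (of_real s * a))) \<le> ln (1 + (norm (F (of_real s0 * a)) + M * m))"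
    using m M by (subst ln_le_cancel_iff) (auto simp: add_pos_nonneg)
  also have "\<dots> \<le> ln (1 + norm (F (of_real s0 * a))) + ln (1 + M * m)"
    using m M by (intro ln_one_plus_add_le) auto
  also have "ln (1 + M * m) \<le> M * ln (1 + m)" by (rule ln_one_plus_mult_le[OF M m])
  also have "ln (1 + m) = Y" by (simp add: m_def)
  finally show ?thesis by simp
qed


text \<open>Level \<open>j\<close> belongs to the radii between \<open>1 - (1/2) ^ j\<close> and
  \<open>1 - (1/2) ^ (j + 1)\<close>, widened to hold whole balls about points on the radius to
  \<open>z\<close>. The last condition does not mention \<open>j\<close>, so it survives the
  summation over levels as the support of the kernel.\<close>

definition dyadic_region :: "complex \<Rightarrow> nat \<Rightarrow> complex set" where
  "dyadic_region z j = {\<xi>. norm \<xi> < 1 \<and> (1/2) ^ (j + 2) < 1 - (norm \<xi>)\<^sup>2 \<and>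
      1 - (norm \<xi>)\<^sup>2 < 4 * (1/2) ^ j \<and> norm (\<xi> - z) < 5 * (1 - (norm \<xi>)\<^sup>2)}"

lemma dyadic_region_borel [measurable]: "dyadic_region z j \<in> sets borel"
  unfolding dyadic_region_def by measurable

definition dyadic_int :: "real \<Rightarrow> (complex \<Rightarrow> complex) \<Rightarrow> complex \<Rightarrow> nat \<Rightarrow> ennreal" where
  "dyadic_int p f z j =
     (\<integral>\<^sup>+\<xi>. indicator (dyadic_region z j) \<xi> * ennreal (ln (1 + norm (f \<xi>)) powr p) \<partial>lborel)"

lemma ball_subset_dyadic_region:
  assumes a: "norm a = 1" "z = of_real (norm z) * a"
    and \<sigma>: "1 - (1/2) ^ j \<le> \<sigma>" "\<sigma> \<le> 1 - (1/2) ^ (j + 1)" "\<sigma> \<le> norm z" "0 \<le> \<sigma>" "norm z < 1"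
  shows "ball (of_real \<sigma> * a) ((1/2) ^ (j + 2)) \<subseteq> dyadic_region z j"
proof
  fix \<xi> assume "\<xi> \<in> ball (of_real \<sigma> * a) ((1/2) ^ (j + 2))"
  \<comment> \<open>The centre is at distance between \<open>2 * \<rho>\<close> and
    \<open>4 * \<rho>\<close> from the circle, so \<open>1 - norm \<xi>\<close> lies between \<rho>
    and \<open>5 * \<rho>\<close>, and \<xi> is within \<open>5 * \<rho>\<close> of
    \<open>z\<close>.\<close>
  define \<rho> :: real where "\<rho> = (1/2) ^ (j + 2)"
  have \<rho>: "(1/2) ^ (j + 1) = 2 * \<rho>" "(1/2) ^ j = 4 * \<rho>" "\<rho> > 0" by (simp_all add: \<rho>_def)
  have d: "norm (\<xi> - of_real \<sigma> * a) < \<rho>"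
    using \<open>\<xi> \<in> _\<close> by (simp add: dist_norm norm_minus_commute \<rho>_def)
  have n: "norm (of_real \<sigma> * a) = \<sigma>" using a \<sigma> by (simp add: norm_mult)
  have 1: "norm \<xi> < \<sigma> + \<rho>" "\<sigma> - \<rho> < norm \<xi>"
    using d n norm_triangle_sub[of \<xi> "of_real \<sigma> * a"] norm_triangle_sub[of "of_real \<sigma> * a" \<xi>]
    by (auto simp: norm_minus_commute)
  have lt: "norm \<xi> < 1" using 1 \<sigma> \<rho> by linarith
  have "norm (\<xi> - z) \<le> norm (\<xi> - of_real \<sigma> * a) + norm (of_real \<sigma> * a - z)"
    using norm_triangle_ineq[of "\<xi> - of_real \<sigma> * a" "of_real \<sigma> * a - z"] by simp
  also have "of_real \<sigma> * a - z = of_real (\<sigma> - norm z) * a"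
    by (subst a(2)) (simp add: algebra_simps)
  also have "norm \<dots> = norm z - \<sigma>" using a(1) \<sigma>(3) by (simp add: norm_mult del: of_real_diff)
  finally have "norm (\<xi> - z) < 5 * \<rho>" using d \<sigma> \<rho> by linarith
  moreover have w: "\<rho> < 1 - norm \<xi>" using 1 \<sigma> \<rho> by linarith
  moreover have "1 - norm \<xi> < 5 * \<rho>" using 1 \<sigma> \<rho> by linarith
  ultimately show "\<xi> \<in> dyadic_region z j"
    using one_minus_norm_square_le[of \<xi>] lt \<rho> unfolding dyadic_region_def
    by (simp add: \<rho>_def[symmetric])
qed

text \<open>Replaces the supremum of \<open>ln (1 + norm f)\<close> along a radial segment by an
  area integral: balls of radius \<open>\<rho> = (1/2) ^ (j + 2)\<close> about its points lie in the
  region, and \<open>(16 / pi) * 4 ^ j\<close> is the inverse area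
  \<open>1 / (pi * \<rho>^2)\<close>.\<close>

lemma dyadic_step:
  assumes p: "p \<ge> 1" and E: "E > 0" and C: "C > 0"
    and sum: "\<And>x y. x \<ge> 0 \<Longrightarrow> y \<ge> 0 \<Longrightarrow> (x + y) powr p \<le> E * x powr p + C * (y::real) powr p"
    and f: "f holomorphic_on unit_disk"
    and F: "\<And>z. z \<in> unit_disk \<Longrightarrow> (F has_field_derivative f z * g' z) (at z)"
    and g': "\<And>z. z \<in> unit_disk \<Longrightarrow> (1 - norm z) * norm (g' z) \<le> M" and M: "M \<ge> 1"
    and a: "norm a = 1" "z = of_real (norm z) * a" and z: "norm z < 1"
    and s: "1 - (1/2) ^ j \<le> s" "s \<le> 1 - (1/2) ^ (j + 1)" "s \<le> norm z"
  shows "ennreal (ln (1 + norm (F (of_real s * a))) powr p)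
    \<le> ennreal E * ennreal (ln (1 + norm (F (of_real (1 - (1/2) ^ j) * a))) powr p)
      + ennreal (C * M powr p * (16 / pi) * 4 ^ j) * dyadic_int p f z j"
proof (cases "dyadic_int p f z j")
  case top
  \<comment> \<open>The coefficient is positive, so an infinite local integral makes the right-hand
    side infinite; the other case is an argument in the reals.\<close>
  have "C * M powr p * (16 / pi) * 4 ^ j > 0" using C M by simp
  then have "ennreal (C * M powr p * (16 / pi) * 4 ^ j) * top = top"
    unfolding ennreal_mult_eq_top_iff ennreal_eq_0_iff not_le by blast
  then show ?thesis unfolding top by simp
next
  case (real x)
  define \<rho> :: real where "\<rho> = (1/2) ^ (j + 2)"
  have \<rho>: "\<rho> > 0" by (simp add: \<rho>_def)
  define X where "X = x / (pi * \<rho>\<^sup>2)"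
  have X: "X \<ge> 0" using real by (simp add: X_def)
  have s0: "(0::real) \<le> 1 - (1/2) ^ j" by (simp add: power_le_one)
  have Y: "ln (1 + norm (f (of_real \<sigma> * a))) \<le> X powr (1 / p)" if "1 - (1/2) ^ j \<le> \<sigma>" "\<sigma> \<le> s" for \<sigma>
  proof -
    have sub: "ball (of_real \<sigma> * a) \<rho> \<subseteq> dyadic_region z j"
      unfolding \<rho>_def using that s s0 by (intro ball_subset_dyadic_region a z) auto
    have "dyadic_region z j \<subseteq> unit_disk" by (auto simp: dyadic_region_def)
    then have "f holomorphic_on ball (of_real \<sigma> * a) \<rho>"
      using f sub by (meson holomorphic_on_subset order_trans)
    from area_submean_powr[OF p \<rho> this]
    have "ennreal (pi * \<rho>\<^sup>2 * ln (1 + norm (f (of_real \<sigma> * a))) powr p) \<le> dyadic_int p f z j"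
      unfolding dyadic_int_def
      by (rule order_trans) (intro nn_integral_mono mult_right_mono, use sub in \<open>auto split: split_indicator\<close>)
    then have "pi * \<rho>\<^sup>2 * ln (1 + norm (f (of_real \<sigma> * a))) powr p \<le> x"
      using real by (simp add: ennreal_le_iff)
    then have "ln (1 + norm (f (of_real \<sigma> * a))) powr p \<le> X"
      using \<rho> by (simp add: X_def field_simps)
    then have "(ln (1 + norm (f (of_real \<sigma> * a))) powr p) powr (1 / p) \<le> X powr (1 / p)"
      using p by (intro powr_mono2) auto
    then show ?thesis using p by (simp add: powr_powr)
  qed
  have "ln (1 + norm (F (of_real s * a))) \<le> ln (1 + norm (F (of_real (1 - (1/2) ^ j) * a))) + M * X powr (1 / p)"
  proof (rule ln_norm_radial_step[OF F g' M a(1) s0 s(1)])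
    have h: "((1/2) ^ j :: real) = 2 * (1/2) ^ (j + 1)" by simp
    show "s < 1" using s(2) zero_less_power[of "1/2::real" "j + 1"] by linarith
    show "s - (1 - (1/2) ^ j) \<le> 1 - s" using s(2) h by linarith
  qed (auto intro: Y)
  then have "ln (1 + norm (F (of_real s * a))) powr p
      \<le> (ln (1 + norm (F (of_real (1 - (1/2) ^ j) * a))) + M * X powr (1 / p)) powr p"
    using p by (intro powr_mono2) auto
  also have "\<dots> \<le> E * ln (1 + norm (F (of_real (1 - (1/2) ^ j) * a))) powr p + C * (M * X powr (1 / p)) powr p"
    using M by (intro sum) auto
  also have "(M * X powr (1 / p)) powr p = M powr p * X"
    using M X p by (simp add: powr_mult powr_powr)
  also have "C * (M powr p * X) = C * M powr p * (16 / pi) * 4 ^ j * x"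
  proof -
    have "\<rho>\<^sup>2 = 1 / (16 * 4 ^ j)"
      by (simp add: \<rho>_def power_add power_mult_distrib power_one_over power2_eq_square field_simps
            flip: power_mult_distrib)
    then have "X = (16 / pi) * 4 ^ j * x" unfolding X_def by simp
    then show ?thesis by simp
  qed
  finally have le: "ln (1 + norm (F (of_real s * a))) powr p
      \<le> E * ln (1 + norm (F (of_real (1 - (1/2) ^ j) * a))) powr p + C * M powr p * (16 / pi) * 4 ^ j * x" .
  define c where "c = C * M powr p * (16 / pi) * 4 ^ j"
  have "c \<ge> 0" using C by (simp add: c_def)
  then show ?thesis
    using ennreal_leI[OF le] E real unfolding c_def[symmetric] by (simp add: ennreal_plus ennreal_mult)
qed

text \<open>Unrolls \<open>dyadic_step\<close> from the origin, where \<open>F\<close> vanishes.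
  Level \<open>i\<close> is multiplied by \<open>E\<close> in every later step, with one factor to
  spare. Admitting all radii up to \<open>1 - (1/2) ^ j\<close> allows the last step to be
  incomplete.\<close>

lemma dyadic_sum:
  assumes p: "p \<ge> 1" and E: "E \<ge> 1" and C: "C > 0"
    and sum: "\<And>x y. x \<ge> 0 \<Longrightarrow> y \<ge> 0 \<Longrightarrow> (x + y) powr p \<le> E * x powr p + C * (y::real) powr p"
    and f: "f holomorphic_on unit_disk"
    and F: "\<And>z. z \<in> unit_disk \<Longrightarrow> (F has_field_derivative f z * g' z) (at z)" and F0: "F 0 = 0"
    and g': "\<And>z. z \<in> unit_disk \<Longrightarrow> (1 - norm z) * norm (g' z) \<le> M" and M: "M \<ge> 1"
    and a: "norm a = 1" "z = of_real (norm z) * a" and z: "norm z < 1"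
  defines "K \<equiv> C * M powr p * (16 / pi)"
  shows "0 \<le> s \<Longrightarrow> s \<le> 1 - (1/2) ^ j \<Longrightarrow> s \<le> norm z \<Longrightarrow>
    ennreal (ln (1 + norm (F (of_real s * a))) powr p)
    \<le> (\<Sum>i<j. ennreal (K * 4 ^ i * E ^ (j - i)) * dyadic_int p f z i)"
proof (induction j arbitrary: s)
  case 0
  then have "s = 0" by simp
  then show ?case using F0 by simp
next
  case (Suc j)
  have K: "K \<ge> 0" using C by (simp add: K_def)
  define S where "S = (\<Sum>i<j. ennreal (K * 4 ^ i * E ^ (j - i)) * dyadic_int p f z i)"
  have *: "ennreal (ln (1 + norm (F (of_real s * a))) powr p)
      \<le> ennreal E * S + ennreal (K * 4 ^ j) * dyadic_int p f z j"
  proof (cases "s \<le> 1 - (1/2) ^ j")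
    case True
    have "ennreal (ln (1 + norm (F (of_real s * a))) powr p) \<le> 1 * S"
      using Suc.IH[of s] Suc.prems True by (simp add: S_def)
    also have "\<dots> \<le> ennreal E * S" using E by (intro mult_right_mono) auto
    also have "\<dots> \<le> ennreal E * S + ennreal (K * 4 ^ j) * dyadic_int p f z j" by simp
    finally show ?thesis .
  next
    case False
    have "ennreal (ln (1 + norm (F (of_real s * a))) powr p)
        \<le> ennreal E * ennreal (ln (1 + norm (F (of_real (1 - (1/2) ^ j) * a))) powr p)
          + ennreal (K * 4 ^ j) * dyadic_int p f z j"
      unfolding K_def by (rule dyadic_step[OF p _ C sum f F g' M a z]) (use False Suc.prems E in auto)
    also have "ennreal (ln (1 + norm (F (of_real (1 - (1/2) ^ j) * a))) powr p) \<le> S"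
      unfolding S_def using False Suc.prems by (intro Suc.IH) (auto simp: power_le_one)
    finally show ?thesis by (simp add: add_right_mono mult_left_mono)
  qed
  also have "ennreal E * S = (\<Sum>i<j. ennreal (K * 4 ^ i * E ^ (Suc j - i)) * dyadic_int p f z i)"
    unfolding S_def sum_distrib_left
  proof (intro sum.cong refl)
    fix i assume "i \<in> {..<j}"
    then have eq: "E * (K * 4 ^ i * E ^ (j - i)) = K * 4 ^ i * E ^ (Suc j - i)"
      by (simp add: Suc_diff_le)
    show "ennreal E * (ennreal (K * 4 ^ i * E ^ (j - i)) * dyadic_int p f z i)
        = ennreal (K * 4 ^ i * E ^ (Suc j - i)) * dyadic_int p f z i"
      unfolding eq[symmetric] using E K by (subst ennreal_mult) (auto simp: mult.assoc)
  qed
  \<comment> \<open>The newest term carries no \<open>E\<close> yet; it is granted one so that all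
    exponents follow a single formula.\<close>
  also have "ennreal (K * 4 ^ j) * dyadic_int p f z j \<le> ennreal (K * 4 ^ j * E ^ (Suc j - j)) * dyadic_int p f z j"
    using E K mult_left_mono[of 1 E "K * 4 ^ j"] by (intro mult_right_mono ennreal_leI) (auto simp: Suc_diff_le)
  finally show ?case by (simp add: add_left_mono)
qed

text \<open>\<open>1 - (norm \<xi>)^2\<close> lies strictly between 1/4 and 4 times
  \<open>(1/2) ^ i\<close>, so the admissible levels span fewer than four halvings.\<close>

lemma card_dyadic_region_le: "card {i. i < n \<and> \<xi> \<in> dyadic_region z i} \<le> 4" (is "card ?S \<le> 4")
proof (cases "?S = {}")
  case False
  have fin: "finite ?S" by simp
  define m where "m = Min ?S"
  have m: "m \<in> ?S" unfolding m_def using fin False by (rule Min_in)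
  have "i < m + 4" if "i \<in> ?S" for i
  proof -
    have "(1/2::real) ^ (m + 2) < 4 * (1/2) ^ i"
      using m that by (auto simp: dyadic_region_def)
    moreover have "(1/2::real) ^ (m + 4) = (1/2) ^ (m + 2) / 4"
      by (simp add: power_add power_divide)
    ultimately have "(1/2::real) ^ (m + 4) < (1/2) ^ i" by linarith
    then show ?thesis by (simp add: power_strict_decreasing_iff)
  qed
  moreover have "m \<le> i" if "i \<in> ?S" for i
    unfolding m_def using fin that by (rule Min_le)
  ultimately have "?S \<subseteq> {m..<m + 4}" by auto
  then have "card ?S \<le> card {m..<m + 4}" by (intro card_mono) auto
  then show ?thesis by simp
qed (simp only: card.empty)


text \<open>The coefficient factors as
  \<open>(2 ^ n) powr \<epsilon> * (2 ^ i) powr (2 - \<epsilon>)\<close>. The first factor is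
  controlled by the boundary distance of \<open>z\<close>, the second, on the region of level
  \<open>i\<close>, by that of \<xi>; \<epsilon> \<le> 2 keeps the second exponent nonnegative. The
  constants 4 combine to 16, and the overlap of the regions makes this 64.\<close>

lemma dyadic_sum_le:
  assumes K: "K \<ge> 0" and \<epsilon>: "0 \<le> \<epsilon>" "\<epsilon> \<le> 2" and n: "2 ^ n \<le> 4 / (1 - (norm z)\<^sup>2)" and z: "norm z < 1"
    and f: "f holomorphic_on unit_disk" and p: "p > 0"
  shows "(\<Sum>i<n. ennreal (K * 4 ^ i * (2 powr \<epsilon>) ^ (n - i)) * dyadic_int p f z i)
    \<le> ennreal (64 * K * (1 - (norm z)\<^sup>2) powr - \<epsilon>) *
       (\<integral>\<^sup>+\<xi>. disk_weight (\<epsilon> - 2) \<xi> * indicator {\<xi>. norm (\<xi> - z) < 5 * (1 - (norm \<xi>)\<^sup>2)} \<xi>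
          * (indicator unit_disk \<xi> * ennreal (ln (1 + norm (f \<xi>)) powr p)) \<partial>lborel)"
proof -
  define V where "V = (\<lambda>\<xi>. indicator unit_disk \<xi> * ennreal (ln (1 + norm (f \<xi>)) powr p))"
  have [measurable]: "V \<in> borel_measurable borel"
    unfolding V_def by (rule measurable_indicator_ln_norm_powr[OF f p])
  define w where "w = 1 - (norm z)\<^sup>2"
  have w: "w > 0" using z by (simp add: w_def power_less_one_iff)
  define R where "R = {\<xi>. norm (\<xi> - z) < 5 * (1 - (norm \<xi>)\<^sup>2)}"
  have [measurable]: "R \<in> sets borel" unfolding R_def by measurable
  define c where "c = (\<lambda>i. K * 4 ^ i * (2 powr \<epsilon>) ^ (n - i))"
  have int: "dyadic_int p f z i = (\<integral>\<^sup>+\<xi>. indicator (dyadic_region z i) \<xi> * V \<xi> \<partial>lborel)" for i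
    unfolding dyadic_int_def V_def by (intro nn_integral_cong) (auto simp: dyadic_region_def split: split_indicator)
  have coeff: "c i \<le> 16 * K * w powr - \<epsilon> * (1 - (norm \<xi>)\<^sup>2) powr (\<epsilon> - 2)"
    if i: "i < n" "\<xi> \<in> dyadic_region z i" for i \<xi>
  proof -
    define y where "y = 1 - (norm \<xi>)\<^sup>2"
    have y: "0 < y" "2 ^ i \<le> 4 / y"
    proof -
      have "(1/2) ^ (i + 2) < y" using i(2) by (simp add: dyadic_region_def y_def)
      then show y0: "0 < y" by (rule less_trans[rotated]) simp
      have "y < 4 * (1/2) ^ i" using i(2) by (simp add: dyadic_region_def y_def)
      then have "y * 2 ^ i < 4 * (1/2) ^ i * 2 ^ i" by (intro mult_strict_right_mono) auto
      also have "\<dots> = 4" by (simp add: power_one_over)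
      finally show "2 ^ i \<le> 4 / y" using y0 by (simp add: field_simps)
    qed
    have "4 ^ i * (2 powr \<epsilon>) ^ (n - i) = (2 ^ n) powr \<epsilon> * (2 ^ i) powr (2 - \<epsilon>)"
    proof -
      have 1: "(4::real) ^ i = 2 powr (2 * real i)"
        using powr_realpow[of 4 i] powr_powr[of 2 2 "real i"] by simp
      have 2: "(2 powr \<epsilon>) ^ (n - i) = 2 powr (\<epsilon> * (real n - real i))"
        using i(1) powr_realpow[of "2 powr \<epsilon>" "n - i"] by (simp add: powr_powr)
      have 3: "(2 ^ n) powr \<epsilon> = 2 powr (real n * \<epsilon>)" "(2 ^ i) powr (2 - \<epsilon>) = 2 powr (real i * (2 - \<epsilon>))"
        by (simp_all add: powr_realpow[symmetric] powr_powr)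
      show ?thesis unfolding 1 2 3 powr_add[symmetric] by (simp add: algebra_simps)
    qed
    also have "\<dots> \<le> (4 / w) powr \<epsilon> * (4 / y) powr (2 - \<epsilon>)"
      using n y \<epsilon> unfolding w_def[symmetric] by (intro mult_mono powr_mono2) auto
    also have "\<dots> = (4 powr \<epsilon> * 4 powr (2 - \<epsilon>)) * (w powr - \<epsilon> * y powr (\<epsilon> - 2))"
    proof -
      have *: "(4 / x) powr s = 4 powr s * x powr - s" if "x > 0" for x s :: real
        using that by (simp add: powr_divide powr_minus_divide)
      show ?thesis using *[OF w, of \<epsilon>] *[OF y(1), of "2 - \<epsilon>"] by simp
    qed
    also have "(4::real) powr \<epsilon> * 4 powr (2 - \<epsilon>) = 16"
      by (simp add: powr_add[symmetric])
    finally have "K * (4 ^ i * (2 powr \<epsilon>) ^ (n - i)) \<le> K * (16 * (w powr - \<epsilon> * y powr (\<epsilon> - 2)))"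
      using K by (rule mult_left_mono)
    then show ?thesis by (simp add: c_def y_def mult_ac)
  qed
  have pt: "(\<Sum>i<n. ennreal (c i) * indicator (dyadic_region z i) \<xi>)
      \<le> ennreal (64 * K * w powr - \<epsilon>) * (disk_weight (\<epsilon> - 2) \<xi> * indicator R \<xi>)" for \<xi>
  proof -
    define S where "S = {i. i < n \<and> \<xi> \<in> dyadic_region z i}"
    have "(\<Sum>i<n. ennreal (c i) * indicator (dyadic_region z i) \<xi>) = (\<Sum>i\<in>S. ennreal (c i))"
      unfolding S_def by (rule sum.mono_neutral_cong_right) auto
    also have "\<dots> \<le> of_nat (card S) * (ennreal (16 * K * w powr - \<epsilon>) * (disk_weight (\<epsilon> - 2) \<xi> * indicator R \<xi>))"
    proof (rule sum_bounded_above)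
      fix i assume i: "i \<in> S"
      then have \<xi>: "norm \<xi> < 1" "\<xi> \<in> R" by (auto simp: S_def R_def dyadic_region_def)
      have "ennreal (c i) \<le> ennreal (16 * K * w powr - \<epsilon> * (1 - (norm \<xi>)\<^sup>2) powr (\<epsilon> - 2))"
        using i by (intro ennreal_leI coeff) (auto simp: S_def)
      then show "ennreal (c i) \<le> ennreal (16 * K * w powr - \<epsilon>) * (disk_weight (\<epsilon> - 2) \<xi> * indicator R \<xi>)"
        using \<xi> K by (simp add: disk_weight_def ennreal_mult)
    qed
    also have "\<dots> \<le> ennreal 4 * (ennreal (16 * K * w powr - \<epsilon>) * (disk_weight (\<epsilon> - 2) \<xi> * indicator R \<xi>))"
    proof (rule mult_right_mono)
      show "of_nat (card S) \<le> ennreal 4"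
        using card_dyadic_region_le[of n \<xi> z] unfolding S_def[symmetric]
        by (metis ennreal_of_nat_eq_real_of_nat ennreal_leI of_nat_le_iff of_nat_numeral)
    qed simp
    also have "\<dots> = ennreal (64 * K * w powr - \<epsilon>) * (disk_weight (\<epsilon> - 2) \<xi> * indicator R \<xi>)"
    proof -
      have "ennreal 4 * ennreal (16 * K * w powr - \<epsilon>) = ennreal (4 * (16 * K * w powr - \<epsilon>))"
        using K by (intro ennreal_mult[symmetric]) auto
      also have "4 * (16 * K * w powr - \<epsilon>) = 64 * K * w powr - \<epsilon>" by simp
      finally show ?thesis unfolding mult.assoc[symmetric, of "ennreal 4"] by (rule arg_cong)
    qed
    finally show ?thesis .
  qed
  have "(\<Sum>i<n. ennreal (c i) * dyadic_int p f z i)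
      = (\<Sum>i<n. \<integral>\<^sup>+\<xi>. ennreal (c i) * (indicator (dyadic_region z i) \<xi> * V \<xi>) \<partial>lborel)"
    unfolding int by (intro sum.cong refl nn_integral_cmult[symmetric]) auto
  also have "\<dots> = (\<integral>\<^sup>+\<xi>. (\<Sum>i<n. ennreal (c i) * (indicator (dyadic_region z i) \<xi> * V \<xi>)) \<partial>lborel)"
    by (rule nn_integral_sum[symmetric]) auto
  also have "\<dots> = (\<integral>\<^sup>+\<xi>. (\<Sum>i<n. ennreal (c i) * indicator (dyadic_region z i) \<xi>) * V \<xi> \<partial>lborel)"
    by (simp only: sum_distrib_right mult.assoc)
  also have "\<dots> \<le> (\<integral>\<^sup>+\<xi>. ennreal (64 * K * w powr - \<epsilon>) * (disk_weight (\<epsilon> - 2) \<xi> * indicator R \<xi>) * V \<xi> \<partial>lborel)"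
    by (intro nn_integral_mono mult_right_mono pt) auto
  also have "\<dots> = ennreal (64 * K * w powr - \<epsilon>) * (\<integral>\<^sup>+\<xi>. disk_weight (\<epsilon> - 2) \<xi> * indicator R \<xi> * V \<xi> \<partial>lborel)"
    unfolding mult.assoc by (rule nn_integral_cmult) auto
  finally show ?thesis by (simp only: c_def w_def R_def V_def)
qed

lemma ln_norm_primitive_bound:
  assumes p: "p \<ge> 1" and \<epsilon>: "0 < \<epsilon>" "\<epsilon> \<le> 2" and M: "M \<ge> 1"
  obtains C where "C > 0"
    "\<And>f F g' z. f holomorphic_on unit_disk \<Longrightarrow>
       (\<And>z. z \<in> unit_disk \<Longrightarrow> (F has_field_derivative f z * g' z) (at z)) \<Longrightarrow> F 0 = 0 \<Longrightarrow>
       (\<And>z. z \<in> unit_disk \<Longrightarrow> (1 - norm z) * norm (g' z) \<le> M) \<Longrightarrow> norm z < 1 \<Longrightarrow>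
       ennreal (ln (1 + norm (F z)) powr p) \<le> ennreal (C * (1 - (norm z)\<^sup>2) powr - \<epsilon>) *
       (\<integral>\<^sup>+\<xi>. disk_weight (\<epsilon> - 2) \<xi> * indicator {\<xi>. norm (\<xi> - z) < 5 * (1 - (norm \<xi>)\<^sup>2)} \<xi>
          * (indicator unit_disk \<xi> * ennreal (ln (1 + norm (f \<xi>)) powr p)) \<partial>lborel)"
proof -
  \<comment> \<open>With this \<open>E\<close> the accumulated factor \<open>E ^ n\<close> equals
    \<open>(2 ^ n) powr \<epsilon>\<close>, a small negative power of the boundary distance.\<close>
  have E: "2 powr \<epsilon> > 1" using \<epsilon> by (simp add: gr_one_powr)
  obtain C where C: "C > 0" and sum: "\<And>x y. x \<ge> 0 \<Longrightarrow> y \<ge> 0 \<Longrightarrow> (x + y) powr p \<le> 2 powr \<epsilon> * x powr p + C * (y::real) powr p"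
    using powr_add_le_eps[OF p E] by blast
  define K where "K = C * M powr p * (16 / pi)"
  have K: "K > 0" using C M by (simp add: K_def)
  show thesis
  proof (rule that[of "64 * K"])
    show "64 * K > 0" using K by simp
    fix f F g' z
    assume f: "f holomorphic_on unit_disk"
      and F: "\<And>z. z \<in> unit_disk \<Longrightarrow> (F has_field_derivative f z * g' z) (at z)" and F0: "F 0 = (0::complex)"
      and g': "\<And>z. z \<in> unit_disk \<Longrightarrow> (1 - norm z) * norm (g' z) \<le> M" and z: "norm (z::complex) < 1"
    \<comment> \<open>\<open>sgn 0 = 0\<close> is not a unit vector, so the origin is assigned the
      direction 1.\<close>
    define a where "a = (if z = 0 then 1 else sgn z)"
    have a: "norm a = 1" "z = of_real (norm z) * a"
      by (auto simp: a_def sgn_eq norm_divide)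
    \<comment> \<open>The first level that reaches \<open>z\<close>. Minimality means that the
      preceding level falls short of \<open>z\<close>, which bounds \<open>2 ^ n\<close> from
      above.\<close>
    define n where "n = (LEAST n. norm z \<le> 1 - (1/2) ^ n)"
    have ex: "\<exists>n. norm z \<le> 1 - (1/2) ^ n"
    proof -
      obtain n where "(1/2::real) ^ n < 1 - norm z"
        using real_arch_pow_inv[of "1 - norm z" "1/2"] z by auto
      then show ?thesis by (intro exI[of _ n]) simp
    qed
    have n: "norm z \<le> 1 - (1/2) ^ n" unfolding n_def using ex by (rule LeastI_ex)
    have n': "2 ^ n \<le> 4 / (1 - (norm z)\<^sup>2)"
    proof (cases n)
      case 0
      have "0 < 1 - (norm z)\<^sup>2" "1 - (norm z)\<^sup>2 \<le> 1" using z by (auto simp: power_less_one_iff)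
      then show ?thesis using 0 by (simp add: field_simps)
    next
      case (Suc m)
      have "\<not> norm z \<le> 1 - (1/2) ^ m" using not_less_Least[of m "\<lambda>n. norm z \<le> 1 - (1/2) ^ n"] Suc
        by (simp add: n_def[symmetric])
      then have "1 - (norm z)\<^sup>2 \<le> 2 * (1/2) ^ m"
        using one_minus_norm_square_le(2)[of z] z by simp
      then have "(1 - (norm z)\<^sup>2) * 2 ^ n \<le> 2 * (1/2) ^ m * 2 ^ n" by (intro mult_right_mono) auto
      also have "\<dots> = 4" by (simp add: Suc power_one_over)
      finally show ?thesis using z by (simp add: field_simps power_less_one_iff)
    qed
    have "ennreal (ln (1 + norm (F (of_real (norm z) * a))) powr p)
        \<le> (\<Sum>i<n. ennreal (K * 4 ^ i * (2 powr \<epsilon>) ^ (n - i)) * dyadic_int p f z i)"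
      unfolding K_def by (rule dyadic_sum[OF p _ C sum f F F0 g' M a z]) (use E n in auto)
    also have "\<dots> \<le> ennreal (64 * K * (1 - (norm z)\<^sup>2) powr - \<epsilon>) *
       (\<integral>\<^sup>+\<xi>. disk_weight (\<epsilon> - 2) \<xi> * indicator {\<xi>. norm (\<xi> - z) < 5 * (1 - (norm \<xi>)\<^sup>2)} \<xi>
          * (indicator unit_disk \<xi> * ennreal (ln (1 + norm (f \<xi>)) powr p)) \<partial>lborel)"
      using K \<epsilon> p by (intro dyadic_sum_le n' z f) auto
    finally show "ennreal (ln (1 + norm (F z)) powr p) \<le> ennreal (64 * K * (1 - (norm z)\<^sup>2) powr - \<epsilon>) *
       (\<integral>\<^sup>+\<xi>. disk_weight (\<epsilon> - 2) \<xi> * indicator {\<xi>. norm (\<xi> - z) < 5 * (1 - (norm \<xi>)\<^sup>2)} \<xi>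
          * (indicator unit_disk \<xi> * ennreal (ln (1 + norm (f \<xi>)) powr p)) \<partial>lborel)"
      by (simp only: a(2)[symmetric])
  qed
qed


section \<open>Sufficiency\<close>

lemma measurable_nev_integrand:
  assumes "f \<in> analytic_disk" "p > 0"
  shows "(\<lambda>z. disk_weight \<alpha> z * ennreal (ln (1 + norm (f z)) powr p)) \<in> borel_measurable borel"
proof -
  have [measurable]: "(\<lambda>z. indicator unit_disk z * ennreal (ln (1 + norm (f z)) powr p)) \<in> borel_measurable borel"
    using assms by (intro measurable_indicator_ln_norm_powr) (auto simp: analytic_disk_def)
  have "(\<lambda>z. disk_weight \<alpha> z * (indicator unit_disk z * ennreal (ln (1 + norm (f z)) powr p))) \<in> borel_measurable borel"
    by measurable
  also have "(\<lambda>z. disk_weight \<alpha> z * (indicator unit_disk z * ennreal (ln (1 + norm (f z)) powr p)))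
      = (\<lambda>z. disk_weight \<alpha> z * ennreal (ln (1 + norm (f z)) powr p))"
    by (auto simp: disk_weight_def split: split_indicator)
  finally show ?thesis .
qed

lemma disk_weight_times_powr:
  assumes "c \<ge> 0"
  shows "disk_weight \<alpha> z * ennreal (c * (1 - (norm z)\<^sup>2) powr \<beta>) = ennreal c * disk_weight (\<alpha> + \<beta>) z"
  using assms by (auto simp: disk_weight_def ennreal_mult powr_add mult_ac split: split_indicator)

text \<open>A point within \<open>5 * y\<close> of \<xi>, where
  \<open>y = 1 - (norm \<xi>)^2\<close>, is within \<open>6 * y\<close> of the radial projection of
  \<xi>, so the set lies in a Carleson box. Here \<xi> is fixed and \<open>z\<close> varies, the
  opposite of the pointwise bound.\<close>

lemma disk_weight_Carleson_interior:
  assumes \<beta>: "\<beta> > -1"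
  obtains C where "C > 0"
    "\<And>\<xi>. norm \<xi> < 1 \<Longrightarrow>
       (\<integral>\<^sup>+z. disk_weight \<beta> z * (if norm (\<xi> - z) < 5 * (1 - (norm \<xi>)\<^sup>2) then 1 else 0) \<partial>lborel)
         \<le> ennreal (C * (1 - (norm \<xi>)\<^sup>2) powr (\<beta> + 2))"
proof -
  obtain C where C: "C > 0"
    "\<And>a h. norm a = 1 \<Longrightarrow> h > 0 \<Longrightarrow>
       (\<integral>\<^sup>+z. disk_weight \<beta> z * indicator (ball a h) z \<partial>lborel) \<le> ennreal (C * h powr (\<beta> + 2))"
    using disk_weight_Carleson[OF \<beta>] by blast
  show thesis
  proof (rule that[of "C * 6 powr (\<beta> + 2)"])
    show "C * 6 powr (\<beta> + 2) > 0" using C(1) by simp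
    fix \<xi> :: complex assume \<xi>: "norm \<xi> < 1"
    define y where "y = 1 - (norm \<xi>)\<^sup>2"
    have y: "y > 0" "1 - norm \<xi> \<le> y"
      using \<xi> one_minus_norm_square_le(1)[of \<xi>] by (auto simp: y_def power_less_one_iff)
    define a where "a = (if \<xi> = 0 then 1 else sgn \<xi>)"
    have a: "norm a = 1" "\<xi> = of_real (norm \<xi>) * a"
      by (auto simp: a_def sgn_eq norm_divide)
    have "norm (a - \<xi>) = 1 - norm \<xi>"
    proof -
      have "a - \<xi> = of_real (1 - norm \<xi>) * a" by (subst a(2)) (simp add: algebra_simps)
      then show ?thesis using a(1) \<xi> by (simp add: norm_mult del: of_real_diff)
    qed
    then have sub: "z \<in> ball a (6 * y)" if "norm (\<xi> - z) < 5 * y" for z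
      using that y norm_triangle_ineq[of "a - \<xi>" "\<xi> - z"] by (simp add: dist_norm)
    have "(\<integral>\<^sup>+z. disk_weight \<beta> z * (if norm (\<xi> - z) < 5 * y then 1 else 0) \<partial>lborel)
        \<le> (\<integral>\<^sup>+z. disk_weight \<beta> z * indicator (ball a (6 * y)) z \<partial>lborel)"
      using sub by (intro nn_integral_mono mult_left_mono) auto
    also have "\<dots> \<le> ennreal (C * (6 * y) powr (\<beta> + 2))"
      using y a by (intro C(2)) auto
    also have "C * (6 * y) powr (\<beta> + 2) = C * 6 powr (\<beta> + 2) * y powr (\<beta> + 2)"
      using y by (simp add: powr_mult)
    finally show "(\<integral>\<^sup>+z. disk_weight \<beta> z * (if norm (\<xi> - z) < 5 * (1 - (norm \<xi>)\<^sup>2) then 1 else 0) \<partial>lborel)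
         \<le> ennreal (C * 6 powr (\<beta> + 2) * (1 - (norm \<xi>)\<^sup>2) powr (\<beta> + 2))"
      by (simp only: y_def)
  qed
qed

text \<open>The exponents balance: the integral over \<open>z\<close> has size
  \<open>(1 - (norm \<xi>)^2) powr (\<alpha> - \<epsilon> + 2)\<close>, which meets the kernel's own
  exponent \<epsilon> - 2 and leaves exactly the weight \<alpha>.\<close>

lemma nev_int_volterra_J_le:
  assumes p: "p \<ge> 1" and \<alpha>: "\<alpha> > -1" and g: "g \<in> analytic_disk" and M: "M \<ge> 1"
    and g': "\<And>z. z \<in> unit_disk \<Longrightarrow> (1 - norm z) * norm (deriv g z) \<le> M"
  obtains K where "K > 0" "\<And>f. f \<in> analytic_disk \<Longrightarrow> nev_int p \<alpha> (volterra_J g f) \<le> ennreal K * nev_int p \<alpha> f"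
proof -
  \<comment> \<open>Half of the gap between \<alpha> and -1 leaves \<alpha> - \<epsilon> > -1, as
    the Carleson estimate demands; the cap at 1 secures \<epsilon> \<le> 2.\<close>
  define \<epsilon> where "\<epsilon> = min 1 ((\<alpha> + 1) / 2)"
  have \<epsilon>: "0 < \<epsilon>" "\<epsilon> \<le> 2" "\<alpha> - \<epsilon> > -1" using \<alpha> by (auto simp: \<epsilon>_def min_def field_simps)
  \<comment> \<open>A function of both points, so that the joint measurability behind Tonelli can be
    stated.\<close>
  define R where "R = (\<lambda>z \<xi>::complex. if norm (\<xi> - z) < 5 * (1 - (norm \<xi>)\<^sup>2) then 1 else (0::ennreal))"
  have indR: "indicator {\<xi>. norm (\<xi> - z) < 5 * (1 - (norm \<xi>)\<^sup>2)} \<xi> = R z \<xi>" for z \<xi>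
    by (simp add: R_def)
  define V where "V = (\<lambda>(f :: complex \<Rightarrow> complex) \<xi>. indicator unit_disk \<xi> * ennreal (ln (1 + norm (f \<xi>)) powr p))"
  obtain C where C: "C > 0"
    "\<And>f F g' z. f holomorphic_on unit_disk \<Longrightarrow>
       (\<And>z. z \<in> unit_disk \<Longrightarrow> (F has_field_derivative f z * g' z) (at z)) \<Longrightarrow> F 0 = 0 \<Longrightarrow>
       (\<And>z. z \<in> unit_disk \<Longrightarrow> (1 - norm z) * norm (g' z) \<le> M) \<Longrightarrow> norm z < 1 \<Longrightarrow>
       ennreal (ln (1 + norm (F z)) powr p) \<le> ennreal (C * (1 - (norm z)\<^sup>2) powr - \<epsilon>) *
       (\<integral>\<^sup>+\<xi>. disk_weight (\<epsilon> - 2) \<xi> * R z \<xi> * V f \<xi> \<partial>lborel)"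
    using ln_norm_primitive_bound[OF p \<epsilon>(1,2) M] unfolding indR V_def by blast
  obtain C' where C': "C' > 0"
    "\<And>\<xi>. norm \<xi> < 1 \<Longrightarrow>
       (\<integral>\<^sup>+z. disk_weight (\<alpha> - \<epsilon>) z * R z \<xi> \<partial>lborel) \<le> ennreal (C' * (1 - (norm \<xi>)\<^sup>2) powr (\<alpha> - \<epsilon> + 2))"
    using disk_weight_Carleson_interior[OF \<epsilon>(3)] unfolding R_def by blast
  show thesis
  proof (rule that[of "C * C'"])
    show "C * C' > 0" using C(1) C'(1) by simp
    fix f assume f: "f \<in> analytic_disk"
    define F where "F = volterra_J g f"
    have [measurable]: "V f \<in> borel_measurable borel"
      using f p unfolding V_def by (intro measurable_indicator_ln_norm_powr) (auto simp: analytic_disk_def)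
    have R1 [measurable]: "(\<lambda>x. R (fst x) (snd x)) \<in> borel_measurable (lborel \<Otimes>\<^sub>M lborel)"
      unfolding R_def by measurable
    have R2 [measurable]: "(\<lambda>\<xi>. R z \<xi>) \<in> borel_measurable borel" for z
      unfolding R_def by measurable
    have R3 [measurable]: "(\<lambda>z. R z \<xi>) \<in> borel_measurable borel" for \<xi>
      unfolding R_def by measurable
    have pt: "ennreal (ln (1 + norm (F z)) powr p) \<le> ennreal (C * (1 - (norm z)\<^sup>2) powr - \<epsilon>) *
       (\<integral>\<^sup>+\<xi>. disk_weight (\<epsilon> - 2) \<xi> * R z \<xi> * V f \<xi> \<partial>lborel)" if "norm z < 1" for z
      unfolding F_def
      by (rule C(2)[OF _ _ _ g' that])
         (use f volterra_J_analytic[OF f g] in \<open>auto simp: analytic_disk_def\<close>)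
    have "nev_int p \<alpha> F \<le> (\<integral>\<^sup>+z. disk_weight \<alpha> z * (ennreal (C * (1 - (norm z)\<^sup>2) powr - \<epsilon>) *
       (\<integral>\<^sup>+\<xi>. disk_weight (\<epsilon> - 2) \<xi> * R z \<xi> * V f \<xi> \<partial>lborel)) \<partial>lborel)"
      unfolding nev_int_def
    proof (intro nn_integral_mono)
      fix z
      show "disk_weight \<alpha> z * ennreal (ln (1 + norm (F z)) powr p) \<le> disk_weight \<alpha> z * (ennreal (C * (1 - (norm z)\<^sup>2) powr - \<epsilon>) *
       (\<integral>\<^sup>+\<xi>. disk_weight (\<epsilon> - 2) \<xi> * R z \<xi> * V f \<xi> \<partial>lborel))"
      proof (cases "norm z < 1")
        case True
        then show ?thesis by (intro mult_left_mono pt) auto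
      next
        case False
        then show ?thesis by (simp add: disk_weight_def)
      qed
    qed
    also have "\<dots> = (\<integral>\<^sup>+z. ennreal C * (\<integral>\<^sup>+\<xi>. disk_weight (\<alpha> - \<epsilon>) z * (disk_weight (\<epsilon> - 2) \<xi> * R z \<xi> * V f \<xi>) \<partial>lborel) \<partial>lborel)"
    proof (intro nn_integral_cong)
      fix z
      have "disk_weight \<alpha> z * ennreal (C * (1 - (norm z)\<^sup>2) powr - \<epsilon>) = ennreal C * disk_weight (\<alpha> - \<epsilon>) z"
        using disk_weight_times_powr[of C \<alpha> z "- \<epsilon>"] C(1) by simp
      then show "disk_weight \<alpha> z * (ennreal (C * (1 - (norm z)\<^sup>2) powr - \<epsilon>) *
          (\<integral>\<^sup>+\<xi>. disk_weight (\<epsilon> - 2) \<xi> * R z \<xi> * V f \<xi> \<partial>lborel))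
         = ennreal C * (\<integral>\<^sup>+\<xi>. disk_weight (\<alpha> - \<epsilon>) z * (disk_weight (\<epsilon> - 2) \<xi> * R z \<xi> * V f \<xi>) \<partial>lborel)"
        by (subst nn_integral_cmult) (auto simp: mult.assoc[symmetric])
    qed
    also have "\<dots> = ennreal C * (\<integral>\<^sup>+z. (\<integral>\<^sup>+\<xi>. disk_weight (\<alpha> - \<epsilon>) z * (disk_weight (\<epsilon> - 2) \<xi> * R z \<xi> * V f \<xi>) \<partial>lborel) \<partial>lborel)"
      by (rule nn_integral_cmult) (rule lborel.borel_measurable_nn_integral, simp add: case_prod_beta)
    also have "(\<integral>\<^sup>+z. (\<integral>\<^sup>+\<xi>. disk_weight (\<alpha> - \<epsilon>) z * (disk_weight (\<epsilon> - 2) \<xi> * R z \<xi> * V f \<xi>) \<partial>lborel) \<partial>lborel)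
       = (\<integral>\<^sup>+\<xi>. (\<integral>\<^sup>+z. disk_weight (\<alpha> - \<epsilon>) z * (disk_weight (\<epsilon> - 2) \<xi> * R z \<xi> * V f \<xi>) \<partial>lborel) \<partial>lborel)"
      by (rule lborel_pair.Fubini'[symmetric]) (simp add: case_prod_beta)
    also have "\<dots> \<le> (\<integral>\<^sup>+\<xi>. ennreal C' * (disk_weight \<alpha> \<xi> * V f \<xi>) \<partial>lborel)"
    proof (intro nn_integral_mono)
      fix \<xi>
      have "(\<integral>\<^sup>+z. disk_weight (\<alpha> - \<epsilon>) z * (disk_weight (\<epsilon> - 2) \<xi> * R z \<xi> * V f \<xi>) \<partial>lborel)
          = disk_weight (\<epsilon> - 2) \<xi> * V f \<xi> * (\<integral>\<^sup>+z. disk_weight (\<alpha> - \<epsilon>) z * R z \<xi> \<partial>lborel)"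
        by (subst nn_integral_cmult[symmetric]) (auto simp: mult_ac)
      also have "\<dots> \<le> ennreal C' * (disk_weight \<alpha> \<xi> * V f \<xi>)"
      proof (cases "norm \<xi> < 1")
        case True
        have "disk_weight (\<epsilon> - 2) \<xi> * V f \<xi> * (\<integral>\<^sup>+z. disk_weight (\<alpha> - \<epsilon>) z * R z \<xi> \<partial>lborel)
            \<le> disk_weight (\<epsilon> - 2) \<xi> * V f \<xi> * ennreal (C' * (1 - (norm \<xi>)\<^sup>2) powr (\<alpha> - \<epsilon> + 2))"
          by (intro mult_left_mono C'(2) True) auto
        also have "\<dots> = V f \<xi> * (disk_weight (\<epsilon> - 2) \<xi> * ennreal (C' * (1 - (norm \<xi>)\<^sup>2) powr (\<alpha> - \<epsilon> + 2)))"
          by (simp add: mult_ac)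
        also have "\<dots> = ennreal C' * (disk_weight \<alpha> \<xi> * V f \<xi>)"
          using C'(1) by (subst disk_weight_times_powr) (auto simp: mult_ac)
        finally show ?thesis .
      next
        case False
        then show ?thesis by (simp add: disk_weight_def)
      qed
      finally show "(\<integral>\<^sup>+z. disk_weight (\<alpha> - \<epsilon>) z * (disk_weight (\<epsilon> - 2) \<xi> * R z \<xi> * V f \<xi>) \<partial>lborel)
          \<le> ennreal C' * (disk_weight \<alpha> \<xi> * V f \<xi>)" .
    qed
    also have "\<dots> = ennreal C' * (\<integral>\<^sup>+\<xi>. disk_weight \<alpha> \<xi> * V f \<xi> \<partial>lborel)"
      by (rule nn_integral_cmult) auto
    also have "(\<integral>\<^sup>+\<xi>. disk_weight \<alpha> \<xi> * V f \<xi> \<partial>lborel) = nev_int p \<alpha> f"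
      unfolding nev_int_def V_def
      by (intro nn_integral_cong) (auto simp: disk_weight_def split: split_indicator)
    finally show "nev_int p \<alpha> (volterra_J g f) \<le> ennreal (C * C') * nev_int p \<alpha> f"
      using C(1) C'(1) by (simp add: F_def ennreal_mult mult.assoc mult_left_mono)
  qed
qed

lemma bloch_space_subset_J_mb:
  assumes p: "p \<ge> 1" and \<alpha>: "\<alpha> > -1"
  shows "bloch_space \<subseteq> J_mb p \<alpha>"
proof
  fix g assume "g \<in> bloch_space"
  then obtain B where g: "g \<in> analytic_disk"
    and B: "\<And>z. z \<in> unit_disk \<Longrightarrow> (1 - (norm z)\<^sup>2) * norm (deriv g z) \<le> B"
    unfolding bloch_space_def bdd_above_def by blast
  \<comment> \<open>The bound is raised to at least 1 for the sake of Bernoulli's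
    inequality.\<close>
  have g': "(1 - norm z) * norm (deriv g z) \<le> max 1 B" if "z \<in> unit_disk" for z
  proof -
    have "(1 - norm z) * norm (deriv g z) \<le> (1 - (norm z)\<^sup>2) * norm (deriv g z)"
      using that one_minus_norm_square_le(1)[of z] by (intro mult_right_mono) auto
    then show ?thesis using B[OF that] by simp
  qed
  obtain K where "K > 0" "\<And>f. f \<in> analytic_disk \<Longrightarrow> nev_int p \<alpha> (volterra_J g f) \<le> ennreal K * nev_int p \<alpha> f"
    using nev_int_volterra_J_le[OF p \<alpha> g _ g'] by auto
  then have "metrically_bounded p \<alpha> (volterra_J g)"
    using p \<alpha> volterra_J_analytic(1)[OF _ g] by (subst metrically_bounded_iff) auto
  then show "g \<in> J_mb p \<alpha>" using g by (simp add: J_mb_def)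
qed

text \<open>Cauchy's estimate on the circle at half the distance to the boundary. It shows that
  bounded functions are Bloch functions, and it later converts growth of \<open>T f\<close> into
  growth of its derivative.\<close>

lemma norm_deriv_le_disk:
  assumes g: "g holomorphic_on unit_disk" and z: "norm z < 1"
    and B: "\<And>\<zeta>. norm (\<zeta> - z) = (1 - norm z) / 2 \<Longrightarrow> norm (g \<zeta>) \<le> B"
  shows "(1 - norm z) * norm (deriv g z) \<le> 2 * B"
proof -
  define r where "r = (1 - norm z) / 2"
  have r: "r > 0" using z by (simp add: r_def)
  have sub: "cball z r \<subseteq> unit_disk"
  proof
    fix \<zeta> assume "\<zeta> \<in> cball z r"
    then have "norm \<zeta> \<le> norm z + r"
      using norm_triangle_sub[of \<zeta> z] by (simp add: dist_norm norm_minus_commute)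
    then show "\<zeta> \<in> unit_disk" using z r_def by (simp add: field_simps)
  qed
  have "norm ((deriv ^^ 1) g z) \<le> fact 1 * B / r ^ 1"
  proof (rule Cauchy_inequality)
    show "g holomorphic_on ball z r" "continuous_on (cball z r) g"
      using g sub by (meson ball_subset_cball holomorphic_on_imp_continuous_on holomorphic_on_subset order_trans)+
    fix \<zeta> assume "norm (z - \<zeta>) = r"
    then show "norm (g \<zeta>) \<le> B" using B[of \<zeta>] by (simp add: r_def norm_minus_commute)
  qed (rule r)
  then have "norm (deriv g z) * r \<le> B" using r by (simp add: field_simps)
  then show ?thesis by (simp add: r_def field_simps)
qed

text \<open>Integration by parts: the difference of the two sides has derivative zero on the disc
  and vanishes at 0.\<close>

lemma volterra_I_eq:
  assumes f: "f \<in> analytic_disk" and g: "g \<in> analytic_disk" and z: "z \<in> unit_disk"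
  shows "volterra_I g f z = f z * g z - f 0 * g 0 - volterra_J g f z"
proof -
  define H where "H = (\<lambda>z. volterra_I g f z - (f z * g z - f 0 * g 0 - volterra_J g f z))"
  have hol: "f holomorphic_on unit_disk" "g holomorphic_on unit_disk"
    using f g by (auto simp: analytic_disk_def)
  have "(H has_field_derivative 0) (at z within unit_disk)" if z: "z \<in> unit_disk" for z
  proof -
    have d: "(f has_field_derivative deriv f z) (at z)" "(g has_field_derivative deriv g z) (at z)"
      using hol z by (auto intro!: holomorphic_derivI)
    have "(H has_field_derivative 0) (at z)"
      unfolding H_def
      by (rule derivative_eq_intros volterra_I_analytic(3)[OF f g z] volterra_J_analytic(3)[OF f g z] d refl)+
         (simp add: algebra_simps)
    then show ?thesis by (rule has_field_derivative_at_within)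
  qed
  then obtain c where c: "\<And>z. z \<in> unit_disk \<Longrightarrow> H z = c"
    using has_field_derivative_zero_constant[of unit_disk H] by auto
  have "c = 0" using c[of 0] volterra_I_analytic(2)[OF f g] volterra_J_analytic(2)[OF f g] by (simp add: H_def)
  then show ?thesis using c[OF z] by (simp add: H_def)
qed

lemma powr_sum3_le:
  assumes "p \<ge> 0" "a \<ge> 0" "b \<ge> 0" "c \<ge> (0::real)"
  shows "(a + b + c) powr p \<le> 3 powr p * (a powr p + b powr p + c powr p)"
proof -
  define m where "m = max a (max b c)"
  have "(a + b + c) powr p \<le> (3 * m) powr p"
    using assms by (intro powr_mono2) (auto simp: m_def)
  also have "\<dots> = 3 powr p * m powr p" using assms by (simp add: powr_mult m_def)
  also have "m powr p \<le> a powr p + b powr p + c powr p"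
    unfolding m_def max_def by (auto simp: add_nonneg_nonneg add_increasing add_increasing2)
  finally show ?thesis by simp
qed


text \<open>The product \<open>f z * g z\<close> costs a factor \<open>B\<close> on the logarithm.
  The constant \<open>f 0 * g 0\<close> is controlled by the pointwise bound at the origin together
  with the finite mass of the disc, and \<open>volterra_J g\<close> is covered because a bounded
  \<open>g\<close> is a Bloch function.\<close>

lemma H_infinity_subset_I_mb:
  assumes p: "p \<ge> 1" and \<alpha>: "\<alpha> > -1"
  shows "H_infinity \<subseteq> I_mb p \<alpha>"
proof
  fix g assume "g \<in> H_infinity"
  then obtain B0 where g: "g \<in> analytic_disk" and B0: "\<And>z. z \<in> unit_disk \<Longrightarrow> norm (g z) \<le> B0"
    unfolding H_infinity_def bounded_iff by blast
  define B where "B = max 1 B0"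
  have B: "B \<ge> 1" "\<And>z. z \<in> unit_disk \<Longrightarrow> norm (g z) \<le> B"
    using B0 by (force simp: B_def)+
  have gh: "g holomorphic_on unit_disk" using g by (simp add: analytic_disk_def)
  have g': "(1 - norm z) * norm (deriv g z) \<le> 2 * B" if "z \<in> unit_disk" for z
  proof (rule norm_deriv_le_disk[OF gh])
    show "norm z < 1" using that by simp
    fix \<zeta> assume "norm (\<zeta> - z) = (1 - norm z) / 2"
    then have "norm \<zeta> < 1" using norm_triangle_sub[of \<zeta> z] \<open>norm z < 1\<close> by (simp add: field_simps)
    then show "norm (g \<zeta>) \<le> B" by (intro B(2)) simp
  qed
  obtain K where K: "K > 0" "\<And>f. f \<in> analytic_disk \<Longrightarrow> nev_int p \<alpha> (volterra_J g f) \<le> ennreal K * nev_int p \<alpha> f"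
    using nev_int_volterra_J_le[OF p \<alpha> g _ g'] B(1) by auto
  obtain C where C: "C > 0" "\<And>f z. f \<in> analytic_disk \<Longrightarrow> norm z < 1 \<Longrightarrow>
     ennreal (ln (1 + norm (f z)) powr p * (1 - norm z) powr (2 + \<alpha>)) \<le> ennreal C * nev_int p \<alpha> f"
    using nevanlinna_pointwise_bound[OF p] by blast
  define T where "T = pi * (2 powr (\<alpha> + 1) / (\<alpha> + 1))"
  have T: "T > 0" "(\<integral>\<^sup>+z. disk_weight \<alpha> z \<partial>lborel) \<le> ennreal T"
    using \<alpha> nn_integral_disk_weight[OF \<alpha>] by (simp_all add: T_def)
  define b where "b = 3 powr p * B powr p"
  have b: "b > 0" using B(1) by (simp add: b_def)
  have "nev_int p \<alpha> (volterra_I g f) \<le> ennreal (b + b * C * T + 3 powr p * K) * nev_int p \<alpha> f"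
    if f: "f \<in> analytic_disk" for f
  proof -
    define u where "u = (\<lambda>z. ln (1 + norm (f z)))"
    define v where "v = (\<lambda>z. ln (1 + norm (volterra_J g f z)))"
    have [measurable]: "(\<lambda>z. disk_weight \<alpha> z * ennreal (u z powr p)) \<in> borel_measurable borel"
      "(\<lambda>z. disk_weight \<alpha> z * ennreal (v z powr p)) \<in> borel_measurable borel"
      unfolding u_def v_def using f volterra_J_analytic(1)[OF f g] p by (auto intro!: measurable_nev_integrand)
    have fg: "ln (1 + norm (f z * g z)) \<le> B * u z" if "z \<in> unit_disk" for z
    proof -
      have "norm (f z * g z) \<le> B * norm (f z)"
        using mult_right_mono[OF B(2)[OF that], of "norm (f z)"] by (simp add: norm_mult mult.commute)
      then have "ln (1 + norm (f z * g z)) \<le> ln (1 + B * norm (f z))"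
        using B(1) by (subst ln_le_cancel_iff) (auto simp: add_pos_nonneg)
      also have "\<dots> \<le> B * u z" unfolding u_def using B(1) by (intro ln_one_plus_mult_le) auto
      finally show ?thesis .
    qed
    have pt: "ln (1 + norm (volterra_I g f z)) powr p \<le> b * u z powr p + b * u 0 powr p + 3 powr p * v z powr p"
      if z: "z \<in> unit_disk" for z
    proof -
      have "norm (volterra_I g f z) \<le> norm (f z * g z) + norm (f 0 * g 0) + norm (volterra_J g f z)"
        unfolding volterra_I_eq[OF f g z]
        using norm_triangle_ineq4[of "f z * g z - f 0 * g 0" "volterra_J g f z"]
          norm_triangle_ineq4[of "f z * g z" "f 0 * g 0"] by linarith
      then have "ln (1 + norm (volterra_I g f z)) \<le> ln (1 + (norm (f z * g z) + norm (f 0 * g 0) + norm (volterra_J g f z)))"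
        by (subst ln_le_cancel_iff) (auto simp: add_pos_nonneg)
      also have "\<dots> \<le> ln (1 + (norm (f z * g z) + norm (f 0 * g 0))) + v z"
        unfolding v_def by (intro ln_one_plus_add_le) auto
      also have "ln (1 + (norm (f z * g z) + norm (f 0 * g 0))) \<le> ln (1 + norm (f z * g z)) + ln (1 + norm (f 0 * g 0))"
        by (intro ln_one_plus_add_le) auto
      also have "ln (1 + norm (f z * g z)) \<le> B * u z" by (rule fg[OF z])
      also have "ln (1 + norm (f 0 * g 0)) \<le> B * u 0" by (rule fg) simp
      finally have "ln (1 + norm (volterra_I g f z)) powr p \<le> (B * u z + B * u 0 + v z) powr p"
        using p by (intro powr_mono2) auto
      also have "\<dots> \<le> 3 powr p * ((B * u z) powr p + (B * u 0) powr p + v z powr p)"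
        using p B(1) by (intro powr_sum3_le) (auto simp: u_def v_def)
      also have "\<dots> = b * u z powr p + b * u 0 powr p + 3 powr p * v z powr p"
        using B(1) by (simp add: powr_mult u_def b_def algebra_simps)
      finally show ?thesis .
    qed
    have u0: "ennreal (u 0 powr p) \<le> ennreal C * nev_int p \<alpha> f"
      using C(2)[OF f, of 0] by (simp add: u_def)
    have "nev_int p \<alpha> (volterra_I g f) \<le> (\<integral>\<^sup>+z. (ennreal b * (disk_weight \<alpha> z * ennreal (u z powr p))
        + ennreal b * ennreal (u 0 powr p) * disk_weight \<alpha> z)
        + ennreal (3 powr p) * (disk_weight \<alpha> z * ennreal (v z powr p)) \<partial>lborel)"
      unfolding nev_int_def
    proof (intro nn_integral_mono)
      fix z
      show "disk_weight \<alpha> z * ennreal (ln (1 + norm (volterra_I g f z)) powr p)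
        \<le> (ennreal b * (disk_weight \<alpha> z * ennreal (u z powr p)) + ennreal b * ennreal (u 0 powr p) * disk_weight \<alpha> z)
        + ennreal (3 powr p) * (disk_weight \<alpha> z * ennreal (v z powr p))"
      proof (cases "z \<in> unit_disk")
        case True
        have "disk_weight \<alpha> z * ennreal (ln (1 + norm (volterra_I g f z)) powr p)
            \<le> disk_weight \<alpha> z * ennreal (b * u z powr p + b * u 0 powr p + 3 powr p * v z powr p)"
          by (intro mult_left_mono ennreal_leI pt True) auto
        also have "\<dots> = (ennreal b * (disk_weight \<alpha> z * ennreal (u z powr p)) + ennreal b * ennreal (u 0 powr p) * disk_weight \<alpha> z)
            + ennreal (3 powr p) * (disk_weight \<alpha> z * ennreal (v z powr p))"
          using b by (simp add: ennreal_plus ennreal_mult distrib_left mult_ac)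
        finally show ?thesis .
      qed (simp add: disk_weight_def)
    qed
    also have "\<dots> = ennreal b * nev_int p \<alpha> f + ennreal b * ennreal (u 0 powr p) * (\<integral>\<^sup>+z. disk_weight \<alpha> z \<partial>lborel)
        + ennreal (3 powr p) * nev_int p \<alpha> (volterra_J g f)"
    proof -
      have "nev_int p \<alpha> f = (\<integral>\<^sup>+z. disk_weight \<alpha> z * ennreal (u z powr p) \<partial>lborel)"
        "nev_int p \<alpha> (volterra_J g f) = (\<integral>\<^sup>+z. disk_weight \<alpha> z * ennreal (v z powr p) \<partial>lborel)"
        by (simp_all add: nev_int_def u_def v_def)
      then show ?thesis by (simp add: nn_integral_add nn_integral_cmult)
    qed
    also have "\<dots> \<le> ennreal b * nev_int p \<alpha> f + ennreal b * (ennreal C * nev_int p \<alpha> f) * ennreal T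
        + ennreal (3 powr p) * (ennreal K * nev_int p \<alpha> f)"
      by (intro add_mono mult_mono mult_left_mono order_refl u0 T(2) K(2) f) auto
    also have "\<dots> = ennreal (b + b * C * T + 3 powr p * K) * nev_int p \<alpha> f"
      using b C(1) T(1) K(1) by (simp add: ennreal_plus ennreal_mult distrib_left distrib_right mult_ac)
    finally show ?thesis .
  qed
  moreover have "b + b * C * T + 3 powr p * K > 0"
    using b C(1) T(1) K(1) by (simp add: add_pos_pos)
  ultimately have "metrically_bounded p \<alpha> (volterra_I g)"
    using metrically_bounded_iff[of p \<alpha> "volterra_I g"] volterra_I_analytic(1)[OF _ g] p \<alpha> by auto
  then show "g \<in> I_mb p \<alpha>" using g by (simp add: I_mb_def)
qed

section \<open>Necessity\<close>

text \<open>On the input side \<open>ln (1 + u) \<le> u\<close> brings out \<open>t powr p\<close>,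
  which cancels against \<open>norm (T f z) powr p\<close> on the output side. The bound is then
  moved to the derivative, because differentiation removes the integral from a Volterra
  operator.\<close>

lemma metrically_bounded_imp_deriv_bound:
  assumes p: "p \<ge> 1" and \<alpha>: "\<alpha> > -1"
    and T: "\<And>f. f \<in> analytic_disk \<Longrightarrow> T f \<in> analytic_disk"
    and hom: "\<And>f t z. f \<in> analytic_disk \<Longrightarrow> z \<in> unit_disk \<Longrightarrow> T (\<lambda>z. of_real t * f z) z = of_real t * T f z"
    and mb: "metrically_bounded p \<alpha> T"
  obtains C where "C > 0" "\<And>f w x. f \<in> analytic_disk \<Longrightarrow> norm w < 1 \<Longrightarrow> x \<ge> 0 \<Longrightarrow>
     (\<integral>\<^sup>+z. disk_weight \<alpha> z * ennreal (norm (f z) powr p) \<partial>lborel) \<le> ennreal x \<Longrightarrow>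
     (1 - norm w) * norm (deriv (T f) w) \<le> C * x powr (1 / p) * (1 - norm w) powr (- (2 + \<alpha>) / p)"
proof -
  obtain K where K: "K > 0"
    "\<And>f. f \<in> analytic_disk \<Longrightarrow> nev_int p \<alpha> f < \<infinity> \<Longrightarrow> nev_int p \<alpha> (T f) \<le> ennreal K * nev_int p \<alpha> f"
    using mb p metrically_bounded_iff[of p \<alpha> T] \<alpha> T by auto
  obtain C0 where C0: "C0 > 0" "\<And>f z. f \<in> analytic_disk \<Longrightarrow> norm z < 1 \<Longrightarrow>
     ennreal (ln (1 + norm (f z)) powr p * (1 - norm z) powr (2 + \<alpha>)) \<le> ennreal C0 * nev_int p \<alpha> f"
    using nevanlinna_pointwise_bound[OF p] by blast
  define C1 where "C1 = C0 * K / ln 2 powr p"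
  have C1: "C1 > 0" using C0(1) K(1) by (simp add: C1_def)
  have bd: "norm (T f z) powr p * (1 - norm z) powr (2 + \<alpha>) \<le> C1 * x"
    if f: "f \<in> analytic_disk" and z: "norm z < 1" and x: "x \<ge> 0"
      and I: "(\<integral>\<^sup>+z. disk_weight \<alpha> z * ennreal (norm (f z) powr p) \<partial>lborel) \<le> ennreal x" for f z x
  proof (cases "T f z = 0")
    case True
    then show ?thesis using x C1 by simp
  next
    case False
    \<comment> \<open>with this scaling the logarithm of the image at \<open>z\<close> is \<open>ln 2\<close>, so no limit \<open>t \<rightarrow> 0\<close> is needed\<close>
    define t where "t = 1 / norm (T f z)"
    have t: "t > 0" using False by (simp add: t_def)
    define h where "h = (\<lambda>z. of_real t * f z)"
    have h: "h \<in> analytic_disk" using f by (auto simp: h_def analytic_disk_def intro!: holomorphic_intros)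
    have [measurable]: "(\<lambda>z. disk_weight \<alpha> z * ennreal (norm (f z) powr p)) \<in> borel_measurable borel"
    proof -
      have [measurable]: "(\<lambda>z. indicator unit_disk z * ennreal (norm (f z) powr p)) \<in> borel_measurable borel"
        using f p by (intro borel_measurable_indicator_ennreal continuous_on_powr' continuous_intros
            holomorphic_on_imp_continuous_on) (auto simp: analytic_disk_def)
      have "(\<lambda>z. disk_weight \<alpha> z * (indicator unit_disk z * ennreal (norm (f z) powr p))) \<in> borel_measurable borel"
        by measurable
      also have "(\<lambda>z. disk_weight \<alpha> z * (indicator unit_disk z * ennreal (norm (f z) powr p)))
          = (\<lambda>z. disk_weight \<alpha> z * ennreal (norm (f z) powr p))"
        by (auto simp: disk_weight_def split: split_indicator)
      finally show ?thesis .
    qed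
    have "nev_int p \<alpha> h \<le> (\<integral>\<^sup>+z. ennreal (t powr p) * (disk_weight \<alpha> z * ennreal (norm (f z) powr p)) \<partial>lborel)"
      unfolding nev_int_def
    proof (intro nn_integral_mono)
      fix z
      have "ln (1 + norm (h z)) \<le> t * norm (f z)"
        using t ln_add_one_self_le_self[of "norm (h z)"] by (simp add: h_def norm_mult)
      then have "ln (1 + norm (h z)) powr p \<le> (t * norm (f z)) powr p"
        using p by (intro powr_mono2) auto
      also have "\<dots> = t powr p * norm (f z) powr p" using t by (simp add: powr_mult)
      finally have "disk_weight \<alpha> z * ennreal (ln (1 + norm (h z)) powr p)
          \<le> disk_weight \<alpha> z * ennreal (t powr p * norm (f z) powr p)"
        by (intro mult_left_mono ennreal_leI) auto
      then show "disk_weight \<alpha> z * ennreal (ln (1 + norm (h z)) powr p)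
          \<le> ennreal (t powr p) * (disk_weight \<alpha> z * ennreal (norm (f z) powr p))"
        by (simp add: ennreal_mult mult_ac)
    qed
    also have "\<dots> = ennreal (t powr p) * (\<integral>\<^sup>+z. disk_weight \<alpha> z * ennreal (norm (f z) powr p) \<partial>lborel)"
      by (rule nn_integral_cmult) auto
    also have "\<dots> \<le> ennreal (t powr p) * ennreal x" by (intro mult_left_mono I) auto
    also have "\<dots> = ennreal (t powr p * x)" using x by (simp add: ennreal_mult)
    finally have nh: "nev_int p \<alpha> h \<le> ennreal (t powr p * x)" .
    then have "nev_int p \<alpha> h < \<infinity>" by (rule order_le_less_trans) simp
    have "T h z = of_real t * T f z" unfolding h_def using f z by (intro hom) auto
    then have "norm (T h z) = 1" using False by (simp add: norm_mult norm_divide t_def)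
    then have "ennreal (ln 2 powr p * (1 - norm z) powr (2 + \<alpha>)) \<le> ennreal C0 * nev_int p \<alpha> (T h)"
      using C0(2)[OF T[OF h] z] by simp
    also have "\<dots> \<le> ennreal C0 * (ennreal K * ennreal (t powr p * x))"
      by (intro mult_left_mono order_trans[OF K(2)[OF h \<open>nev_int p \<alpha> h < \<infinity>\<close>]] nh) auto
    also have "\<dots> = ennreal (C0 * K * (t powr p * x))" using C0(1) K(1) x by (simp add: ennreal_mult mult_ac)
    finally have le: "ln 2 powr p * (1 - norm z) powr (2 + \<alpha>) \<le> C0 * K * (t powr p * x)"
      using C0(1) K(1) x by (subst (asm) ennreal_le_iff) auto
    have "t powr p * norm (T f z) powr p = 1"
      using False by (simp add: t_def powr_mult[symmetric])
    then have eq: "norm (T f z) powr p * (C0 * K * (t powr p * x)) = C0 * K * x"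
      by (metis mult.assoc mult.commute mult.right_neutral)
    have "norm (T f z) powr p * (ln 2 powr p * (1 - norm z) powr (2 + \<alpha>)) \<le> C0 * K * x"
      using mult_left_mono[OF le, of "norm (T f z) powr p"] unfolding eq by simp
    then show ?thesis by (simp add: C1_def field_simps)
  qed
  define C where "C = 2 * (C1 * 2 powr (2 + \<alpha>)) powr (1 / p)"
  show thesis
  proof (rule that[of C])
    show "C > 0" using C1 by (simp add: C_def)
    fix f w x
    assume f: "f \<in> analytic_disk" and w: "norm (w::complex) < 1" and x: "x \<ge> (0::real)"
      and I: "(\<integral>\<^sup>+z. disk_weight \<alpha> z * ennreal (norm (f z) powr p) \<partial>lborel) \<le> ennreal x"
    define \<delta> where "\<delta> = 1 - norm w"
    have \<delta>: "\<delta> > 0" using w by (simp add: \<delta>_def)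
    have "\<delta> * norm (deriv (T f) w) \<le> 2 * ((C1 * 2 powr (2 + \<alpha>)) powr (1 / p) * x powr (1 / p) * \<delta> powr (- (2 + \<alpha>) / p))"
      unfolding \<delta>_def
    proof (rule norm_deriv_le_disk)
      show "T f holomorphic_on unit_disk" using T[OF f] by (simp add: analytic_disk_def)
      fix \<zeta> assume \<zeta>: "norm (\<zeta> - w) = (1 - norm w) / 2"
      have "norm \<zeta> \<le> norm w + \<delta> / 2" using norm_triangle_sub[of \<zeta> w] unfolding \<zeta> \<delta>_def by assumption
      \<comment> \<open>On the Cauchy circle the boundary distance is at least half of that at
        \<open>w\<close>, whence the factor \<open>2 powr (2 + \<alpha>)\<close>.\<close>
      then have d: "\<delta> / 2 \<le> 1 - norm \<zeta>" by (simp add: \<delta>_def field_simps)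
      then have "norm \<zeta> < 1" using \<delta> by linarith
      have "norm (T f \<zeta>) powr p * (\<delta> / 2) powr (2 + \<alpha>) \<le> norm (T f \<zeta>) powr p * (1 - norm \<zeta>) powr (2 + \<alpha>)"
        using d \<delta> \<alpha> by (intro mult_left_mono powr_mono2) auto
      also have "\<dots> \<le> C1 * x" by (rule bd[OF f \<open>norm \<zeta> < 1\<close> x I])
      finally have "norm (T f \<zeta>) powr p \<le> C1 * x / (\<delta> / 2) powr (2 + \<alpha>)"
        using \<delta> by (simp add: field_simps)
      also have "\<dots> = (C1 * 2 powr (2 + \<alpha>)) * x * \<delta> powr (- (2 + \<alpha>))"
      proof -
        have "(\<delta> / 2) powr (2 + \<alpha>) = \<delta> powr (2 + \<alpha>) / 2 powr (2 + \<alpha>)"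
          using \<delta> by (simp add: powr_divide)
        moreover have "\<delta> powr (- (2 + \<alpha>)) = 1 / \<delta> powr (2 + \<alpha>)" by (rule powr_minus_divide)
        ultimately show ?thesis by simp
      qed
      finally have "(norm (T f \<zeta>) powr p) powr (1 / p) \<le> ((C1 * 2 powr (2 + \<alpha>)) * x * \<delta> powr (- (2 + \<alpha>))) powr (1 / p)"
        using p by (intro powr_mono2) auto
      also have "\<dots> = (C1 * 2 powr (2 + \<alpha>)) powr (1 / p) * x powr (1 / p) * \<delta> powr (- (2 + \<alpha>) / p)"
      proof -
        have e: "(\<delta> powr (- (2 + \<alpha>))) powr (1 / p) = \<delta> powr (- (2 + \<alpha>) / p)" by (simp only: powr_powr) simp
        show ?thesis unfolding e[symmetric] using C1 x by (simp add: powr_mult)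
      qed
      finally show "norm (T f \<zeta>) \<le> (C1 * 2 powr (2 + \<alpha>)) powr (1 / p) * x powr (1 / p) * (1 - norm w) powr (- (2 + \<alpha>) / p)"
        using p by (simp add: powr_powr \<delta>_def)
    qed (rule w)
    then show "(1 - norm w) * norm (deriv (T f) w) \<le> C * x powr (1 / p) * (1 - norm w) powr (- (2 + \<alpha>) / p)"
      by (simp add: C_def \<delta>_def mult.assoc)
  qed
qed


text \<open>A negative power as an integral over levels; the condition \<open>X \<le> h\<close> on
  the level is what becomes a Carleson box.\<close>

lemma powr_minus_eq_nn_integral:
  assumes "X > 0" "s > (0::real)"
  shows "ennreal (X powr - s) = ennreal s * (\<integral>\<^sup>+h. ennreal (h powr (- s - 1)) * indicator {X..} h \<partial>lborel)"
proof -
  have "(\<integral>\<^sup>+h. ennreal (h powr (- s - 1)) * indicator {X..} h \<partial>lborel)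
      = ennreal (- (X powr (- s - 1 + 1)) / (- s - 1 + 1))"
    using assms by (intro nn_integral_has_integral_lebesgue' has_integral_powr_to_inf) auto
  also have "\<dots> = ennreal (X powr - s / s)" by simp
  finally show ?thesis using assms by (simp add: ennreal_mult[symmetric])
qed

text \<open>The layer-cake formula reduces this Forelli--Rudin estimate to the Carleson boxes.\<close>

lemma nn_integral_disk_weight_kernel:
  assumes \<alpha>: "\<alpha> > -1" and s: "s > 2 + \<alpha>"
  obtains C where "C > 0" "\<And>w. norm w < 1 \<Longrightarrow>
     (\<integral>\<^sup>+z. disk_weight \<alpha> z * ennreal (norm (1 - cnj w * z) powr - s) \<partial>lborel)
       \<le> ennreal (C * (1 - norm w) powr (2 + \<alpha> - s))"
proof -
  obtain C where C: "C > 0" "\<And>a h. norm a = 1 \<Longrightarrow> h > 0 \<Longrightarrow>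
       (\<integral>\<^sup>+z. disk_weight \<alpha> z * indicator (ball a h) z \<partial>lborel) \<le> ennreal (C * h powr (\<alpha> + 2))"
    using disk_weight_Carleson[OF \<alpha>] by blast
  have s0: "s > 0" using \<alpha> s by simp
  define c where "c = C * 3 powr (\<alpha> + 2)"
  have c: "c > 0" using C(1) by (simp add: c_def)
  show thesis
  proof (rule that[of "s * (c * (1 / (s - (2 + \<alpha>))))"])
    show "s * (c * (1 / (s - (2 + \<alpha>)))) > 0" using s0 s c by simp
    fix w :: complex assume w: "norm w < 1"
    define \<delta> where "\<delta> = 1 - norm w"
    have \<delta>: "\<delta> > 0" using w by (simp add: \<delta>_def)
    define a where "a = (if w = 0 then 1 else sgn w)"
    have a: "norm a = 1" "w = of_real (norm w) * a"
      by (auto simp: a_def sgn_eq norm_divide)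
    \<comment> \<open>\<open>1 - cnj w * z\<close> has the modulus of \<open>a - norm w * z\<close>,
      with \<open>a\<close> the radial projection of \<open>w\<close>, and this differs from
      \<open>a - z\<close> by at most \<delta>. Small values thus confine \<open>z\<close> to a ball
      about \<open>a\<close>.\<close>
    have X: "\<delta> \<le> norm (1 - cnj w * z)" "dist a z \<le> 2 * norm (1 - cnj w * z)" if z: "norm z < 1" for z
    proof -
      have "norm (cnj w * z) \<le> norm w" using z by (simp add: norm_mult mult_left_le)
      then show 1: "\<delta> \<le> norm (1 - cnj w * z)"
        using norm_triangle_ineq2[of 1 "cnj w * z"] by (simp add: \<delta>_def)
      have aa: "a * cnj a = 1" using complex_norm_square[of a] a(1) by simp
      have cw: "cnj w = of_real (norm w) * cnj a" by (subst a(2)) simp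
      have "a * (1 - cnj w * z) = a - (a * cnj a) * (of_real (norm w) * z)"
        unfolding cw by (simp add: algebra_simps)
      then have "norm (a * (1 - cnj w * z)) = norm (a - of_real (norm w) * z)"
        unfolding aa by simp
      then have "norm (a - of_real (norm w) * z) = norm (1 - cnj w * z)"
        unfolding norm_mult a(1) by simp
      moreover have "norm (of_real (norm w) * z - z) \<le> \<delta>"
      proof -
        have "of_real (norm w) * z - z = - (of_real \<delta> * z)" by (simp add: \<delta>_def algebra_simps)
        then show ?thesis using z \<delta> by (simp add: norm_mult mult_left_le)
      qed
      moreover have "norm (a - z) \<le> norm (a - of_real (norm w) * z) + norm (of_real (norm w) * z - z)"
        using norm_triangle_ineq[of "a - of_real (norm w) * z" "of_real (norm w) * z - z"] by simp
      ultimately show "dist a z \<le> 2 * norm (1 - cnj w * z)" using 1 by (simp add: dist_norm)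
    qed
    \<comment> \<open>The radius is \<open>3 * h\<close> rather than \<open>2 * h\<close> to turn a
      closed condition into an open ball.\<close>
    define R where "R = (\<lambda>z h. if dist a z < 3 * h then 1 else (0::ennreal))"
    have [measurable]: "(\<lambda>x. R (fst x) (snd x)) \<in> borel_measurable (lborel \<Otimes>\<^sub>M lborel)"
      "\<And>h. (\<lambda>z. R z h) \<in> borel_measurable borel" "\<And>z. (\<lambda>h. R z h) \<in> borel_measurable borel"
      unfolding R_def by measurable
    \<comment> \<open>The levels start at \<delta>, below which no point of the disc qualifies; this
      lower limit produces the power of \<open>1 - norm w\<close>.\<close>
    define k where "k = (\<lambda>h::real. ennreal (h powr (- s - 1)) * indicator {\<delta>..} h)"
    have [measurable]: "k \<in> borel_measurable borel" unfolding k_def by measurable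
    have "(\<integral>\<^sup>+h. (\<integral>\<^sup>+z. disk_weight \<alpha> z * (k h * R z h) \<partial>lborel) \<partial>lborel)
        \<le> (\<integral>\<^sup>+h. ennreal c * (ennreal (h powr (\<alpha> + 1 - s)) * indicator {\<delta>..} h) \<partial>lborel)"
    proof (intro nn_integral_mono)
      fix h
      show "(\<integral>\<^sup>+z. disk_weight \<alpha> z * (k h * R z h) \<partial>lborel)
          \<le> ennreal c * (ennreal (h powr (\<alpha> + 1 - s)) * indicator {\<delta>..} h)"
      proof (cases "\<delta> \<le> h")
        case True
        then have h: "h > 0" using \<delta> by linarith
        have "(\<integral>\<^sup>+z. disk_weight \<alpha> z * (k h * R z h) \<partial>lborel) = k h * (\<integral>\<^sup>+z. disk_weight \<alpha> z * R z h \<partial>lborel)"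
          by (subst nn_integral_cmult[symmetric]) (auto simp: mult.left_commute)
        also have "(\<integral>\<^sup>+z. disk_weight \<alpha> z * R z h \<partial>lborel) = (\<integral>\<^sup>+z. disk_weight \<alpha> z * indicator (ball a (3 * h)) z \<partial>lborel)"
          by (intro nn_integral_cong) (simp add: R_def split: split_indicator)
        also have "\<dots> \<le> ennreal (C * (3 * h) powr (\<alpha> + 2))" using h a(1) by (intro C(2)) auto
        also have "k h * ennreal (C * (3 * h) powr (\<alpha> + 2)) = ennreal c * ennreal (h powr (\<alpha> + 1 - s))"
        proof -
          have "h powr (\<alpha> + 1 - s) = h powr (- s - 1) * h powr (\<alpha> + 2)"
            by (simp add: powr_add[symmetric] algebra_simps)
          then have "h powr (- s - 1) * (C * (3 * h) powr (\<alpha> + 2)) = c * h powr (\<alpha> + 1 - s)"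
            using h by (simp add: c_def powr_mult)
          then show ?thesis using True C(1) c by (simp add: k_def ennreal_mult[symmetric])
        qed
        finally show ?thesis using True by (simp add: mult_left_mono)
      qed (simp add: k_def)
    qed
    also have "\<dots> = ennreal c * (\<integral>\<^sup>+h. ennreal (h powr (\<alpha> + 1 - s)) * indicator {\<delta>..} h \<partial>lborel)"
      by (rule nn_integral_cmult) auto
    \<comment> \<open>The tail integral converges because \<open>s > 2 + \<alpha>\<close> puts the
      exponent below -1.\<close>
    also have "(\<integral>\<^sup>+h. ennreal (h powr (\<alpha> + 1 - s)) * indicator {\<delta>..} h \<partial>lborel)
        = ennreal (- (\<delta> powr (\<alpha> + 1 - s + 1)) / (\<alpha> + 1 - s + 1))"
      using \<delta> s by (intro nn_integral_has_integral_lebesgue' has_integral_powr_to_inf) auto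
    also have "- (\<delta> powr (\<alpha> + 1 - s + 1)) / (\<alpha> + 1 - s + 1) = 1 / (s - (2 + \<alpha>)) * \<delta> powr (2 + \<alpha> - s)"
    proof -
      have d: "- d / (2 + \<alpha> - s) = d / - (2 + \<alpha> - s)" for d
        by (simp only: divide_minus_right minus_divide_left)
      have e: "\<alpha> + 1 - s + 1 = 2 + \<alpha> - s" by simp
      show ?thesis unfolding e d by simp
    qed
    also have "ennreal c * ennreal (1 / (s - (2 + \<alpha>)) * \<delta> powr (2 + \<alpha> - s))
        = ennreal (c * (1 / (s - (2 + \<alpha>)) * \<delta> powr (2 + \<alpha> - s)))"
      using c s by (intro ennreal_mult[symmetric]) auto
    finally have inner: "(\<integral>\<^sup>+h. (\<integral>\<^sup>+z. disk_weight \<alpha> z * (k h * R z h) \<partial>lborel) \<partial>lborel)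
        \<le> ennreal (c * (1 / (s - (2 + \<alpha>)) * \<delta> powr (2 + \<alpha> - s)))" .
    have "(\<integral>\<^sup>+z. disk_weight \<alpha> z * ennreal (norm (1 - cnj w * z) powr - s) \<partial>lborel)
        \<le> (\<integral>\<^sup>+z. disk_weight \<alpha> z * (ennreal s * (\<integral>\<^sup>+h. k h * R z h \<partial>lborel)) \<partial>lborel)"
    proof (intro nn_integral_mono)
      fix z
      show "disk_weight \<alpha> z * ennreal (norm (1 - cnj w * z) powr - s)
          \<le> disk_weight \<alpha> z * (ennreal s * (\<integral>\<^sup>+h. k h * R z h \<partial>lborel))"
      proof (cases "norm z < 1")
        case True
        have X0: "norm (1 - cnj w * z) > 0" using X(1)[OF True] \<delta> by linarith
        have "ennreal (norm (1 - cnj w * z) powr - s)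
          = ennreal s * (\<integral>\<^sup>+h. ennreal (h powr (- s - 1)) * indicator {norm (1 - cnj w * z)..} h \<partial>lborel)"
          by (rule powr_minus_eq_nn_integral[OF X0 s0])
        also have "\<dots> \<le> ennreal s * (\<integral>\<^sup>+h. k h * R z h \<partial>lborel)"
        proof (intro mult_left_mono nn_integral_mono)
          fix h
          show "ennreal (h powr (- s - 1)) * indicator {norm (1 - cnj w * z)..} h \<le> k h * R z h"
          proof (cases "norm (1 - cnj w * z) \<le> h")
            case h: True
            have "dist a z < 3 * h" using X(2)[OF True] h X0 by linarith
            moreover have "\<delta> \<le> h" using X(1)[OF True] h by linarith
            ultimately show ?thesis using h by (simp add: k_def R_def)
          qed simp
        qed simp
        finally show ?thesis by (intro mult_left_mono) auto
      qed (simp add: disk_weight_def)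
    qed
    also have "\<dots> = (\<integral>\<^sup>+z. ennreal s * (\<integral>\<^sup>+h. disk_weight \<alpha> z * (k h * R z h) \<partial>lborel) \<partial>lborel)"
      by (intro nn_integral_cong) (subst nn_integral_cmult, auto simp: mult.left_commute)
    also have "\<dots> = ennreal s * (\<integral>\<^sup>+z. (\<integral>\<^sup>+h. disk_weight \<alpha> z * (k h * R z h) \<partial>lborel) \<partial>lborel)"
      by (rule nn_integral_cmult) (rule lborel.borel_measurable_nn_integral, simp add: case_prod_beta)
    also have "(\<integral>\<^sup>+z. (\<integral>\<^sup>+h. disk_weight \<alpha> z * (k h * R z h) \<partial>lborel) \<partial>lborel)
        = (\<integral>\<^sup>+h. (\<integral>\<^sup>+z. disk_weight \<alpha> z * (k h * R z h) \<partial>lborel) \<partial>lborel)"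
      by (rule lborel_pair.Fubini'[symmetric]) (simp add: case_prod_beta)
    also have "ennreal s * (\<integral>\<^sup>+h. (\<integral>\<^sup>+z. disk_weight \<alpha> z * (k h * R z h) \<partial>lborel) \<partial>lborel)
        \<le> ennreal s * ennreal (c * (1 / (s - (2 + \<alpha>)) * \<delta> powr (2 + \<alpha> - s)))"
      by (intro mult_left_mono inner) simp
    also have "\<dots> = ennreal (s * (c * (1 / (s - (2 + \<alpha>)) * \<delta> powr (2 + \<alpha> - s))))"
      using c s s0 by (intro ennreal_mult[symmetric]) auto
    finally show "(\<integral>\<^sup>+z. disk_weight \<alpha> z * ennreal (norm (1 - cnj w * z) powr - s) \<partial>lborel)
       \<le> ennreal (s * (c * (1 / (s - (2 + \<alpha>)))) * (1 - norm w) powr (2 + \<alpha> - s))"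
      by (simp only: \<delta>_def mult.assoc)
  qed
qed

text \<open>A power of the Szego kernel, whose base at \<open>z = w\<close> is exactly
  \<open>1 - (norm w)^2\<close>. An integer exponent avoids a choice of branch.\<close>

definition test_fun :: "nat \<Rightarrow> complex \<Rightarrow> complex \<Rightarrow> complex" where
  "test_fun n w z = 1 / (1 - cnj w * z) ^ n"

lemma one_minus_cnj_mult_nz:
  assumes "norm w < 1" "norm z < 1"
  shows "1 - cnj w * z \<noteq> 0"
proof
  assume "1 - cnj w * z = 0"
  then have "norm (cnj w * z) = 1" by simp
  moreover have "norm (cnj w * z) \<le> norm w" using assms by (simp add: norm_mult mult_left_le)
  ultimately show False using assms by simp
qed

lemma test_fun_analytic: "norm w < 1 \<Longrightarrow> test_fun n w \<in> analytic_disk"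
  unfolding analytic_disk_def test_fun_def[abs_def]
  by (auto intro!: holomorphic_intros dest: one_minus_cnj_mult_nz)

lemma test_fun_derivative:
  assumes "norm w < 1" "norm z < 1" "n > 0"
  shows "(test_fun n w has_field_derivative of_nat n * cnj w / (1 - cnj w * z) ^ (n + 1)) (at z)"
proof -
  define y where "y = 1 - cnj w * z"
  have y: "y \<noteq> 0" using one_minus_cnj_mult_nz[OF assms(1,2)] by (simp add: y_def)
  have "(test_fun n w has_field_derivative - (of_nat n * (- cnj w) * y ^ (n - 1)) / (y ^ n * y ^ n)) (at z)"
    unfolding test_fun_def[abs_def] y_def
    by (rule derivative_eq_intros refl | use y in \<open>simp add: y_def\<close>)+
  also have "- (of_nat n * (- cnj w) * y ^ (n - 1)) / (y ^ n * y ^ n) = of_nat n * cnj w / y ^ (n + 1)"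
    using y assms(3) by (cases n) (auto simp: field_simps)
  finally show ?thesis by (simp add: y_def)
qed

lemma norm_one_minus_cnj_self: "norm w < 1 \<Longrightarrow> norm (1 - cnj w * w) = 1 - (norm w)\<^sup>2"
proof -
  assume w: "norm w < 1"
  have "1 - cnj w * w = of_real (1 - (norm w)\<^sup>2)"
    using complex_norm_square[of w] by (simp add: mult.commute)
  then show ?thesis using w by (simp only: norm_of_real) (simp add: power_le_one)
qed

text \<open>The size of the test function contributes \<open>(2 + \<alpha>) / p - n\<close> to the
  exponent of \<open>1 - norm w\<close>, the growth estimate contributes
  \<open>- (2 + \<alpha>) / p\<close>; in the sum only \<open>- n\<close> remains.\<close>

lemma metrically_bounded_imp_test_fun_bound:
  assumes p: "p \<ge> 1" and \<alpha>: "\<alpha> > -1"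
    and T: "\<And>f. f \<in> analytic_disk \<Longrightarrow> T f \<in> analytic_disk"
    and hom: "\<And>f t z. f \<in> analytic_disk \<Longrightarrow> z \<in> unit_disk \<Longrightarrow> T (\<lambda>z. of_real t * f z) z = of_real t * T f z"
    and mb: "metrically_bounded p \<alpha> T"
  obtains C n where "C > 0" "n > 0"
    "\<And>w. norm w < 1 \<Longrightarrow> (1 - norm w) ^ (n + 1) * norm (deriv (T (test_fun n w)) w) \<le> C"
proof -
  \<comment> \<open>Strictly above 2 + \<alpha>, so with \<open>p \<ge> 1\<close> the exponent
    \<open>n * p\<close> is admissible for the kernel estimate.\<close>
  define n where "n = nat \<lceil>2 + \<alpha>\<rceil> + 1"
  have n: "real n > 2 + \<alpha>" unfolding n_def by linarith
  have np: "real n * p > 2 + \<alpha>" using n p mult_left_mono[OF p, of "real n"] by simp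
  obtain C1 where C1: "C1 > 0" "\<And>w. norm w < 1 \<Longrightarrow>
     (\<integral>\<^sup>+z. disk_weight \<alpha> z * ennreal (norm (1 - cnj w * z) powr - (real n * p)) \<partial>lborel)
       \<le> ennreal (C1 * (1 - norm w) powr (2 + \<alpha> - real n * p))"
    using nn_integral_disk_weight_kernel[OF \<alpha> np] by blast
  obtain C where C: "C > 0" "\<And>f w x. f \<in> analytic_disk \<Longrightarrow> norm w < 1 \<Longrightarrow> x \<ge> 0 \<Longrightarrow>
     (\<integral>\<^sup>+z. disk_weight \<alpha> z * ennreal (norm (f z) powr p) \<partial>lborel) \<le> ennreal x \<Longrightarrow>
     (1 - norm w) * norm (deriv (T f) w) \<le> C * x powr (1 / p) * (1 - norm w) powr (- (2 + \<alpha>) / p)"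
    using metrically_bounded_imp_deriv_bound[OF p \<alpha> T hom mb] by blast
  show thesis
  proof (rule that[of "C * C1 powr (1 / p)" n])
    show "C * C1 powr (1 / p) > 0" using C(1) C1(1) by simp
    show "n > 0" by (simp add: n_def)
    fix w :: complex assume w: "norm w < 1"
    define \<delta> where "\<delta> = 1 - norm w"
    have \<delta>: "\<delta> > 0" using w by (simp add: \<delta>_def)
    define x where "x = C1 * \<delta> powr (2 + \<alpha> - real n * p)"
    have x: "x \<ge> 0" using C1(1) by (simp add: x_def)
    have "(\<integral>\<^sup>+z. disk_weight \<alpha> z * ennreal (norm (test_fun n w z) powr p) \<partial>lborel)
        = (\<integral>\<^sup>+z. disk_weight \<alpha> z * ennreal (norm (1 - cnj w * z) powr - (real n * p)) \<partial>lborel)"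
    proof (intro nn_integral_cong)
      fix z
      show "disk_weight \<alpha> z * ennreal (norm (test_fun n w z) powr p)
          = disk_weight \<alpha> z * ennreal (norm (1 - cnj w * z) powr - (real n * p))"
      proof (cases "norm z < 1")
        case True
        define y where "y = norm (1 - cnj w * z)"
        have y: "y > 0" using one_minus_cnj_mult_nz[OF w True] by (simp add: y_def)
        have "norm (test_fun n w z) = y powr - real n"
          using y by (simp add: test_fun_def norm_divide norm_power y_def[symmetric] powr_minus_divide powr_realpow)
        then show ?thesis by (simp add: powr_powr y_def)
      qed (simp add: disk_weight_def)
    qed
    also have "\<dots> \<le> ennreal x" unfolding x_def \<delta>_def by (rule C1(2)[OF w])
    finally have "\<delta> * norm (deriv (T (test_fun n w)) w) \<le> C * x powr (1 / p) * \<delta> powr (- (2 + \<alpha>) / p)"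
      unfolding \<delta>_def by (intro C(2) test_fun_analytic w x)
    also have "C * x powr (1 / p) * \<delta> powr (- (2 + \<alpha>) / p) = C * C1 powr (1 / p) * \<delta> powr - real n"
    proof -
      have "x powr (1 / p) = C1 powr (1 / p) * \<delta> powr ((2 + \<alpha> - real n * p) * (1 / p))"
        unfolding x_def using C1(1) by (simp add: powr_mult powr_powr)
      moreover have "\<delta> powr ((2 + \<alpha> - real n * p) * (1 / p)) * \<delta> powr (- (2 + \<alpha>) / p) = \<delta> powr - real n"
        unfolding powr_add[symmetric] using p by (intro arg_cong[where f="\<lambda>t. \<delta> powr t"]) (simp add: field_simps)
      ultimately show ?thesis by (simp add: mult.assoc)
    qed
    also have "\<delta> powr - real n = 1 / \<delta> ^ n" using \<delta> by (simp add: powr_minus_divide powr_realpow)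
    finally show "(1 - norm w) ^ (n + 1) * norm (deriv (T (test_fun n w)) w) \<le> C * C1 powr (1 / p)"
      using \<delta> unfolding \<delta>_def[symmetric] by (simp add: field_simps)
  qed
qed

section \<open>Reading off the conditions on \<open>g\<close>\<close>

lemma volterra_J_scale:
  assumes "f \<in> analytic_disk" "g \<in> analytic_disk" "z \<in> unit_disk"
  shows "volterra_J g (\<lambda>z. of_real t * f z) z = of_real t * volterra_J g f z"
proof -
  have "(\<lambda>\<zeta>. f \<zeta> * deriv g \<zeta>) holomorphic_on unit_disk"
    using assms by (auto simp: analytic_disk_def intro!: holomorphic_intros holomorphic_deriv)
  then have "(\<lambda>\<zeta>. f \<zeta> * deriv g \<zeta>) contour_integrable_on linepath 0 z"
    using assms(3) closed_segment_subset[of 0 unit_disk z]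
    by (intro contour_integrable_holomorphic_simple[of _ unit_disk]) auto
  then show ?thesis
    unfolding volterra_J_def by (subst contour_integral_lmul[symmetric]) (auto simp: mult.assoc)
qed

lemma volterra_I_scale:
  assumes f: "f \<in> analytic_disk" and g: "g \<in> analytic_disk" and z: "z \<in> unit_disk"
  shows "volterra_I g (\<lambda>z. of_real t * f z) z = of_real t * volterra_I g f z"
proof -
  have "(\<lambda>z. of_real t * f z) \<in> analytic_disk"
    using f by (auto simp: analytic_disk_def intro!: holomorphic_intros)
  then show ?thesis
    by (simp add: volterra_I_eq[OF _ g z] f volterra_J_scale[OF f g z] algebra_simps)
qed

text \<open>The derivative of the image at \<open>w\<close> is
  \<open>test_fun n w w * deriv g w\<close>. The test value uses up \<open>n\<close> of the
  \<open>n + 1\<close> powers of the boundary distance, and the remaining one is the Bloch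
  weight.\<close>

lemma J_mb_subset_bloch_space:
  assumes p: "p \<ge> 1" and \<alpha>: "\<alpha> > -1"
  shows "J_mb p \<alpha> \<subseteq> bloch_space"
proof
  fix g assume "g \<in> J_mb p \<alpha>"
  then have g: "g \<in> analytic_disk" and mb: "metrically_bounded p \<alpha> (volterra_J g)"
    by (auto simp: J_mb_def)
  obtain C n where C: "C > 0" "n > 0"
    "\<And>w. norm w < 1 \<Longrightarrow> (1 - norm w) ^ (n + 1) * norm (deriv (volterra_J g (test_fun n w)) w) \<le> C"
    using metrically_bounded_imp_test_fun_bound[OF p \<alpha> volterra_J_analytic(1)[OF _ g] volterra_J_scale[OF _ g] mb]
    by blast
  have "(1 - (norm w)\<^sup>2) * norm (deriv g w) \<le> 2 ^ (n + 1) * C" if "w \<in> unit_disk" for w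
  proof -
    have w: "norm w < 1" using that by simp
    define \<delta> where "\<delta> = 1 - norm w"
    define y where "y = 1 - (norm w)\<^sup>2"
    have y: "y > 0" "y \<le> 2 * \<delta>"
      using w one_minus_norm_square_le(2)[of w] by (auto simp: y_def \<delta>_def power_less_one_iff)
    have "deriv (volterra_J g (test_fun n w)) w = test_fun n w w * deriv g w"
      by (rule DERIV_imp_deriv[OF volterra_J_analytic(3)[OF test_fun_analytic[OF w] g that]])
    then have "norm (deriv (volterra_J g (test_fun n w)) w) = norm (deriv g w) / y ^ n"
      by (simp add: test_fun_def norm_mult norm_divide norm_power norm_one_minus_cnj_self[OF w] y_def)
    then have b: "\<delta> ^ (n + 1) * (norm (deriv g w) / y ^ n) \<le> C"
      using C(3)[OF w] by (simp add: \<delta>_def)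
    have "y * norm (deriv g w) = y ^ (n + 1) * (norm (deriv g w) / y ^ n)" using y by simp
    also have "\<dots> \<le> (2 * \<delta>) ^ (n + 1) * (norm (deriv g w) / y ^ n)"
      using y by (intro mult_right_mono power_mono) auto
    also have "\<dots> = 2 ^ (n + 1) * (\<delta> ^ (n + 1) * (norm (deriv g w) / y ^ n))"
      unfolding power_mult_distrib by (rule mult.assoc)
    also have "\<dots> \<le> 2 ^ (n + 1) * C" by (intro mult_left_mono b) auto
    finally show ?thesis by (simp only: y_def)
  qed
  then show "g \<in> bloch_space"
    using g unfolding bloch_space_def bdd_above_def by blast
qed

text \<open>Now the derivative of the test function appears; its denominator uses up all
  \<open>n + 1\<close> powers of the boundary distance, so that \<open>g\<close> itself is
  bounded.\<close>

lemma I_mb_subset_H_infinity: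
  assumes p: "p \<ge> 1" and \<alpha>: "\<alpha> > -1"
  shows "I_mb p \<alpha> \<subseteq> H_infinity"
proof
  fix g assume "g \<in> I_mb p \<alpha>"
  then have g: "g \<in> analytic_disk" and mb: "metrically_bounded p \<alpha> (volterra_I g)"
    by (auto simp: I_mb_def)
  obtain C n where C: "C > 0" "n > 0"
    "\<And>w. norm w < 1 \<Longrightarrow> (1 - norm w) ^ (n + 1) * norm (deriv (volterra_I g (test_fun n w)) w) \<le> C"
    using metrically_bounded_imp_test_fun_bound[OF p \<alpha> volterra_I_analytic(1)[OF _ g] volterra_I_scale[OF _ g] mb]
    by blast
  have *: "norm w * norm (g w) \<le> 2 ^ (n + 1) * C" if "w \<in> unit_disk" for w
  proof -
    have w: "norm w < 1" using that by simp
    define \<delta> where "\<delta> = 1 - norm w"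
    define y where "y = 1 - (norm w)\<^sup>2"
    have y: "y > 0" "y \<le> 2 * \<delta>"
      using w one_minus_norm_square_le(2)[of w] by (auto simp: y_def \<delta>_def power_less_one_iff)
    have "deriv (volterra_I g (test_fun n w)) w = deriv (test_fun n w) w * g w"
      by (rule DERIV_imp_deriv[OF volterra_I_analytic(3)[OF test_fun_analytic[OF w] g that]])
    also have "deriv (test_fun n w) w = of_nat n * cnj w / (1 - cnj w * w) ^ (n + 1)"
      by (rule DERIV_imp_deriv[OF test_fun_derivative[OF w w C(2)]])
    finally have d: "norm (deriv (volterra_I g (test_fun n w)) w) = real n * norm w / y ^ (n + 1) * norm (g w)"
      by (simp only: norm_mult norm_divide norm_power norm_one_minus_cnj_self[OF w] y_def) simp
    \<comment> \<open>Since \<open>n\<close> is at least 1, the factor \<open>real n\<close> of the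
      derivative can be inserted.\<close>
    have "norm w * norm (g w) * 1 \<le> norm w * norm (g w) * real n"
      using C(2) by (intro mult_left_mono) auto
    also have "\<dots> = y ^ (n + 1) * (real n * norm w / y ^ (n + 1) * norm (g w))" using y by simp
    also have "\<dots> \<le> (2 * \<delta>) ^ (n + 1) * (real n * norm w / y ^ (n + 1) * norm (g w))"
      using y by (intro mult_right_mono power_mono) auto
    also have "\<dots> = 2 ^ (n + 1) * (\<delta> ^ (n + 1) * (real n * norm w / y ^ (n + 1) * norm (g w)))"
      unfolding power_mult_distrib by (rule mult.assoc)
    also have "\<dots> \<le> 2 ^ (n + 1) * C"
      using C(3)[OF w] d by (intro mult_left_mono) (auto simp: \<delta>_def)
    finally show ?thesis by simp
  qed
  \<comment> \<open>The factor \<open>norm w\<close> makes the estimate degenerate at the origin, so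
    the inner disc is handled by compactness.\<close>
  have "compact (g ` cball 0 (1/2))"
    using g by (intro compact_continuous_image holomorphic_on_imp_continuous_on)
       (auto simp: analytic_disk_def intro: holomorphic_on_subset)
  then have "bounded (g ` cball 0 (1/2))" by (rule compact_imp_bounded)
  then obtain B where B: "\<And>w. w \<in> cball 0 (1/2) \<Longrightarrow> norm (g w) \<le> B"
    unfolding bounded_iff by blast
  have "norm (g w) \<le> max B (2 * (2 ^ (n + 1) * C))" if w: "w \<in> unit_disk" for w
  proof (cases "norm w \<le> 1/2")
    case True
    then show ?thesis using B[of w] by simp
  next
    case False
    have "1/2 * norm (g w) \<le> norm w * norm (g w)" using False by (intro mult_right_mono) auto
    then show ?thesis using *[OF w] by simp
  qed
  then show "g \<in> H_infinity"
    using g unfolding H_infinity_def bounded_iff by blast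
qed

theorem theorem1p2:
  fixes p \<alpha> :: real
  assumes "1 \<le> p" and "\<alpha> > -1"
  shows "J_mb p \<alpha> = bloch_space \<and> I_mb p \<alpha> = H_infinity"
  using bloch_space_subset_J_mb[OF assms] J_mb_subset_bloch_space[OF assms]
    H_infinity_subset_I_mb[OF assms] I_mb_subset_H_infinity[OF assms] by blast

end
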